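(* Let $\ell\in\{6,7,8\}$ and let $G$ be an $\mathsf E_\ell$-graded group. Then there exist a commutative unital ring $K$ and a group homomorphism $Q\colon\mathrm{St}(\mathsf E_\ell,K)\to G$ inducing isomorphisms between the root subgroups. Moreover, fix such $K$ and $Q$. For a commutative unital ring $K'$, the homomorphisms $Q'\colon\mathrm{St}(\mathsf E_\ell,K')\to G$ inducing isomorphisms between the root subgroups are precisely those of the following type: choose a ring isomorphism $F\colon K'\to K$ and an element $(a_\alpha)_{\alpha\in\mathsf E_\ell}\in T^{\mathrm{ad}}(\mathsf E_\ell,K)$ and let $Q'(t_\alpha(x))=Q\bigl(t_\alpha(a_\alpha\,F(x))\bigr)$ for all $\alpha\in\mathsf E_\ell$, $x\in K'$. Both $F$ and $(a_\alpha)_\alpha$ are uniquely determined by $Q'$.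
   Context: Conventions: $[f,g]=fgf^{-1}g^{-1}$, ${}^{f}g=fgf^{-1}$. For a root system $\Phi$ and linearly independent $\alpha,\beta\in\Phi$ let $]\alpha,\beta[\;=\Phi\cap(\mathbb R_{>0}\alpha+\mathbb R_{>0}\beta)$. A subset $\Sigma\subseteq\Phi$ is special closed if it is the intersection of $\Phi$ with a convex cone not containing opposite non-zero vectors; $\alpha\in\Sigma$ is extreme if it lies on an extreme ray of the conical convex hull of $\Sigma$. A group $G$ has $\Phi$-commutator relations if it has a family of subgroups $(G_\alpha)_{\alpha\in\Phi}$ such that $[G_\alpha,G_\beta]\le\langle G_\gamma\mid\gamma\in\,]\alpha,\beta[\,\rangle$ for all linearly independent $\alpha,\beta\in\Phi$, and $G_\alpha\cap\langle G_\beta\mid\beta\in\Sigma\setminus\{\alpha\}\rangle=1$ for all special closed $\Sigma\subseteq\Phi$ and all extreme $\alpha\in\Sigma$. An $\alpha$-Weyl element is an element $n\in G_\alpha G_{-\alpha}G_\alpha$ with ${}^nG_\beta=G_{s_\alpha(\beta)}$ for all $\beta\in\Phi$, where $s_\alpha$ is the reflection. $G$ is $\Phi$-graded if moreover for every $\alpha\in\Phi$ there exists an $\alpha$-Weyl element. Fix parametrizations $t_\alpha$ ($\alpha\in\mathsf E_\ell$) of the root subgroups of the adjoint Chevalley group $G^{\mathrm{ad}}(\mathsf E_\ell,\mathbb C)$ as in the Chevalley commutator formula, and let $N_{\alpha\beta}=N_{\alpha\beta11}\in\{-1,1\}$ be the structure constants: $[t_\alpha(x),t_\beta(y)]=t_{\alpha+\beta}(N_{\alpha\beta}xy)$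 when $\alpha,\beta,\alpha+\beta\in\mathsf E_\ell$. For a commutative unital ring $K$, $\mathrm{St}(\mathsf E_\ell,K)$ is the group with generators $t_\alpha(x)$, $\alpha\in\mathsf E_\ell$, $x\in K$, and relations $t_\alpha(x)t_\alpha(x')=t_\alpha(x+x')$; $[t_\alpha(x),t_\beta(y)]=t_{\alpha+\beta}(N_{\alpha\beta}xy)$ if $\alpha+\beta\in\mathsf E_\ell$; $[t_\alpha(x),t_\beta(y)]=1$ if $\beta\ne-\alpha$ and $\alpha+\beta\notin\mathsf E_\ell$. It is $\mathsf E_\ell$-graded with root subgroups $t_\alpha(K)$. Here $T^{\mathrm{ad}}(\mathsf E_\ell,K)=\{(a_\alpha\in K^* )_{\alpha\in\mathsf E_\ell}\mid a_{\alpha+\beta}=a_\alpha a_\beta\text{ whenever }\alpha,\beta,\alpha+\beta\in\mathsf E_\ell\}$. "$Q$ induces isomorphisms between the root subgroups" means that $x\mapsto Q(t_\alpha(x))$ is an isomorphism of the additive group of the ring onto $G_\alpha$ for all $\alpha$. *)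

theory Defs
  imports
    "HOL-Analysis.Analysis"
    "HOL-Algebra.Generated_Groups"
    "HOL-Algebra.Bij"
    "HOL-Algebra.QuotRing"
begin

section \<open>Root systems\<close>

definition coroot :: "'v::euclidean_space \<Rightarrow> 'v" where
  "coroot \<alpha> = (2 / (\<alpha> \<bullet> \<alpha>)) *\<^sub>R \<alpha>"

definition reflection :: "'v::euclidean_space \<Rightarrow> 'v \<Rightarrow> 'v" where
  "reflection \<alpha> \<beta> = \<beta> - (\<beta> \<bullet> coroot \<alpha>) *\<^sub>R \<alpha>"

text \<open>
  The root systems of type E in Bourbaki's coordinates: E8 consists of the vectors of squared
  norm 2 in the E8 lattice, E7 of the roots of E8 orthogonal to the sum of the last two basis
  vectors, and E6 of the roots whose last three coordinates are of the form (t, t, -t).  They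
  span subspaces of dimension 8, 7, 6.  Only the parameter values 6, 7, 8 are meaningful.
  (In the index type 8 the numeral 8 denotes the same element as 0.)
\<close>

definition E_roots :: "nat \<Rightarrow> (real^8) set" where
  "E_roots l = {v. v \<bullet> v = 2
      \<and> ((\<forall>i. v $ i \<in> \<int>) \<or> (\<forall>i. v $ i - 1/2 \<in> \<int>))
      \<and> (\<exists>k::int. (\<Sum>i\<in>UNIV. v $ i) = 2 * of_int k)
      \<and> (l \<le> 7 \<longrightarrow> v $ 7 + v $ 8 = 0)
      \<and> (l \<le> 6 \<longrightarrow> v $ 6 = v $ 7)}"

definition open_root_interval :: "'v::euclidean_space set \<Rightarrow> 'v \<Rightarrow> 'v \<Rightarrow> 'v set" where
  "open_root_interval \<Phi> \<alpha> \<beta> = \<Phi> \<inter> {a *\<^sub>R \<alpha> + b *\<^sub>R \<beta> | a b. a > 0 \<and> b > 0}"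

text \<open>
  The cones of \<^const>\<open>convex_cone\<close> contain 0; this does not affect the intersection with a set of
  roots.
\<close>

definition special_closed :: "'v::euclidean_space set \<Rightarrow> 'v set \<Rightarrow> bool" where
  "special_closed \<Phi> \<Sigma> \<longleftrightarrow>
     (\<exists>C. convex_cone C \<and> (\<forall>v\<in>C. - v \<in> C \<longrightarrow> v = 0) \<and> \<Sigma> = \<Phi> \<inter> C)"

definition extreme_ray_of :: "'v::euclidean_space set \<Rightarrow> 'v set \<Rightarrow> bool" where
  "extreme_ray_of R C \<longleftrightarrow> R face_of C \<and> (\<exists>v. v \<noteq> 0 \<and> R = {c *\<^sub>R v | c. c \<ge> 0})"

definition extreme_root :: "'v::euclidean_space set \<Rightarrow> 'v \<Rightarrow> bool" where
  "extreme_root \<Sigma> \<alpha> \<longleftrightarrow>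
     \<alpha> \<in> \<Sigma> \<and> (\<exists>R. extreme_ray_of R (convex_cone hull \<Sigma>) \<and> \<alpha> \<in> R)"


section \<open>Root graded groups\<close>

definition group_commutator :: "('g, 'c) monoid_scheme \<Rightarrow> 'g \<Rightarrow> 'g \<Rightarrow> 'g" where
  "group_commutator G f g = f \<otimes>\<^bsub>G\<^esub> g \<otimes>\<^bsub>G\<^esub> inv\<^bsub>G\<^esub> f \<otimes>\<^bsub>G\<^esub> inv\<^bsub>G\<^esub> g"

definition commutator_subgroup :: "('g, 'c) monoid_scheme \<Rightarrow> 'g set \<Rightarrow> 'g set \<Rightarrow> 'g set" where
  "commutator_subgroup G A B = generate G {group_commutator G f g | f g. f \<in> A \<and> g \<in> B}"

text \<open>
  The guard \<open>\<alpha> \<noteq> \<beta>\<close> is needed because \<open>{\<alpha>, \<alpha>}\<close> collapses to the independent set \<open>{\<alpha>}\<close>.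
\<close>

definition commutator_relations ::
  "('g, 'c) monoid_scheme \<Rightarrow> 'v::euclidean_space set \<Rightarrow> ('v \<Rightarrow> 'g set) \<Rightarrow> bool" where
  "commutator_relations G \<Phi> U \<longleftrightarrow>
     (\<forall>\<alpha>\<in>\<Phi>. subgroup (U \<alpha>) G)
   \<and> (\<forall>\<alpha>\<in>\<Phi>. \<forall>\<beta>\<in>\<Phi>. \<alpha> \<noteq> \<beta> \<and> independent {\<alpha>, \<beta>} \<longrightarrow>
        commutator_subgroup G (U \<alpha>) (U \<beta>)
          \<subseteq> generate G (\<Union>\<gamma> \<in> open_root_interval \<Phi> \<alpha> \<beta>. U \<gamma>))
   \<and> (\<forall>\<Sigma> \<alpha>. special_closed \<Phi> \<Sigma> \<and> extreme_root \<Sigma> \<alpha> \<longrightarrow>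
        U \<alpha> \<inter> generate G (\<Union>\<beta> \<in> \<Sigma> - {\<alpha>}. U \<beta>) = {\<one>\<^bsub>G\<^esub>})"

definition weyl_element ::
  "('g, 'c) monoid_scheme \<Rightarrow> 'v::euclidean_space set \<Rightarrow> ('v \<Rightarrow> 'g set) \<Rightarrow> 'v \<Rightarrow> 'g \<Rightarrow> bool" where
  "weyl_element G \<Phi> U \<alpha> n \<longleftrightarrow>
     n \<in> (U \<alpha> <#>\<^bsub>G\<^esub> U (- \<alpha>)) <#>\<^bsub>G\<^esub> U \<alpha>
   \<and> (\<forall>\<beta>\<in>\<Phi>. {n \<otimes>\<^bsub>G\<^esub> g \<otimes>\<^bsub>G\<^esub> inv\<^bsub>G\<^esub> n | g. g \<in> U \<beta>} = U (reflection \<alpha> \<beta>))"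

definition root_graded_group ::
  "('g, 'c) monoid_scheme \<Rightarrow> 'v::euclidean_space set \<Rightarrow> ('v \<Rightarrow> 'g set) \<Rightarrow> bool" where
  "root_graded_group G \<Phi> U \<longleftrightarrow>
     group G \<and> commutator_relations G \<Phi> U \<and> (\<forall>\<alpha>\<in>\<Phi>. \<exists>n. weyl_element G \<Phi> U \<alpha> n)"


section \<open>Adjoint Chevalley groups over the complex numbers\<close>

definition complex_lie_algebra ::
  "(complex \<Rightarrow> 'l::ab_group_add \<Rightarrow> 'l) \<Rightarrow> ('l \<Rightarrow> 'l \<Rightarrow> 'l) \<Rightarrow> bool" where
  "complex_lie_algebra sc br \<longleftrightarrow>
     vector_space sc
   \<and> (\<forall>x. Vector_Spaces.linear sc sc (br x))
   \<and> (\<forall>y. Vector_Spaces.linear sc sc (\<lambda>x. br x y))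
   \<and> (\<forall>x. br x x = 0)
   \<and> (\<forall>x y z. br x (br y z) + br y (br z x) + br z (br x y) = 0)"

text \<open>
  \<open>e\<close> is the family of root vectors of a Chevalley basis of a complex semisimple Lie algebra
  with root system \<open>\<Phi>\<close>.  The elements \<open>h \<alpha>\<close> are the coroots.  Since they act by the weights
  below, the spanning and dimension conditions say that the \<open>e \<alpha>\<close> together with the coroots of
  a base of \<open>\<Phi>\<close> form a basis of the Lie algebra.  The number \<open>p\<close> is the largest one such that
  \<open>\<beta> - p \<alpha>\<close> is a root.
\<close>

definition chevalley_basis ::
  "'v::euclidean_space set \<Rightarrow> (complex \<Rightarrow> 'l::ab_group_add \<Rightarrow> 'l) \<Rightarrow> ('l \<Rightarrow> 'l \<Rightarrow> 'l)
    \<Rightarrow> ('v \<Rightarrow> 'l) \<Rightarrow> bool" where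
  "chevalley_basis \<Phi> sc br e \<longleftrightarrow>
     complex_lie_algebra sc br
   \<and> (let h = (\<lambda>\<alpha>. br (e \<alpha>) (e (- \<alpha>))) in
        Modules.module.span sc (h ` \<Phi> \<union> e ` \<Phi>) = UNIV
      \<and> vector_space.dim sc (UNIV :: 'l set) = dim \<Phi> + card \<Phi>
      \<and> (\<forall>\<alpha>\<in>\<Phi>. \<forall>\<beta>\<in>\<Phi>. br (h \<alpha>) (h \<beta>) = 0)
      \<and> (\<forall>\<alpha>\<in>\<Phi>. \<forall>\<beta>\<in>\<Phi>. br (h \<alpha>) (e \<beta>) = sc (of_real (\<beta> \<bullet> coroot \<alpha>)) (e \<beta>))
      \<and> (\<forall>\<alpha>\<in>\<Phi>. \<forall>\<beta>\<in>\<Phi>. \<alpha> + \<beta> \<in> \<Phi> \<longrightarrow>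
           (let p = (GREATEST k::nat. \<beta> - real k *\<^sub>R \<alpha> \<in> \<Phi>) in
              \<exists>\<epsilon>\<in>{1, -1}. br (e \<alpha>) (e \<beta>) = sc (\<epsilon> * of_nat (p + 1)) (e (\<alpha> + \<beta>))))
      \<and> (\<forall>\<alpha>\<in>\<Phi>. \<forall>\<beta>\<in>\<Phi>. \<alpha> + \<beta> \<notin> \<Phi> \<and> \<alpha> + \<beta> \<noteq> 0 \<longrightarrow> br (e \<alpha>) (e \<beta>) = 0))"

text \<open>The exponential series, which has only finitely many non-zero terms for nilpotent \<open>f\<close>.\<close>

definition nilpotent_exp ::
  "(complex \<Rightarrow> 'l::ab_group_add \<Rightarrow> 'l) \<Rightarrow> ('l \<Rightarrow> 'l) \<Rightarrow> 'l \<Rightarrow> 'l" where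
  "nilpotent_exp sc f v = (\<Sum>k | (f ^^ k) v \<noteq> 0. sc (1 / fact k) ((f ^^ k) v))"

definition chevalley_root_subgroup ::
  "(complex \<Rightarrow> 'l::ab_group_add \<Rightarrow> 'l) \<Rightarrow> ('l \<Rightarrow> 'l \<Rightarrow> 'l) \<Rightarrow> ('v \<Rightarrow> 'l) \<Rightarrow> 'v
    \<Rightarrow> ('l \<Rightarrow> 'l) set" where
  "chevalley_root_subgroup sc br e \<alpha> = range (\<lambda>x. nilpotent_exp sc (br (sc x (e \<alpha>))))"

definition adjoint_chevalley_group ::
  "'v set \<Rightarrow> (complex \<Rightarrow> 'l::ab_group_add \<Rightarrow> 'l) \<Rightarrow> ('l \<Rightarrow> 'l \<Rightarrow> 'l) \<Rightarrow> ('v \<Rightarrow> 'l)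
    \<Rightarrow> ('l \<Rightarrow> 'l) monoid" where
  "adjoint_chevalley_group \<Phi> sc br e =
     (BijGroup UNIV)\<lparr>carrier :=
        generate (BijGroup UNIV) (\<Union>\<alpha>\<in>\<Phi>. chevalley_root_subgroup sc br e \<alpha>)\<rparr>"

text \<open>
  A parametrization of a root subgroup is determined up to a non-zero scalar \<open>c \<alpha>\<close>, the images of
  the parametrizations being the root subgroups above.
\<close>

definition root_subgroup_parametrizations ::
  "'v set \<Rightarrow> (complex \<Rightarrow> 'l::ab_group_add \<Rightarrow> 'l) \<Rightarrow> ('l \<Rightarrow> 'l \<Rightarrow> 'l) \<Rightarrow> ('v \<Rightarrow> 'l)
    \<Rightarrow> ('v \<Rightarrow> complex \<Rightarrow> 'l \<Rightarrow> 'l) \<Rightarrow> bool" where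
  "root_subgroup_parametrizations \<Phi> sc br e t \<longleftrightarrow>
     (\<exists>c. \<forall>\<alpha>\<in>\<Phi>. c \<alpha> \<noteq> 0 \<and> (\<forall>x. t \<alpha> x = nilpotent_exp sc (br (sc (c \<alpha> * x) (e \<alpha>)))))"

text \<open>The Chevalley commutator formula in the simply laced case.\<close>

definition structure_constants ::
  "('h, 'c) monoid_scheme \<Rightarrow> 'v::ab_group_add set \<Rightarrow> ('v \<Rightarrow> complex \<Rightarrow> 'h)
    \<Rightarrow> ('v \<Rightarrow> 'v \<Rightarrow> int) \<Rightarrow> bool" where
  "structure_constants H \<Phi> t N \<longleftrightarrow>
     (\<forall>\<alpha>\<in>\<Phi>. \<forall>\<beta>\<in>\<Phi>. \<alpha> + \<beta> \<in> \<Phi> \<longrightarrow>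
        N \<alpha> \<beta> \<in> {-1, 1}
      \<and> (\<forall>x y. group_commutator H (t \<alpha> x) (t \<beta> y) = t (\<alpha> + \<beta>) (of_int (N \<alpha> \<beta>) * x * y)))"


section \<open>Groups given by generators and relations\<close>

text \<open>
  A letter \<open>(s, True)\<close> stands for the generator \<open>s\<close> and \<open>(s, False)\<close> for its inverse.  A
  relation is a pair of words that become equal in the presented group.
\<close>

type_synonym 's word = "('s \<times> bool) list"

definition words :: "'s set \<Rightarrow> 's word set" where
  "words S = lists (S \<times> UNIV)"

definition inv_word :: "'s word \<Rightarrow> 's word" where
  "inv_word w = rev (map (\<lambda>(s, b). (s, \<not> b)) w)"

definition comm_word :: "'s word \<Rightarrow> 's word \<Rightarrow> 's word" where
  "comm_word u v = u @ v @ inv_word u @ inv_word v"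

inductive_set word_congruence :: "'s set \<Rightarrow> ('s word \<times> 's word) set \<Rightarrow> ('s word \<times> 's word) set"
  for S R where
  refl: "w \<in> words S \<Longrightarrow> (w, w) \<in> word_congruence S R"
| sym: "(u, v) \<in> word_congruence S R \<Longrightarrow> (v, u) \<in> word_congruence S R"
| trans: "(u, v) \<in> word_congruence S R \<Longrightarrow> (v, w) \<in> word_congruence S R
    \<Longrightarrow> (u, w) \<in> word_congruence S R"
| append: "(u, v) \<in> word_congruence S R \<Longrightarrow> (u', v') \<in> word_congruence S R
    \<Longrightarrow> (u @ u', v @ v') \<in> word_congruence S R"
| cancel: "s \<in> S \<Longrightarrow> ([(s, b), (s, \<not> b)], []) \<in> word_congruence S R"
| relation: "(u, v) \<in> R \<Longrightarrow> u \<in> words S \<Longrightarrow> v \<in> words S \<Longrightarrow> (u, v) \<in> word_congruence S R"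

definition presented_group :: "'s set \<Rightarrow> ('s word \<times> 's word) set \<Rightarrow> 's word set monoid" where
  "presented_group S R =
     \<lparr>carrier = words S // word_congruence S R,
      mult = (\<lambda>A B. \<Union>u\<in>A. \<Union>v\<in>B. word_congruence S R `` {u @ v}),
      one = word_congruence S R `` {[]}\<rparr>"

definition presented_generator :: "'s set \<Rightarrow> ('s word \<times> 's word) set \<Rightarrow> 's \<Rightarrow> 's word set" where
  "presented_generator S R s = word_congruence S R `` {[(s, True)]}"


section \<open>Steinberg groups\<close>

definition steinberg_generators ::
  "'v set \<Rightarrow> ('k, 'c) ring_scheme \<Rightarrow> ('v \<times> 'k) set" where
  "steinberg_generators \<Phi> K = \<Phi> \<times> carrier K"

definition steinberg_relations ::
  "'v::ab_group_add set \<Rightarrow> ('v \<Rightarrow> 'v \<Rightarrow> int) \<Rightarrow> ('k, 'c) ring_scheme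
    \<Rightarrow> (('v \<times> 'k) word \<times> ('v \<times> 'k) word) set" where
  "steinberg_relations \<Phi> N K =
     (let t = (\<lambda>\<alpha> x. [((\<alpha>, x), True)]) in
        {(t \<alpha> x @ t \<alpha> x', t \<alpha> (x \<oplus>\<^bsub>K\<^esub> x')) | \<alpha> x x'.
           \<alpha> \<in> \<Phi> \<and> x \<in> carrier K \<and> x' \<in> carrier K}
      \<union> {(comm_word (t \<alpha> x) (t \<beta> y), t (\<alpha> + \<beta>) ([N \<alpha> \<beta>] \<cdot>\<^bsub>K\<^esub> (x \<otimes>\<^bsub>K\<^esub> y))) | \<alpha> \<beta> x y.
           \<alpha> \<in> \<Phi> \<and> \<beta> \<in> \<Phi> \<and> \<alpha> + \<beta> \<in> \<Phi> \<and> x \<in> carrier K \<and> y \<in> carrier K}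
      \<union> {(comm_word (t \<alpha> x) (t \<beta> y), []) | \<alpha> \<beta> x y.
           \<alpha> \<in> \<Phi> \<and> \<beta> \<in> \<Phi> \<and> \<beta> \<noteq> - \<alpha> \<and> \<alpha> + \<beta> \<notin> \<Phi> \<and> x \<in> carrier K \<and> y \<in> carrier K})"

definition steinberg_group ::
  "'v::ab_group_add set \<Rightarrow> ('v \<Rightarrow> 'v \<Rightarrow> int) \<Rightarrow> ('k, 'c) ring_scheme
    \<Rightarrow> ('v \<times> 'k) word set monoid" where
  "steinberg_group \<Phi> N K =
     presented_group (steinberg_generators \<Phi> K) (steinberg_relations \<Phi> N K)"

definition steinberg_elt ::
  "'v::ab_group_add set \<Rightarrow> ('v \<Rightarrow> 'v \<Rightarrow> int) \<Rightarrow> ('k, 'c) ring_scheme \<Rightarrow> 'v \<Rightarrow> 'k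
    \<Rightarrow> ('v \<times> 'k) word set" where
  "steinberg_elt \<Phi> N K \<alpha> x =
     presented_generator (steinberg_generators \<Phi> K) (steinberg_relations \<Phi> N K) (\<alpha>, x)"

definition induces_root_isos ::
  "('g, 'd) monoid_scheme \<Rightarrow> 'v::ab_group_add set \<Rightarrow> ('v \<Rightarrow> 'g set) \<Rightarrow> ('v \<Rightarrow> 'v \<Rightarrow> int)
    \<Rightarrow> ('k, 'c) ring_scheme \<Rightarrow> (('v \<times> 'k) word set \<Rightarrow> 'g) \<Rightarrow> bool" where
  "induces_root_isos G \<Phi> U N K Q \<longleftrightarrow>
     (\<forall>\<alpha>\<in>\<Phi>. (\<lambda>x. Q (steinberg_elt \<Phi> N K \<alpha> x)) \<in> iso (add_monoid K) (G\<lparr>carrier := U \<alpha>\<rparr>))"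

definition adjoint_torus ::
  "'v::ab_group_add set \<Rightarrow> ('k, 'c) ring_scheme \<Rightarrow> ('v \<Rightarrow> 'k) set" where
  "adjoint_torus \<Phi> K =
     {a \<in> \<Phi> \<rightarrow>\<^sub>E Units K.
        \<forall>\<alpha>\<in>\<Phi>. \<forall>\<beta>\<in>\<Phi>. \<alpha> + \<beta> \<in> \<Phi> \<longrightarrow> a (\<alpha> + \<beta>) = a \<alpha> \<otimes>\<^bsub>K\<^esub> a \<beta>}"

definition twisted_by ::
  "'v::ab_group_add set \<Rightarrow> ('v \<Rightarrow> 'v \<Rightarrow> int) \<Rightarrow> ('k, 'c) ring_scheme
    \<Rightarrow> (('v \<times> 'k) word set \<Rightarrow> 'g) \<Rightarrow> ('m, 'd) ring_scheme \<Rightarrow> (('v \<times> 'm) word set \<Rightarrow> 'g)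
    \<Rightarrow> ('m \<Rightarrow> 'k) \<Rightarrow> ('v \<Rightarrow> 'k) \<Rightarrow> bool" where
  "twisted_by \<Phi> N K Q K' Q' F a \<longleftrightarrow>
     (\<forall>\<alpha>\<in>\<Phi>. \<forall>x\<in>carrier K'.
        Q' (steinberg_elt \<Phi> N K' \<alpha> x) = Q (steinberg_elt \<Phi> N K \<alpha> (a \<alpha> \<otimes>\<^bsub>K\<^esub> F x)))"

end

theory Submission
  imports Defs
begin

text \<open>
  By a computation with the factors of a Weyl element, an \<open>\<alpha>\<close>-Weyl element \<open>n = b\<^sub>1 b\<^sub>2 b\<^sub>3\<close> acts on
  \<open>U \<beta>\<close> for \<open>\<alpha> \<bullet> \<beta> = -1\<close> as \<open>x \<mapsto> [b\<^sub>3, x]\<close>.  So \<open>b\<^sub>3\<close> is invertible for the commutator maps, and the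
  root subgroups are abelian.  The structure constants \<open>N\<close> satisfy the same sign identities as the
  commutators, so \<open>x * y = [x, y]\<^bsup>N\<^esup>\<close> is a biadditive, commutative and associative partial product
  \<open>U \<alpha> \<times> U \<beta> \<rightarrow> U (\<alpha> + \<beta>)\<close>, and no signs occur any more.

  Let \<open>\<theta>\<close> be a root and order the roots by a generic linear functional close to the inner product
  with \<open>\<theta>\<close>, so that \<open>\<theta>\<close> is the largest root.  Choose invertible elements \<open>u \<alpha>\<close> for positive
  \<open>\<alpha>\<close> with \<open>u \<alpha> * u \<beta> = u (\<alpha> + \<beta>)\<close>.  Multiplication by these elements moves every root subgroup
  upwards to \<open>U \<theta>\<close>, independently of the path: any two upward steps from a root are completed to a
  triangle or a square, or are both linked to a third one.  The product transported to \<open>U \<theta>\<close> does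
  not depend on the pair \<open>(\<alpha>, \<beta>)\<close> with \<open>\<alpha> \<bullet> \<beta> = -1\<close>, because all such pairs are connected by
  exchanging one root at a time.  Since \<open>(\<beta>, \<alpha>)\<close> is one of them, the ring \<open>U \<theta>\<close> is commutative.

  Two coordinatizations differ on \<open>U \<alpha>\<close> by an additive bijection \<open>g \<alpha>\<close> with
  \<open>g (\<alpha> + \<beta>) (x y) = g \<alpha> x g \<beta> y\<close>, so \<open>a \<alpha> = g \<alpha> 1\<close> and \<open>F x = (a \<alpha>)\<^sup>-\<^sup>1 g \<alpha> x\<close>, which is independent
  of \<open>\<alpha>\<close>.
\<close>

subsection \<open>Simply laced root systems\<close>

text \<open>Once type E has been checked, everything is about a finite irreducible simply laced root
  system containing a D4 diagram. The branch node of D4 forces commutativity: in type A the pairs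
  with inner product -1 fall into two classes, interchanged by swapping, one belonging to a ring and
  the other to its opposite. The sign identities of \<open>N\<close> come from the Jacobi identity,
  because \<open>N\<close> arises from the structure constants of the Lie algebra by rescaling the
  root vectors. A coherent choice of the \<open>u \<alpha>\<close> is an induction on positive
  roots, where both summands precede their sum. Transport therefore goes upwards only, and the order
  must leave \<theta> as the sole root without an upward step. The levels \<theta> \<bullet>
  \<gamma> have ties, and a step within a level would have no direction. A perturbation below 1/2
  breaks the ties and, as two errors stay below 1, keeps distinct levels in order. The obstacle in
  comparing paths is a root \<gamma> = \<delta> + \<delta>' with both summands above it: its two
  upward steps fit into neither a triangle nor a square, so a third step has to be found.\<close>

definition D4_extends :: "'v::euclidean_space set \<Rightarrow> 'v \<Rightarrow> 'v \<Rightarrow> bool" where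
  "D4_extends \<Phi> \<alpha> \<beta> \<longleftrightarrow> (\<exists>\<gamma>\<in>\<Phi>. \<exists>\<delta>\<in>\<Phi>. \<gamma> \<bullet> \<delta> = 0 \<and> \<gamma> \<bullet> \<alpha> = 0 \<and> \<delta> \<bullet> \<alpha> = 0
     \<and> \<gamma> \<bullet> \<beta> = -1 \<and> \<delta> \<bullet> \<beta> = -1)"

lemmas inner_expand = inner_add_left inner_add_right inner_diff_left inner_diff_right inner_commute

text \<open>\<open>some_D4\<close> asks for a single D4 diagram, with \<beta> as branch node and
  \<alpha>, \<gamma>, \<delta> as legs; reflections spread it to all pairs with inner product -1.
  \<open>irreducible\<close> speaks of chains of non-orthogonal roots because the arguments are
  inductions along such chains.\<close>

locale simply_laced =
  fixes \<Phi> :: "'v::euclidean_space set"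
  assumes finite_roots: "finite \<Phi>"
    and norm_root: "\<alpha> \<in> \<Phi> \<Longrightarrow> \<alpha> \<bullet> \<alpha> = 2"
    and ip_Ints: "\<alpha> \<in> \<Phi> \<Longrightarrow> \<beta> \<in> \<Phi> \<Longrightarrow> \<alpha> \<bullet> \<beta> \<in> \<int>"
    and reflect: "\<alpha> \<in> \<Phi> \<Longrightarrow> \<beta> \<in> \<Phi> \<Longrightarrow> \<beta> - (\<beta> \<bullet> \<alpha>) *\<^sub>R \<alpha> \<in> \<Phi>"
    and irreducible: "\<alpha> \<in> \<Phi> \<Longrightarrow> \<beta> \<in> \<Phi> \<Longrightarrow> (\<lambda>x y. x \<in> \<Phi> \<and> y \<in> \<Phi> \<and> x \<bullet> y \<noteq> 0)\<^sup>*\<^sup>* \<alpha> \<beta>"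
    and some_D4: "\<exists>\<alpha>\<in>\<Phi>. \<exists>\<beta>\<in>\<Phi>. \<alpha> \<bullet> \<beta> = -1 \<and> D4_extends \<Phi> \<alpha> \<beta>"
begin

lemma uminus_root [simp]: "- \<alpha> \<in> \<Phi> \<longleftrightarrow> \<alpha> \<in> \<Phi>"
proof -
  have "- \<alpha> \<in> \<Phi>" if "\<alpha> \<in> \<Phi>" for \<alpha>
    using reflect[OF that that] by (simp add: norm_root[OF that] scaleR_2)
  from this[of \<alpha>] this[of "- \<alpha>"] show ?thesis by auto
qed

lemma zero_not_root [simp]: "0 \<notin> \<Phi>"
  using norm_root by fastforce

lemma ip_2_iff: assumes "\<alpha> \<in> \<Phi>" "\<beta> \<in> \<Phi>" shows "\<alpha> \<bullet> \<beta> = 2 \<longleftrightarrow> \<alpha> = \<beta>"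
proof
  assume "\<alpha> \<bullet> \<beta> = 2"
  then have "(\<alpha> - \<beta>) \<bullet> (\<alpha> - \<beta>) = 0"
    using assms by (simp add: inner_diff_left inner_diff_right norm_root inner_commute)
  then show "\<alpha> = \<beta>" by simp
qed (use assms norm_root in auto)

lemma ip_m2_iff: assumes "\<alpha> \<in> \<Phi>" "\<beta> \<in> \<Phi>" shows "\<alpha> \<bullet> \<beta> = -2 \<longleftrightarrow> \<alpha> = - \<beta>"
  using ip_2_iff[of \<alpha> "- \<beta>"] assms by auto

lemma ip_cases:
  assumes "\<alpha> \<in> \<Phi>" "\<beta> \<in> \<Phi>"
  shows "\<alpha> \<bullet> \<beta> = 2 \<or> \<alpha> \<bullet> \<beta> = 1 \<or> \<alpha> \<bullet> \<beta> = 0 \<or> \<alpha> \<bullet> \<beta> = -1 \<or> \<alpha> \<bullet> \<beta> = -2"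
proof -
  obtain k :: int where k: "\<alpha> \<bullet> \<beta> = of_int k" using ip_Ints[OF assms] by (auto elim: Ints_cases)
  have "(\<alpha> \<bullet> \<beta>)\<^sup>2 \<le> (\<alpha> \<bullet> \<alpha>) * (\<beta> \<bullet> \<beta>)" by (rule Cauchy_Schwarz_ineq)
  then have "(\<alpha> \<bullet> \<beta>)\<^sup>2 \<le> 2\<^sup>2" using assms by (simp add: norm_root)
  then have "\<bar>\<alpha> \<bullet> \<beta>\<bar> \<le> 2" using abs_le_square_iff[of "\<alpha> \<bullet> \<beta>" 2] by simp
  then have "\<bar>k\<bar> \<le> 2" using k by linarith
  then have "k = 2 \<or> k = 1 \<or> k = 0 \<or> k = -1 \<or> k = -2" by arith
  then show ?thesis using k by auto
qed

lemma add_root: "\<alpha> \<in> \<Phi> \<Longrightarrow> \<beta> \<in> \<Phi> \<Longrightarrow> \<alpha> \<bullet> \<beta> = -1 \<Longrightarrow> \<alpha> + \<beta> \<in> \<Phi>"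
  using reflect[of \<beta> \<alpha>] by simp

lemma diff_root: "\<alpha> \<in> \<Phi> \<Longrightarrow> \<beta> \<in> \<Phi> \<Longrightarrow> \<alpha> \<bullet> \<beta> = 1 \<Longrightarrow> \<alpha> - \<beta> \<in> \<Phi>"
  using reflect[of \<beta> \<alpha>] by simp

lemma add_root_iff:
  assumes "\<alpha> \<in> \<Phi>" "\<beta> \<in> \<Phi>" shows "\<alpha> + \<beta> \<in> \<Phi> \<longleftrightarrow> \<alpha> \<bullet> \<beta> = -1"
proof
  assume "\<alpha> + \<beta> \<in> \<Phi>"
  then have "(\<alpha> + \<beta>) \<bullet> (\<alpha> + \<beta>) = 2" by (rule norm_root)
  then show "\<alpha> \<bullet> \<beta> = -1"
    using assms by (simp add: inner_add_left inner_add_right norm_root inner_commute)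
qed (use assms add_root in auto)

lemma reflection_eq: "\<alpha> \<in> \<Phi> \<Longrightarrow> reflection \<alpha> \<beta> = \<beta> - (\<beta> \<bullet> \<alpha>) *\<^sub>R \<alpha>"
  by (simp add: reflection_def coroot_def norm_root)

lemma reflection_root: "\<alpha> \<in> \<Phi> \<Longrightarrow> \<beta> \<in> \<Phi> \<Longrightarrow> reflection \<alpha> \<beta> \<in> \<Phi>"
  by (simp add: reflection_eq reflect)

lemma reflection_ip: "\<alpha> \<in> \<Phi> \<Longrightarrow> reflection \<alpha> \<beta> \<bullet> reflection \<alpha> \<gamma> = \<beta> \<bullet> \<gamma>"
  by (simp add: reflection_eq inner_diff_left inner_diff_right norm_root inner_commute)

section \<open>Extending pairs of roots to A3 and D4 diagrams\<close>

lemma D4_extends_reflection: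
  assumes "\<rho> \<in> \<Phi>" "D4_extends \<Phi> \<alpha> \<beta>"
  shows "D4_extends \<Phi> (reflection \<rho> \<alpha>) (reflection \<rho> \<beta>)"
proof -
  obtain \<gamma> \<delta> where "\<gamma>\<in>\<Phi>" "\<delta>\<in>\<Phi>" "\<gamma> \<bullet> \<delta> = 0" "\<gamma> \<bullet> \<alpha> = 0" "\<delta> \<bullet> \<alpha> = 0" "\<gamma> \<bullet> \<beta> = -1" "\<delta> \<bullet> \<beta> = -1"
    using assms(2) unfolding D4_extends_def by blast
  then show ?thesis unfolding D4_extends_def using assms(1)
    by (intro bexI[of _ "reflection \<rho> \<gamma>"] bexI[of _ "reflection \<rho> \<delta>"])
       (auto simp: reflection_ip reflection_root)
qed

lemma D4_extends_uminus:
  assumes "D4_extends \<Phi> \<alpha> \<beta>"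
  shows "D4_extends \<Phi> (- \<alpha>) (- \<beta>)"
proof -
  obtain \<gamma> \<delta> where "\<gamma>\<in>\<Phi>" "\<delta>\<in>\<Phi>" "\<gamma> \<bullet> \<delta> = 0" "\<gamma> \<bullet> \<alpha> = 0" "\<delta> \<bullet> \<alpha> = 0" "\<gamma> \<bullet> \<beta> = -1" "\<delta> \<bullet> \<beta> = -1"
    using assms unfolding D4_extends_def by blast
  then show ?thesis unfolding D4_extends_def
    by (intro bexI[of _ "- \<gamma>"] bexI[of _ "- \<delta>"]) auto
qed

text \<open>The reflection in \<open>\<alpha> + \<beta>\<close> exchanges \<alpha> and \<beta> up to
  sign, and a D4 diagram survives a global change of sign.\<close>

lemma D4_extends_swap:
  assumes "\<alpha> \<in> \<Phi>" "\<beta> \<in> \<Phi>" "\<alpha> \<bullet> \<beta> = -1" "D4_extends \<Phi> \<alpha> \<beta>"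
  shows "D4_extends \<Phi> \<beta> \<alpha>"
proof -
  have r: "\<alpha> + \<beta> \<in> \<Phi>" using assms add_root by blast
  have "reflection (\<alpha> + \<beta>) \<alpha> = - \<beta>" "reflection (\<alpha> + \<beta>) \<beta> = - \<alpha>"
    using assms r by (auto simp: reflection_eq inner_add_right norm_root inner_commute)
  then show ?thesis
    using D4_extends_uminus[OF D4_extends_reflection[OF r assms(4)]] by simp
qed

lemma D4_extends_ip1:
  assumes "\<alpha> \<in> \<Phi>" "\<alpha>' \<in> \<Phi>" "\<beta> \<in> \<Phi>" "\<alpha> \<bullet> \<beta> = -1" "\<alpha>' \<bullet> \<beta> = -1" "\<alpha> \<bullet> \<alpha>' = 1" "D4_extends \<Phi> \<alpha> \<beta>"
  shows "D4_extends \<Phi> \<alpha>' \<beta>"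
proof -
  have r: "\<alpha> - \<alpha>' \<in> \<Phi>" using assms diff_root by blast
  have "reflection (\<alpha> - \<alpha>') \<alpha> = \<alpha>'" "reflection (\<alpha> - \<alpha>') \<beta> = \<beta>"
    using assms r by (auto simp: reflection_eq inner_diff_right norm_root inner_commute)
  then show ?thesis
    using D4_extends_reflection[OF r assms(7)] by simp
qed

text \<open>The roots \<alpha>, \<beta> and \<open>- \<alpha> - \<beta>\<close> form a triangle with
  pairwise inner products -1. The reflection in \<beta> followed by negation fixes \<beta> and sends
  \<alpha> to the third root.\<close>

lemma D4_extends_third:
  assumes "\<alpha> \<in> \<Phi>" "\<beta> \<in> \<Phi>" "\<alpha> \<bullet> \<beta> = -1" "D4_extends \<Phi> \<alpha> \<beta>"
  shows "D4_extends \<Phi> (- \<alpha> - \<beta>) \<beta>"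
proof -
  have "reflection \<beta> \<alpha> = \<alpha> + \<beta>" "reflection \<beta> \<beta> = - \<beta>"
    using assms by (auto simp: reflection_eq norm_root scaleR_2)
  then show ?thesis
    using D4_extends_uminus[OF D4_extends_reflection[OF assms(2,4)]] by simp
qed

lemma third_root: "\<alpha> \<in> \<Phi> \<Longrightarrow> \<beta> \<in> \<Phi> \<Longrightarrow> \<alpha> \<bullet> \<beta> = -1 \<Longrightarrow> - \<alpha> - \<beta> \<in> \<Phi>"
  by (metis add_root uminus_root minus_add_distrib uminus_add_conv_diff add.commute)

lemma D4_extends_move:
  assumes "\<alpha> \<in> \<Phi>" "\<alpha>' \<in> \<Phi>" "\<beta> \<in> \<Phi>" "\<alpha> \<bullet> \<beta> = -1" "\<alpha>' \<bullet> \<beta> = -1" "D4_extends \<Phi> \<alpha> \<beta>"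
  shows "D4_extends \<Phi> \<alpha>' \<beta>"
proof -
  have t: "- \<alpha> - \<beta> \<in> \<Phi>" "D4_extends \<Phi> (- \<alpha> - \<beta>) \<beta>" "(- \<alpha> - \<beta>) \<bullet> \<beta> = -1"
    using assms third_root D4_extends_third by (auto simp: inner_diff_left norm_root)
  consider "\<alpha> \<bullet> \<alpha>' = 2" | "\<alpha> \<bullet> \<alpha>' = 1" | "\<alpha> \<bullet> \<alpha>' = 0" | "\<alpha> \<bullet> \<alpha>' = -1" | "\<alpha> \<bullet> \<alpha>' = -2"
    using ip_cases assms by blast
  then show ?thesis
  proof cases
    case 1 then show ?thesis using assms ip_2_iff by auto
  next
    case 2 then show ?thesis using assms D4_extends_ip1 by blast
  next
    case 3
    \<comment> \<open>No single reflection is used for an orthogonal pair of legs; the third root of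
      the triangle is a leg that has inner product 1 with \<open>\<alpha>'\<close>.\<close>
    then have "(- \<alpha> - \<beta>) \<bullet> \<alpha>' = 1" using assms by (simp add: inner_expand)
    then show ?thesis using D4_extends_ip1[OF t(1) assms(2,3) t(3) assms(5)] t by blast
  next
    case 4
    then have "(- \<alpha> - \<beta>) \<bullet> \<alpha>' = 2" using assms by (simp add: inner_expand)
    then have "- \<alpha> - \<beta> = \<alpha>'" using ip_2_iff[OF t(1) assms(2)] by blast
    then show ?thesis using t by simp
  next
    case 5 then have "\<alpha> = - \<alpha>'" using assms ip_m2_iff by blast
    then show ?thesis using assms by auto
  qed
qed

text \<open>This stands in for the transitivity of the Weyl group on such pairs.
  \<open>P \<beta>\<close> quantifies over all legs at \<beta>, so passing to an adjacent branch
  node requires only one leg there, which \<open>D4_extends_swap\<close> supplies.\<close>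

lemma D4_extends_all:
  assumes "\<alpha> \<in> \<Phi>" "\<beta> \<in> \<Phi>" "\<alpha> \<bullet> \<beta> = -1"
  shows "D4_extends \<Phi> \<alpha> \<beta>"
proof -
  define P where "P = (\<lambda>\<beta>. \<forall>\<alpha>\<in>\<Phi>. \<alpha> \<bullet> \<beta> = -1 \<longrightarrow> D4_extends \<Phi> \<alpha> \<beta>)"
  obtain \<alpha>0 \<beta>0 where 0: "\<alpha>0 \<in> \<Phi>" "\<beta>0 \<in> \<Phi>" "\<alpha>0 \<bullet> \<beta>0 = -1" "D4_extends \<Phi> \<alpha>0 \<beta>0"
    using some_D4 by blast
  have neg: "P (- \<beta>)" if "P \<beta>" for \<beta>
    unfolding P_def
  proof (intro ballI impI)
    fix \<alpha> assume "\<alpha> \<in> \<Phi>" "\<alpha> \<bullet> - \<beta> = -1"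
    then have "D4_extends \<Phi> (- \<alpha>) \<beta>" using that unfolding P_def by auto
    from D4_extends_uminus[OF this] show "D4_extends \<Phi> \<alpha> (- \<beta>)" by simp
  qed
  have adj: "P \<beta>'" if "P \<beta>" "\<beta> \<in> \<Phi>" "\<beta>' \<in> \<Phi>" "\<beta> \<bullet> \<beta>' = -1" for \<beta> \<beta>'
  proof -
    have "D4_extends \<Phi> \<beta>' \<beta>" using that unfolding P_def by (simp add: inner_commute)
    then have "D4_extends \<Phi> \<beta> \<beta>'" using D4_extends_swap that by (simp add: inner_commute)
    then show ?thesis unfolding P_def using D4_extends_move that by blast
  qed
  have step: "P \<beta>'" if h: "P \<beta>" "\<beta> \<in> \<Phi>" "\<beta>' \<in> \<Phi>" "\<beta> \<bullet> \<beta>' \<noteq> 0" for \<beta> \<beta>'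
  proof -
    consider "\<beta> \<bullet> \<beta>' = 2" | "\<beta> \<bullet> \<beta>' = 1" | "\<beta> \<bullet> \<beta>' = -1" | "\<beta> \<bullet> \<beta>' = -2"
      using ip_cases[OF h(2,3)] h(4) by blast
    then show ?thesis
    proof cases
      case 1 then show ?thesis using h ip_2_iff by auto
    next
      case 2 then show ?thesis using adj[OF neg] h by auto
    next
      case 3 then show ?thesis using adj h by auto
    next
      case 4 then show ?thesis using ip_m2_iff h neg by fastforce
    qed
  qed
  have "P \<beta>0" unfolding P_def using D4_extends_move 0 by blast
  moreover have "(\<lambda>x y. x \<in> \<Phi> \<and> y \<in> \<Phi> \<and> x \<bullet> y \<noteq> 0)\<^sup>*\<^sup>* \<beta>0 \<beta>" using irreducible 0 assms by blast
  then have "P \<beta>0 \<longrightarrow> P \<beta>" by (induction rule: rtranclp_induct) (use step in auto)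
  ultimately show ?thesis using assms unfolding P_def by blast
qed

lemma A3_extension:
  assumes "\<alpha> \<in> \<Phi>" "\<beta> \<in> \<Phi>" "\<alpha> \<bullet> \<beta> = -1"
  obtains \<gamma> where "\<gamma> \<in> \<Phi>" "\<gamma> \<bullet> \<alpha> = 0" "\<gamma> \<bullet> \<beta> = -1"
  using D4_extends_all[OF assms] unfolding D4_extends_def by blast

lemma D4_extension:
  assumes "\<alpha> \<in> \<Phi>" "\<beta> \<in> \<Phi>" "\<alpha>' \<in> \<Phi>" "\<alpha> \<bullet> \<beta> = -1" "\<alpha>' \<bullet> \<beta> = -1" "\<alpha> \<bullet> \<alpha>' = 0"
  obtains \<gamma> where "\<gamma> \<in> \<Phi>" "\<gamma> \<bullet> \<alpha> = 0" "\<gamma> \<bullet> \<alpha>' = 0" "\<gamma> \<bullet> \<beta> = -1"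
proof -
  obtain \<gamma> \<delta> where *: "\<gamma>\<in>\<Phi>" "\<delta>\<in>\<Phi>" "\<gamma> \<bullet> \<delta> = 0" "\<gamma> \<bullet> \<alpha> = 0" "\<delta> \<bullet> \<alpha> = 0" "\<gamma> \<bullet> \<beta> = -1" "\<delta> \<bullet> \<beta> = -1"
    using D4_extends_all[OF assms(1,2,4)] unfolding D4_extends_def by blast
  have cases: "\<epsilon> \<bullet> \<alpha>' = 0 \<or> \<epsilon> \<bullet> \<alpha>' = 1 \<or> \<epsilon> = \<alpha>'" if "\<epsilon> \<in> \<Phi>" "\<epsilon> \<bullet> \<beta> = -1" "\<epsilon> \<bullet> \<alpha> = 0" for \<epsilon>
  proof -
    have "\<epsilon> \<bullet> \<alpha>' \<noteq> -2" using ip_m2_iff[OF that(1) assms(3)] that assms by auto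
    \<comment> \<open>Otherwise \<open>\<epsilon> + \<alpha>' = - \<beta>\<close>. The left side is
      orthogonal to \<alpha>, whereas the right side has inner product 1 with \<alpha>.\<close>
    moreover have "\<epsilon> \<bullet> \<alpha>' \<noteq> -1"
    proof
      assume e: "\<epsilon> \<bullet> \<alpha>' = -1"
      have r: "\<epsilon> + \<alpha>' \<in> \<Phi>" by (rule add_root) (use that assms e in auto)
      have "(\<epsilon> + \<alpha>') \<bullet> \<beta> = -2" using that assms by (simp add: inner_add_left)
      then have "\<epsilon> + \<alpha>' = - \<beta>" using ip_m2_iff[OF r assms(2)] by blast
      then have "(\<epsilon> + \<alpha>') \<bullet> \<alpha> = (- \<beta>) \<bullet> \<alpha>" by simp
      then show False using that assms by (simp add: inner_add_left inner_commute[of \<alpha>' \<alpha>] inner_commute[of \<beta> \<alpha>])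
    qed
    moreover have "\<epsilon> \<bullet> \<alpha>' = 2 \<longrightarrow> \<epsilon> = \<alpha>'" using ip_2_iff that assms by blast
    ultimately show ?thesis using ip_cases[OF that(1) assms(3)] by blast
  qed
  show thesis
  proof (cases "\<gamma> \<bullet> \<alpha>' = 0 \<or> \<delta> \<bullet> \<alpha>' = 0")
    case True then show ?thesis using that * by blast
  next
    case False
    then have "\<gamma> \<noteq> \<alpha>'" "\<delta> \<noteq> \<alpha>'" using * by (auto simp: inner_commute)
    with False have 1: "\<gamma> \<bullet> \<alpha>' = 1" "\<delta> \<bullet> \<alpha>' = 1" using cases * by blast+
    \<comment> \<open>The root \<open>\<gamma> - \<alpha>' + \<delta>\<close> is the required leg:
      its inner product with \<open>\<alpha>'\<close> is 1 - 2 + 1 = 0, and with \<beta> it is -1 +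
      1 - 1 = -1.\<close>
    have "(\<gamma> - \<alpha>') \<bullet> \<delta> = -1" using 1 * by (simp add: inner_diff_left inner_commute[of \<alpha>'])
    then have "(\<gamma> - \<alpha>') + \<delta> \<in> \<Phi>" using add_root diff_root 1 * assms by blast
    then show ?thesis
      by (rule that) (use 1 * assms in \<open>auto simp: inner_expand norm_root\<close>)
  qed
qed

section \<open>Connectedness of roots and of pairs of roots\<close>

lemma common_nonorthogonal:
  assumes "\<alpha> \<in> \<Phi>" "\<beta> \<in> \<Phi>"
  obtains \<delta> where "\<delta> \<in> \<Phi>" "\<delta> \<bullet> \<alpha> \<noteq> 0" "\<delta> \<bullet> \<beta> \<noteq> 0"
proof -
  have "(\<lambda>x y. x \<in> \<Phi> \<and> y \<in> \<Phi> \<and> x \<bullet> y \<noteq> 0)\<^sup>*\<^sup>* \<alpha> \<beta>" using irreducible assms by blast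
  then have "\<exists>\<delta>\<in>\<Phi>. \<delta> \<bullet> \<alpha> \<noteq> 0 \<and> \<delta> \<bullet> \<beta> \<noteq> 0"
  proof (induction rule: rtranclp_induct)
    case base then show ?case using assms norm_root by force
  next
    case (step \<gamma> \<gamma>')
    then obtain \<delta> where d: "\<delta> \<in> \<Phi>" "\<delta> \<bullet> \<alpha> \<noteq> 0" "\<delta> \<bullet> \<gamma> \<noteq> 0" by blast
    show ?case
    proof (cases "\<delta> \<bullet> \<gamma>' = 0")
      case False then show ?thesis using d by blast
    next
      case True
      show ?thesis
      proof (cases "\<gamma> \<bullet> \<alpha> = 0")
        case False then show ?thesis using step by blast
      next
        case t: True
        \<comment> \<open>Reflecting \<delta> in \<gamma> keeps the inner product with \<alpha>,
          since \<gamma> is orthogonal to \<alpha>, and makes the one with \<open>\<gamma>'\<close>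
          non-zero. So a chain of any length shortens to one intermediate root.\<close>
        have "\<delta> - (\<delta> \<bullet> \<gamma>) *\<^sub>R \<gamma> \<in> \<Phi>" using reflect d step by blast
        then show ?thesis
          by (rule bexI[rotated]) (use d t True step in \<open>auto simp: inner_diff_left\<close>)
      qed
    qed
  qed
  then show thesis using that by blast
qed

text \<open>Irreducibility gives chains of non-orthogonal roots, but products exist only for inner
  product -1. The other inner products are reached by inserting intermediate roots.\<close>

lemma neighbour_connected:
  assumes P: "P \<alpha>" and "\<alpha> \<in> \<Phi>" "\<beta> \<in> \<Phi>"
    and step: "\<And>\<gamma> \<delta>. \<gamma> \<in> \<Phi> \<Longrightarrow> \<delta> \<in> \<Phi> \<Longrightarrow> \<gamma> \<bullet> \<delta> = -1 \<Longrightarrow> P \<gamma> \<Longrightarrow> P \<delta>"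
  shows "P \<beta>"
proof -
  have one: "P \<delta>" if h: "P \<gamma>" "\<gamma> \<in> \<Phi>" "\<delta> \<in> \<Phi>" "\<gamma> \<bullet> \<delta> = 1" for \<gamma> \<delta>
  proof -
    have d: "\<gamma> - \<delta> \<in> \<Phi>" using h diff_root by blast
    \<comment> \<open>A root orthogonal to \<open>\<gamma> - \<delta>\<close> has the same inner
      product with \<gamma> and \<delta>. Here this value is 1, so its negative is a common
      neighbour of both.\<close>
    obtain \<epsilon> where e: "\<epsilon> \<in> \<Phi>" "\<epsilon> \<bullet> (\<gamma> - \<delta>) = 0" "\<epsilon> \<bullet> (- \<gamma>) = -1"
      by (rule A3_extension[of "\<gamma> - \<delta>" "- \<gamma>"])
         (use h d in \<open>auto simp: inner_expand norm_root\<close>)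
    define \<zeta> where "\<zeta> = - \<epsilon>"
    have z: "\<zeta> \<in> \<Phi>" "\<zeta> \<bullet> \<gamma> = -1" "\<zeta> \<bullet> \<delta> = -1"
      using e by (auto simp: \<zeta>_def inner_diff_right)
    show ?thesis
      using step[of \<gamma> \<zeta>] step[of \<zeta> \<delta>] z h by (auto simp: inner_commute)
  qed
  have nz: "P \<delta>" if "P \<gamma>" "\<gamma> \<in> \<Phi>" "\<delta> \<in> \<Phi>" "\<gamma> \<bullet> \<delta> \<noteq> 0" "\<gamma> \<bullet> \<delta> \<noteq> -2" for \<gamma> \<delta>
    using ip_cases[OF that(2,3)] that one[OF that(1-3)] step[OF that(2,3)] ip_2_iff[OF that(2,3)] by auto
  have all: "P \<delta>" if "P \<gamma>" "\<gamma> \<in> \<Phi>" "\<delta> \<in> \<Phi>" "\<gamma> \<bullet> \<delta> \<noteq> -2" for \<gamma> \<delta>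
  proof (cases "\<gamma> \<bullet> \<delta> = 0")
    case True
    obtain \<epsilon> where e: "\<epsilon> \<in> \<Phi>" "\<epsilon> \<bullet> \<gamma> \<noteq> 0" "\<epsilon> \<bullet> \<delta> \<noteq> 0" using common_nonorthogonal \<open>\<gamma> \<in> \<Phi>\<close> \<open>\<delta> \<in> \<Phi>\<close> by metis
    have "\<epsilon> \<bullet> \<gamma> \<noteq> -2" "\<epsilon> \<bullet> \<delta> \<noteq> -2"
      using e True ip_m2_iff[OF e(1)] that by (auto simp: inner_commute[of \<delta> \<gamma>])
    then show ?thesis using nz[of \<gamma> \<epsilon>] nz[of \<epsilon> \<delta>] e that by (simp add: inner_commute)
  qed (use nz that in auto)
  show ?thesis
  proof (cases "\<alpha> \<bullet> \<beta> = -2")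
    case True
    obtain \<gamma> \<delta> where gd: "\<gamma> \<in> \<Phi>" "\<delta> \<in> \<Phi>" "\<gamma> \<bullet> \<delta> = -1" using some_D4 by blast
    obtain \<epsilon> where e: "\<epsilon> \<in> \<Phi>" "\<epsilon> \<noteq> \<alpha>" "\<epsilon> \<noteq> - \<alpha>"
      using gd assms(2) norm_root[OF assms(2)] by (cases "\<gamma> = \<alpha> \<or> \<gamma> = - \<alpha>") fastforce+
    have "\<beta> = - \<alpha>" using ip_m2_iff[OF assms(2,3)] True by simp
    then have "\<alpha> \<bullet> \<epsilon> \<noteq> -2" "\<epsilon> \<bullet> \<beta> \<noteq> -2"
      using ip_m2_iff[of \<alpha> \<epsilon>] ip_m2_iff[of \<epsilon> \<beta>] assms(2,3) e by auto
    then show ?thesis using all[OF P assms(2) e(1)] all[of \<epsilon> \<beta>] assms(3) e(1) by blast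
  next
    case False then show ?thesis using all[OF P assms(2,3)] by blast
  qed
qed

lemma neighbour_exists:
  assumes "\<alpha> \<in> \<Phi>" obtains \<beta> where "\<beta> \<in> \<Phi>" "\<alpha> \<bullet> \<beta> = -1"
proof -
  obtain \<gamma> \<delta> where gd: "\<gamma> \<in> \<Phi>" "\<delta> \<in> \<Phi>" "\<gamma> \<bullet> \<delta> = -1" using some_D4 by blast
  have "\<exists>\<beta>\<in>\<Phi>. \<alpha> \<bullet> \<beta> = -1"
  proof (rule neighbour_connected[of "\<lambda>\<alpha>. \<exists>\<beta>\<in>\<Phi>. \<alpha> \<bullet> \<beta> = -1", OF _ gd(1) assms])
    show "\<exists>\<beta>\<in>\<Phi>. \<gamma> \<bullet> \<beta> = -1" using gd by blast
  next
    fix \<delta> \<epsilon> assume a: "\<delta> \<in> \<Phi>" "\<delta> \<bullet> \<epsilon> = -1"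
    have "\<epsilon> \<bullet> \<delta> = -1" using a by (simp add: inner_commute)
    then show "\<exists>\<beta>\<in>\<Phi>. \<epsilon> \<bullet> \<beta> = -1" using a by blast
  qed
  then show thesis using that by blast
qed

text \<open>Here D4 is essential. In type A the neighbours of a root form two families, according to
  which end of the root they meet, and inner product 1 occurs only inside a family.\<close>

lemma neighbours_connected:
  assumes roots: "\<alpha> \<in> \<Phi>" "\<alpha>' \<in> \<Phi>" "\<beta> \<in> \<Phi>" and ip: "\<alpha> \<bullet> \<beta> = -1" "\<alpha>' \<bullet> \<beta> = -1" and P: "P \<alpha>"
    and step: "\<And>\<gamma> \<delta>. \<gamma> \<in> \<Phi> \<Longrightarrow> \<delta> \<in> \<Phi> \<Longrightarrow> \<gamma> \<bullet> \<beta> = -1 \<Longrightarrow> \<delta> \<bullet> \<beta> = -1 \<Longrightarrow> \<gamma> \<bullet> \<delta> = 1 \<Longrightarrow> P \<gamma> \<Longrightarrow> P \<delta>"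
  shows "P \<alpha>'"
proof -
  have orth: "P \<delta>" if h: "P \<gamma>" "\<gamma> \<in> \<Phi>" "\<delta> \<in> \<Phi>" "\<gamma> \<bullet> \<beta> = -1" "\<delta> \<bullet> \<beta> = -1" "\<gamma> \<bullet> \<delta> = 0" for \<gamma> \<delta>
  proof -
    obtain \<epsilon> where e: "\<epsilon> \<in> \<Phi>" "\<epsilon> \<bullet> \<gamma> = 0" "\<epsilon> \<bullet> \<delta> = 0" "\<epsilon> \<bullet> \<beta> = -1"
      by (rule D4_extension[of \<gamma> \<beta> \<delta>]) (use h roots in auto)
    \<comment> \<open>This is the sum of all nodes of the D4 diagram with branch node \<beta> and
      legs \<gamma>, \<delta>, \<epsilon>. It has inner product 2 - 1 = 1 with each leg and 2 - 3 =
      -1 with \<beta>, hence links the two orthogonal legs.\<close>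
    define \<mu> where "\<mu> = \<gamma> + \<beta> + \<delta> + \<epsilon>"
    have 1: "\<gamma> + \<beta> \<in> \<Phi>" using add_root h roots by blast
    then have 2: "\<gamma> + \<beta> + \<delta> \<in> \<Phi>" using h roots by (simp add: inner_expand add_root)
    then have "\<mu> \<in> \<Phi>" unfolding \<mu>_def using e h roots by (simp add: inner_expand add_root)
    moreover have "\<mu> \<bullet> \<gamma> = 1" "\<mu> \<bullet> \<delta> = 1" "\<mu> \<bullet> \<beta> = -1"
      unfolding \<mu>_def using e h roots by (auto simp: inner_expand norm_root)
    ultimately show ?thesis using step[of \<gamma> \<mu>] step[of \<mu> \<delta>] h by (auto simp: inner_commute)
  qed
  consider "\<alpha> \<bullet> \<alpha>' = 2" | "\<alpha> \<bullet> \<alpha>' = 1" | "\<alpha> \<bullet> \<alpha>' = 0" | "\<alpha> \<bullet> \<alpha>' = -1" | "\<alpha> \<bullet> \<alpha>' = -2"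
    using ip_cases roots by blast
  then show ?thesis
  proof cases
    case 1 then show ?thesis using P roots ip_2_iff by auto
  next
    case 2 then show ?thesis using step P roots ip by blast
  next
    case 3 then show ?thesis using orth P roots ip by blast
  next
    case 4
    then have s: "\<alpha> + \<alpha>' \<in> \<Phi>" using add_root roots by blast
    have "(\<alpha> + \<alpha>') \<bullet> \<beta> = -2" using ip by (simp add: inner_add_left)
    then have sb: "\<alpha> + \<alpha>' = - \<beta>" using ip_m2_iff[OF s roots(3)] by blast
    \<comment> \<open>Now \<open>\<alpha> + \<alpha>' = - \<beta>\<close>. A leg orthogonal to
      \<alpha> then has inner product 1 with \<open>\<alpha>'\<close>, which reduces this case to
      the orthogonal one followed by one step.\<close>
    obtain \<gamma> where g: "\<gamma> \<in> \<Phi>" "\<gamma> \<bullet> \<alpha> = 0" "\<gamma> \<bullet> \<beta> = -1" using A3_extension roots ip by metis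
    have "\<gamma> \<bullet> (\<alpha> + \<alpha>') = 1" using g sb by simp
    then have "\<gamma> \<bullet> \<alpha>' = 1" using g by (simp add: inner_add_right)
    then show ?thesis using orth[OF P roots(1) g(1) ip(1) g(3)] step[OF g(1) roots(2) g(3) ip(2)] g(2)
      by (simp add: inner_commute)
  next
    case 5 then have "\<alpha> = - \<alpha>'" using roots ip_m2_iff by blast
    then show ?thesis using ip by auto
  qed
qed

lemma pairs_connected:
  assumes "P \<alpha> \<beta>" "\<alpha> \<in> \<Phi>" "\<beta> \<in> \<Phi>" "\<alpha> \<bullet> \<beta> = -1" "\<alpha>' \<in> \<Phi>" "\<beta>' \<in> \<Phi>" "\<alpha>' \<bullet> \<beta>' = -1"
    and left: "\<And>\<gamma> \<delta> \<beta>. \<gamma> \<in> \<Phi> \<Longrightarrow> \<delta> \<in> \<Phi> \<Longrightarrow> \<beta> \<in> \<Phi> \<Longrightarrow> \<gamma> \<bullet> \<beta> = -1 \<Longrightarrow> \<delta> \<bullet> \<beta> = -1 \<Longrightarrow> \<gamma> \<bullet> \<delta> = 1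
       \<Longrightarrow> P \<gamma> \<beta> \<Longrightarrow> P \<delta> \<beta>"
    and right: "\<And>\<gamma> \<delta> \<beta>. \<gamma> \<in> \<Phi> \<Longrightarrow> \<delta> \<in> \<Phi> \<Longrightarrow> \<beta> \<in> \<Phi> \<Longrightarrow> \<gamma> \<bullet> \<beta> = -1 \<Longrightarrow> \<delta> \<bullet> \<beta> = -1 \<Longrightarrow> \<gamma> \<bullet> \<delta> = 1
       \<Longrightarrow> P \<beta> \<gamma> \<Longrightarrow> P \<beta> \<delta>"
  shows "P \<alpha>' \<beta>'"
proof -
  have L: "P \<alpha>' \<beta>" if "P \<alpha> \<beta>" "\<alpha> \<in> \<Phi>" "\<alpha>' \<in> \<Phi>" "\<beta> \<in> \<Phi>" "\<alpha> \<bullet> \<beta> = -1" "\<alpha>' \<bullet> \<beta> = -1" for \<alpha> \<alpha>' \<beta>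
    by (rule neighbours_connected[of \<alpha> \<alpha>' \<beta>]) (use that left in auto)
  have R: "P \<beta> \<alpha>'" if "P \<beta> \<alpha>" "\<alpha> \<in> \<Phi>" "\<alpha>' \<in> \<Phi>" "\<beta> \<in> \<Phi>" "\<alpha> \<bullet> \<beta> = -1" "\<alpha>' \<bullet> \<beta> = -1" for \<alpha> \<alpha>' \<beta>
    by (rule neighbours_connected[of \<alpha> \<alpha>' \<beta>]) (use that right in auto)
  \<comment> \<open>With \<tau> = \<open>- \<alpha> - \<beta>\<close> the swap is made by changing
    one entry at a time: (\<alpha>, \<beta>), (\<alpha>, \<tau>), (\<beta>, \<tau>), (\<beta>,
    \<alpha>). This is what later yields commutativity of the ring.\<close>
  have swap: "P \<beta> \<alpha>" if "P \<alpha> \<beta>" "\<alpha> \<in> \<Phi>" "\<beta> \<in> \<Phi>" "\<alpha> \<bullet> \<beta> = -1" for \<alpha> \<beta>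
  proof -
    have t: "- \<alpha> - \<beta> \<in> \<Phi>" using third_root that by blast
    have i: "(- \<alpha> - \<beta>) \<bullet> \<alpha> = -1" "(- \<alpha> - \<beta>) \<bullet> \<beta> = -1"
      using that by (auto simp: inner_diff_left norm_root inner_commute[of \<beta> \<alpha>])
    have i': "\<alpha> \<bullet> (- \<alpha> - \<beta>) = -1" "\<beta> \<bullet> (- \<alpha> - \<beta>) = -1" "\<beta> \<bullet> \<alpha> = -1"
      using that by (auto simp: inner_diff_right norm_root inner_commute[of \<beta> \<alpha>])
    have "P \<alpha> (- \<alpha> - \<beta>)" using R[OF that(1,3) t that(2)] i i' by blast
    then have "P \<beta> (- \<alpha> - \<beta>)" using L[OF _ that(2,3) t] i' by blast
    then show ?thesis using R[OF _ t that(2,3)] i that by blast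
  qed
  have "\<forall>\<alpha>\<in>\<Phi>. \<alpha> \<bullet> \<beta>' = -1 \<longrightarrow> P \<alpha> \<beta>'"
  proof (rule neighbour_connected[of "\<lambda>\<beta>. \<forall>\<alpha>\<in>\<Phi>. \<alpha> \<bullet> \<beta> = -1 \<longrightarrow> P \<alpha> \<beta>" \<beta> \<beta>'])
    show "\<forall>\<alpha>\<in>\<Phi>. \<alpha> \<bullet> \<beta> = -1 \<longrightarrow> P \<alpha> \<beta>" using L assms(1-4) by blast
    fix \<gamma> \<delta> assume a: "\<gamma> \<in> \<Phi>" "\<delta> \<in> \<Phi>" "\<gamma> \<bullet> \<delta> = -1" and "\<forall>\<alpha>\<in>\<Phi>. \<alpha> \<bullet> \<gamma> = -1 \<longrightarrow> P \<alpha> \<gamma>"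
    then have "P \<delta> \<gamma>" by (simp add: inner_commute)
    then have "P \<gamma> \<delta>" using swap a by (simp add: inner_commute)
    then show "\<forall>\<alpha>\<in>\<Phi>. \<alpha> \<bullet> \<delta> = -1 \<longrightarrow> P \<alpha> \<delta>" using L a by blast
  qed (use assms(3,6) in auto)
  then show ?thesis using assms(5,7) by blast
qed

end

subsection \<open>The root systems of type E\<close>

lemma UNIV_8: "(UNIV :: 8 set) = {1,2,3,4,5,6,7,8}"
proof -
  have "x \<in> {1,2,3,4,5,6,7,8}" for x :: 8
  proof (induct x)
    case (of_int z)
    then have "0 \<le> z" "z < 8" by simp_all
    then have "z = 0 \<or> z = 1 \<or> z = 2 \<or> z = 3 \<or> z = 4 \<or> z = 5 \<or> z = 6 \<or> z = 7" by arith
    then show ?case by auto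
  qed
  then show ?thesis by blast
qed

lemma sum_8: "(\<Sum>i\<in>(UNIV::8 set). f i) = f 1 + f 2 + f 3 + f 4 + f 5 + f 6 + f 7 + (f 8 :: 'a::comm_monoid_add)"
  unfolding UNIV_8 by (simp add: add.assoc)

text \<open>The parity of the coordinate sum is expressed by membership of half the sum in the
  integers, so that the closure rules for integers apply.\<close>

definition E8_lattice :: "(real^8) set" where
  "E8_lattice = {v. ((\<forall>i. v $ i \<in> \<int>) \<or> (\<forall>i. v $ i - 1/2 \<in> \<int>)) \<and> (\<Sum>i\<in>UNIV. v $ i) / 2 \<in> \<int>}"

lemma even_int_iff: "(\<exists>k::int. x = 2 * of_int k) \<longleftrightarrow> x / 2 \<in> (\<int> :: real set)"
  by (metis Ints_cases Ints_of_int field_sum_of_halves mult.commute mult_2 nonzero_mult_div_cancel_right zero_neq_numeral)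

lemma E_roots_eq: "E_roots l = {v \<in> E8_lattice. v \<bullet> v = 2 \<and> (l \<le> 7 \<longrightarrow> v $ 7 + v $ 8 = 0) \<and> (l \<le> 6 \<longrightarrow> v $ 6 = v $ 7)}"
  unfolding E_roots_def E8_lattice_def even_int_iff by blast

lemma E8_lattice_diff:
  assumes "u \<in> E8_lattice" "v \<in> E8_lattice" shows "u - v \<in> E8_lattice"
proof -
  have s: "(\<Sum>i\<in>UNIV. (u - v) $ i) / 2 \<in> \<int>"
    using assms by (simp add: E8_lattice_def sum_subtractf diff_divide_distrib)
  have half: "a - b \<in> \<int>" if "a - 1/2 \<in> \<int>" "b - 1/2 \<in> \<int>" for a b :: real
    using Ints_diff[OF that] by simp
  have mix1: "a - b - 1/2 \<in> \<int>" if "a - 1/2 \<in> \<int>" "b \<in> \<int>" for a b :: real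
    using Ints_diff[OF that] by (simp add: algebra_simps)
  have mix2: "a - b - 1/2 \<in> \<int>" if "a \<in> \<int>" "b - 1/2 \<in> \<int>" for a b :: real
    using Ints_diff[OF Ints_diff[OF that] Ints_1] by (simp add: algebra_simps)
  show ?thesis
  proof -
    have "(\<forall>i. u $ i \<in> \<int>) \<or> (\<forall>i. u $ i - 1/2 \<in> \<int>)" "(\<forall>i. v $ i \<in> \<int>) \<or> (\<forall>i. v $ i - 1/2 \<in> \<int>)"
      using assms by (auto simp: E8_lattice_def)
    then have "(\<forall>i. (u - v) $ i \<in> \<int>) \<or> (\<forall>i. (u - v) $ i - 1/2 \<in> \<int>)"
      unfolding vector_minus_component using half mix1 mix2 Ints_diff by metis
    then show ?thesis using s by (simp add: E8_lattice_def)
  qed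
qed

lemma E8_lattice_uminus: "v \<in> E8_lattice \<Longrightarrow> - v \<in> E8_lattice"
proof -
  assume v: "v \<in> E8_lattice"
  from E8_lattice_diff[OF E8_lattice_diff[OF v v] v] show ?thesis by simp
qed

lemma E8_lattice_scale_nat:
  assumes "v \<in> E8_lattice" shows "of_nat n *\<^sub>R v \<in> E8_lattice"
proof (induction n)
  case 0 show ?case using E8_lattice_diff[OF assms assms] by simp
next
  case (Suc n)
  from E8_lattice_diff[OF Suc E8_lattice_uminus[OF assms]] show ?case
    by (simp add: algebra_simps)
qed

lemma E8_lattice_scale:
  assumes "v \<in> E8_lattice" "c \<in> \<int>" shows "c *\<^sub>R v \<in> E8_lattice"
proof -
  obtain k where c: "c = of_int k" using assms(2) by (auto elim: Ints_cases)
  show ?thesis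
  proof (cases "k \<ge> 0")
    case True
    then have "c = of_nat (nat k)" using c by simp
    then show ?thesis using E8_lattice_scale_nat[OF assms(1)] by metis
  next
    case False
    then have "c = - of_nat (nat (- k))" using c by simp
    then show ?thesis using E8_lattice_uminus[OF E8_lattice_scale_nat[OF assms(1), of "nat (- k)"]] by simp
  qed
qed

lemma E8_lattice_inner_Ints:
  assumes "u \<in> E8_lattice" "v \<in> E8_lattice" shows "u \<bullet> v \<in> \<int>"
proof -
  have half_int: "u \<bullet> v \<in> \<int>" if "\<forall>i. u $ i - 1/2 \<in> \<int>" "\<forall>i. v $ i \<in> \<int>" "(\<Sum>i\<in>UNIV. v $ i) / 2 \<in> \<int>" for u v :: "real^8"
  proof -
    have "u \<bullet> v = (\<Sum>i\<in>UNIV. (u $ i - 1/2) * v $ i) + (\<Sum>i\<in>UNIV. v $ i) / 2"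
      unfolding inner_vec_def sum_divide_distrib sum.distrib[symmetric] by (simp add: algebra_simps)
    also have "\<dots> \<in> \<int>" using that by (intro Ints_add Ints_sum Ints_mult) auto
    finally show ?thesis .
  qed
  have half_half: "u \<bullet> v \<in> \<int>" if "\<forall>i. u $ i - 1/2 \<in> \<int>" "\<forall>i. v $ i - 1/2 \<in> \<int>"
     "(\<Sum>i\<in>UNIV. u $ i) / 2 \<in> \<int>" "(\<Sum>i\<in>UNIV. v $ i) / 2 \<in> \<int>" for u v :: "real^8"
  proof -
    \<comment> \<open>Expanding the eight products leaves the half sums of both vectors, corrected
      by 8 times 1/4, that is 2.\<close>
    have "u \<bullet> v = (\<Sum>i\<in>UNIV. (u $ i - 1/2) * (v $ i - 1/2)) + (\<Sum>i\<in>UNIV. u $ i) / 2 + (\<Sum>i\<in>UNIV. v $ i) / 2 - 2"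
      unfolding inner_vec_def sum_8 by (simp add: field_simps)
    also have "\<dots> \<in> \<int>"
    proof -
      have "(\<Sum>i\<in>UNIV. (u $ i - 1/2) * (v $ i - 1/2)) \<in> \<int>"
        using that by (intro Ints_sum) (blast intro: Ints_mult)
      then show ?thesis using that by (intro Ints_add Ints_diff) auto
    qed
    finally show ?thesis .
  qed
  have int_int: "u \<bullet> v \<in> \<int>" if "\<forall>i. u $ i \<in> \<int>" "\<forall>i. v $ i \<in> \<int>" for u v :: "real^8"
    unfolding inner_vec_def using that by (intro Ints_sum) (auto intro: Ints_mult)
  show ?thesis
    using assms half_int[of u v] half_int[of v u] half_half[of u v] int_int[of u v]
    unfolding E8_lattice_def by (auto simp: inner_commute)
qed

lemma E_roots_finite: "finite (E_roots l)"
proof -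
  \<comment> \<open>Coordinates are half-integers, and squared norm 2 bounds them by 2 in absolute
    value, so the doubled coordinates lie between -4 and 4.\<close>
  define A :: "real set" where "A = (\<lambda>k::int. of_int k / 2) ` {-4..4}"
  have "v $ i \<in> A" if v: "v \<in> E_roots l" for v i
  proof -
    have L: "v \<in> E8_lattice" and n: "v \<bullet> v = 2" using v by (auto simp: E_roots_eq)
    have "2 * v $ i \<in> \<int>"
    proof (cases "v $ i \<in> \<int>")
      case False
      then have "v $ i - 1/2 \<in> \<int>" using L by (auto simp: E8_lattice_def)
      from Ints_mult[OF Ints_numeral[of "num.Bit0 num.One"] this] have "2 * v $ i - 1 \<in> \<int>" by (simp add: algebra_simps)
      from Ints_add[OF this Ints_1] show ?thesis by simp
    qed auto
    then obtain k where k: "2 * v $ i = of_int k" by (auto elim: Ints_cases)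
    have "v $ i * v $ i \<le> v \<bullet> v" unfolding inner_vec_def inner_real_def
      by (rule member_le_sum) auto
    then have "(v $ i)\<^sup>2 \<le> 2\<^sup>2" using n by (simp add: power2_eq_square)
    then have "\<bar>v $ i\<bar> \<le> 2" using abs_le_square_iff[of "v $ i" 2] by simp
    then have "k \<in> {-4..4}" using k by simp linarith
    then show ?thesis unfolding A_def using k by (intro image_eqI[of _ _ k]) auto
  qed
  then have "E_roots l \<subseteq> {v. \<forall>i. v $ i \<in> A}" by blast
  moreover have "finite {v :: real^8. \<forall>i. v $ i \<in> A}"
  proof -
    have "finite {f. \<forall>i::8. f i \<in> A}" using finite_set_of_finite_funs[of "UNIV::8 set" A] by (simp add: A_def Pi_def)
    moreover have "{v :: real^8. \<forall>i. v $ i \<in> A} \<subseteq> vec_lambda ` {f. \<forall>i::8. f i \<in> A}"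
    proof
      fix v :: "real^8" assume "v \<in> {v. \<forall>i. v $ i \<in> A}"
      then show "v \<in> vec_lambda ` {f. \<forall>i::8. f i \<in> A}" by (intro image_eqI[of _ _ "vec_nth v"]) auto
    qed
    ultimately show ?thesis using finite_surj by blast
  qed
  ultimately show ?thesis using finite_subset by blast
qed

lemma E_roots_reflect:
  assumes "\<alpha> \<in> E_roots l" "\<beta> \<in> E_roots l"
  shows "\<beta> - (\<beta> \<bullet> \<alpha>) *\<^sub>R \<alpha> \<in> E_roots l"
proof -
  have a: "\<alpha> \<in> E8_lattice" "\<beta> \<in> E8_lattice" using assms by (auto simp: E_roots_eq)
  then have "\<beta> - (\<beta> \<bullet> \<alpha>) *\<^sub>R \<alpha> \<in> E8_lattice"
    by (intro E8_lattice_diff E8_lattice_scale E8_lattice_inner_Ints)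
  moreover have "(\<beta> - (\<beta> \<bullet> \<alpha>) *\<^sub>R \<alpha>) \<bullet> (\<beta> - (\<beta> \<bullet> \<alpha>) *\<^sub>R \<alpha>) = 2"
    using assms by (simp add: E_roots_eq inner_expand)
  moreover have "(l \<le> 7 \<longrightarrow> (\<beta> - c *\<^sub>R \<alpha>) $ 7 + (\<beta> - c *\<^sub>R \<alpha>) $ 8 = 0) \<and> (l \<le> 6 \<longrightarrow> (\<beta> - c *\<^sub>R \<alpha>) $ 6 = (\<beta> - c *\<^sub>R \<alpha>) $ 7)" for c
  proof -
    have "(\<beta> - c *\<^sub>R \<alpha>) $ 7 + (\<beta> - c *\<^sub>R \<alpha>) $ 8 = (\<beta> $ 7 + \<beta> $ 8) - c * (\<alpha> $ 7 + \<alpha> $ 8)"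
      by (simp add: algebra_simps)
    then show ?thesis using assms by (auto simp: E_roots_eq)
  qed
  ultimately show ?thesis by (simp add: E_roots_eq)
qed

text \<open>These are Bourbaki's simple roots, with \<open>E_simple k\<close> equal to the
  difference of the basis vectors k - 1 and k - 2 for k \<ge> 3. The diagram is the chain 1, 3, 4,
  5, 6, 7, 8 with node 2 attached to node 4; the first l nodes belong to the system of rank
  l.\<close>

definition E_simple :: "nat \<Rightarrow> real^8" where
  "E_simple k = (\<chi> i.
     if k = 1 then (if i = 1 \<or> i = 8 then 1/2 else - 1/2)
     else if k = 2 then (if i = 1 \<or> i = 2 then 1 else 0)
     else if i = of_nat k - 1 then 1 else if i = of_nat k - 2 then - 1 else 0)"

lemma E_simple_in_lattice:
  assumes "k \<in> {1..8}" shows "E_simple k \<in> E8_lattice" "E_simple k \<bullet> E_simple k = 2"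
proof -
  have k: "k = 1 \<or> k = 2 \<or> k = 3 \<or> k = 4 \<or> k = 5 \<or> k = 6 \<or> k = 7 \<or> k = 8" using assms by auto
  show "E_simple k \<in> E8_lattice"
  proof (cases "k = 1")
    case True
    have "E_simple k $ i - 1/2 \<in> \<int>" for i using True by (simp add: E_simple_def)
    moreover have "(\<Sum>i\<in>UNIV. E_simple k $ i) / 2 \<in> \<int>" using True by (simp add: E_simple_def sum_8)
    ultimately show ?thesis by (simp add: E8_lattice_def)
  next
    case False
    then have "E_simple k $ i \<in> \<int>" for i by (simp add: E_simple_def)
    moreover have "(\<Sum>i\<in>UNIV. E_simple k $ i) / 2 \<in> \<int>"
      using False k by (elim disjE) (simp_all add: E_simple_def sum_8)
    ultimately show ?thesis by (simp add: E8_lattice_def)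
  qed
  show "E_simple k \<bullet> E_simple k = 2"
    using k by (elim disjE) (simp_all add: E_simple_def sum_8 inner_vec_def)
qed

lemma E_simple_root:
  assumes "l \<in> {6,7,8}" "k \<in> {1..l}" shows "E_simple k \<in> E_roots l"
proof -
  have "E_simple j $ 7 + E_simple j $ 8 = 0" if "j \<in> {1,2,3,4,5,6,7}" for j
    using that by (auto simp: E_simple_def)
  then have a: "E_simple k $ 7 + E_simple k $ 8 = 0" if "l \<le> 7"
  proof -
    have "k \<in> {1,2,3,4,5,6,7}" using that assms(2) by auto
    then show ?thesis using \<open>\<And>j. j \<in> {1,2,3,4,5,6,7} \<Longrightarrow> E_simple j $ 7 + E_simple j $ 8 = 0\<close> by blast
  qed
  have "E_simple j $ 6 = E_simple j $ 7" if "j \<in> {1,2,3,4,5,6}" for j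
    using that by (auto simp: E_simple_def)
  then have b: "E_simple k $ 6 = E_simple k $ 7" if "l \<le> 6"
  proof -
    have "k \<in> {1,2,3,4,5,6}" using that assms(2) by auto
    then show ?thesis using \<open>\<And>j. j \<in> {1,2,3,4,5,6} \<Longrightarrow> E_simple j $ 6 = E_simple j $ 7\<close> by blast
  qed
  have "k \<in> {1..8}" using assms by auto
  from E_simple_in_lattice[OF this] a b show ?thesis by (simp add: E_roots_eq)
qed

lemma E_simple_spanning:
  assumes "l \<in> {6,7,8}" "v \<in> E_roots l" shows "\<exists>k\<in>{1..l}. v \<bullet> E_simple k \<noteq> 0"
proof (rule ccontr)
  assume "\<not> ?thesis"
  then have *: "v \<bullet> E_simple k = 0" if "1 \<le> k" "k \<le> l" for k using that by auto
  have a: "v $ 2 - v $ 1 = 0" "v $ 3 - v $ 2 = 0" "v $ 4 - v $ 3 = 0" "v $ 5 - v $ 4 = 0" "v $ 1 + v $ 2 = 0"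
    "v $ 1 + v $ 8 - (v $ 2 + v $ 3 + v $ 4 + v $ 5 + v $ 6 + v $ 7) = 0"
    using *[of 1] *[of 2] *[of 3] *[of 4] *[of 5] *[of 6] assms(1)
    by (auto simp: E_simple_def inner_vec_def sum_8)
  have b: "l \<ge> 7 \<Longrightarrow> v $ 6 - v $ 5 = 0" "l \<ge> 8 \<Longrightarrow> v $ 7 - v $ 6 = 0"
    using *[of 7] *[of 8] by (auto simp: E_simple_def inner_vec_def sum_8)
  \<comment> \<open>For l = 6 and l = 7 the linear equations cutting the system out of E8 replace
    the missing simple roots.\<close>
  have "v $ 6 = 0 \<and> v $ 7 = 0 \<and> v $ 8 = 0"
    using a b assms by (auto simp: E_roots_eq)
  then have "v \<bullet> v = 0" using a by (simp add: inner_vec_def sum_8)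
  then show False using assms by (simp add: E_roots_eq)
qed

text \<open>For irreducibility, the Dynkin diagram is walked from its branch node 4, and
  \<open>E_simple_spanning\<close> attaches every root to some node of it. The D4 diagram consists
  of node 4 with legs 2, 3 and 5.\<close>

lemma simply_laced_E:
  assumes l: "l \<in> {6,7,8}" shows "simply_laced (E_roots l)"
proof
  define R where "R = (\<lambda>x y. x \<in> E_roots l \<and> y \<in> E_roots l \<and> x \<bullet> y \<noteq> (0::real))"
  have adj: "E_simple 4 \<bullet> E_simple 2 \<noteq> 0" "E_simple 4 \<bullet> E_simple 3 \<noteq> 0" "E_simple 3 \<bullet> E_simple 1 \<noteq> 0"
    "E_simple 4 \<bullet> E_simple 5 \<noteq> 0" "E_simple 5 \<bullet> E_simple 6 \<noteq> 0" "E_simple 6 \<bullet> E_simple 7 \<noteq> 0"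
    "E_simple 7 \<bullet> E_simple 8 \<noteq> 0"
    by (simp_all add: E_simple_def inner_vec_def sum_8)
  have edge: "R\<^sup>*\<^sup>* (E_simple 4) (E_simple k)"
    if "R\<^sup>*\<^sup>* (E_simple 4) (E_simple j)" "E_simple j \<bullet> E_simple k \<noteq> 0" "j \<in> {1..l}" "k \<in> {1..l}" for j k
  proof -
    have "R (E_simple j) (E_simple k)" unfolding R_def using that E_simple_root[OF l] by blast
    then show ?thesis using that(1) by (rule rtranclp.rtrancl_into_rtrancl[rotated])
  qed
  have l6: "i \<in> {1..l}" if "i \<in> {1..6}" for i using that l by auto
  have e4: "R\<^sup>*\<^sup>* (E_simple 4) (E_simple 4)" by simp
  have e2: "R\<^sup>*\<^sup>* (E_simple 4) (E_simple 2)" by (rule edge[OF e4 adj(1) l6 l6]) auto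
  have e3: "R\<^sup>*\<^sup>* (E_simple 4) (E_simple 3)" by (rule edge[OF e4 adj(2) l6 l6]) auto
  have e1: "R\<^sup>*\<^sup>* (E_simple 4) (E_simple 1)" by (rule edge[OF e3 adj(3) l6 l6]) auto
  have e5: "R\<^sup>*\<^sup>* (E_simple 4) (E_simple 5)" by (rule edge[OF e4 adj(4) l6 l6]) auto
  have e6: "R\<^sup>*\<^sup>* (E_simple 4) (E_simple 6)" by (rule edge[OF e5 adj(5) l6 l6]) auto
  have e7: "R\<^sup>*\<^sup>* (E_simple 4) (E_simple 7)" if "7 \<le> l" by (rule edge[OF e6 adj(6)]) (use that in auto)
  have e8: "R\<^sup>*\<^sup>* (E_simple 4) (E_simple 8)" if "8 \<le> l" by (rule edge[OF e7 adj(7)]) (use that in auto)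
  have s: "R\<^sup>*\<^sup>* (E_simple 4) (E_simple k)" if k: "k \<in> {1..l}" for k
  proof -
    have "k = 1 \<or> k = 2 \<or> k = 3 \<or> k = 4 \<or> k = 5 \<or> k = 6 \<or> k = 7 \<and> 7 \<le> l \<or> k = 8 \<and> 8 \<le> l"
      using k l by auto
    then show ?thesis using e1 e2 e3 e4 e5 e6 e7 e8 by (elim disjE) blast+
  qed
  have r: "R\<^sup>*\<^sup>* (E_simple 4) \<alpha>" if a: "\<alpha> \<in> E_roots l" for \<alpha>
  proof -
    obtain k where k: "k \<in> {1..l}" "\<alpha> \<bullet> E_simple k \<noteq> 0" using E_simple_spanning[OF l a] by blast
    then have "R (E_simple k) \<alpha>" unfolding R_def using a E_simple_root[OF l] by (simp add: inner_commute)
    then show ?thesis using s[OF k(1)] by (auto intro: rtranclp.intros)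
  qed
  have "symp R" unfolding R_def symp_def by (simp add: inner_commute)
  then have "symp R\<^sup>*\<^sup>*" by (rule symp_rtranclp)
  then show "(\<lambda>x y. x \<in> E_roots l \<and> y \<in> E_roots l \<and> x \<bullet> y \<noteq> 0)\<^sup>*\<^sup>* \<alpha> \<beta>"
    if "\<alpha> \<in> E_roots l" "\<beta> \<in> E_roots l" for \<alpha> \<beta>
    using r that unfolding R_def[symmetric] by (meson rtranclp_trans sympD)
  show "\<exists>\<alpha>\<in>E_roots l. \<exists>\<beta>\<in>E_roots l. \<alpha> \<bullet> \<beta> = - 1 \<and> D4_extends (E_roots l) \<alpha> \<beta>"
  proof (intro bexI conjI)
    show "E_simple 3 \<bullet> E_simple 4 = -1" by (simp add: E_simple_def inner_vec_def sum_8)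
    have "E_simple 2 \<bullet> E_simple 5 = 0 \<and> E_simple 2 \<bullet> E_simple 3 = 0 \<and> E_simple 5 \<bullet> E_simple 3 = 0
        \<and> E_simple 2 \<bullet> E_simple 4 = -1 \<and> E_simple 5 \<bullet> E_simple 4 = -1"
      by (simp add: E_simple_def inner_vec_def sum_8)
    moreover have "E_simple 2 \<in> E_roots l" "E_simple 5 \<in> E_roots l" by (rule E_simple_root[OF l l6]; simp)+
    ultimately show "D4_extends (E_roots l) (E_simple 3) (E_simple 4)"
      unfolding D4_extends_def by blast
    show "E_simple 3 \<in> E_roots l" "E_simple 4 \<in> E_roots l" by (rule E_simple_root[OF l l6]; simp)+
  qed
qed (auto simp: E_roots_finite E_roots_reflect intro: E8_lattice_inner_Ints, auto simp: E_roots_eq intro: E8_lattice_inner_Ints)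

subsection \<open>The structure constants\<close>

lemma nilpotent_exp_cubic:
  assumes "\<And>v. f (f (f v)) = 0" "f 0 = 0" "vector_space sc"
  shows "nilpotent_exp sc f v = v + f v + sc (1/2) (f (f v))"
proof -
  interpret V: vector_space sc by fact
  have z: "(f ^^ k) v = 0" if "k \<ge> 3" for k
    using that
  proof (induction k rule: dec_induct)
    case base then show ?case using assms by (simp add: numeral_3_eq_3)
  next
    case (step k) then show ?case using assms by simp
  qed
  have "nilpotent_exp sc f v = (\<Sum>k\<in>{0,1,2}. sc (1 / fact k) ((f ^^ k) v))"
    unfolding nilpotent_exp_def
  proof (rule sum.mono_neutral_left)
    show "{k. (f ^^ k) v \<noteq> 0} \<subseteq> {0,1,2}"
    proof
      fix k assume "k \<in> {k. (f ^^ k) v \<noteq> 0}"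
      then have "\<not> k \<ge> 3" using z by blast
      then show "k \<in> {0,1,2}" by auto
    qed
  qed auto
  then show ?thesis by (simp add: numeral_2_eq_2 add.assoc)
qed

text \<open>This form of the commutator avoids inverses. It serves both the automorphisms of the Lie
  algebra and the calculations in the graded group.\<close>

lemma commutator_swap:
  assumes "group H" "f \<in> carrier H" "g \<in> carrier H"
  shows "f \<otimes>\<^bsub>H\<^esub> g = group_commutator H f g \<otimes>\<^bsub>H\<^esub> (g \<otimes>\<^bsub>H\<^esub> f)"
proof -
  interpret group H by fact
  have "group_commutator H f g \<otimes>\<^bsub>H\<^esub> (g \<otimes>\<^bsub>H\<^esub> f) = f \<otimes>\<^bsub>H\<^esub> g \<otimes>\<^bsub>H\<^esub> inv\<^bsub>H\<^esub> f \<otimes>\<^bsub>H\<^esub> (inv\<^bsub>H\<^esub> g \<otimes>\<^bsub>H\<^esub> g) \<otimes>\<^bsub>H\<^esub> f"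
    unfolding group_commutator_def using assms(2,3) by (simp only: m_assoc m_closed inv_closed)
  also have "\<dots> = f \<otimes>\<^bsub>H\<^esub> g" using assms(2,3) by (simp add: m_assoc)
  finally show ?thesis by simp
qed

section \<open>Root vectors of a Chevalley basis and their exponentials\<close>

locale simply_laced_chevalley = simply_laced +
  fixes sc :: "complex \<Rightarrow> 'l::ab_group_add \<Rightarrow> 'l"
    and br :: "'l \<Rightarrow> 'l \<Rightarrow> 'l"
    and e :: "'v::euclidean_space \<Rightarrow> 'l"
  assumes chevalley: "chevalley_basis \<Phi> sc br e"
begin

sublocale V: vector_space sc
  using chevalley unfolding chevalley_basis_def complex_lie_algebra_def by blast

lemma br_linear:
  "br x (y + z) = br x y + br x z" "br x (sc c y) = sc c (br x y)"
  "br (x + y) z = br x z + br y z" "br (sc c x) y = sc c (br x y)"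
  using chevalley unfolding chevalley_basis_def complex_lie_algebra_def Vector_Spaces.linear_iff by blast+

lemma br_self: "br x x = 0"
  using chevalley unfolding chevalley_basis_def complex_lie_algebra_def by blast

lemma jacobi: "br x (br y z) + br y (br z x) + br z (br x y) = 0"
  using chevalley unfolding chevalley_basis_def complex_lie_algebra_def by blast

lemma br_zero: "br x 0 = 0" "br 0 x = 0"
  using br_linear(1)[of x 0 0] br_linear(3)[of 0 0 x] by auto

lemma br_anti: "br x y = - br y x"
proof -
  have "br (x + y) (x + y) = 0" by (rule br_self)
  then have "br x y + br y x = 0"
    unfolding br_linear(3) br_linear(1) by (simp add: br_self add.commute)
  then show ?thesis by (rule eq_neg_iff_add_eq_0[THEN iffD2])
qed

definition h where "h \<alpha> = br (e \<alpha>) (e (- \<alpha>))"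

lemma basis:
  shows "V.span (h ` \<Phi> \<union> e ` \<Phi>) = UNIV"
    and "V.dim (UNIV :: 'l set) = dim \<Phi> + card \<Phi>"
    and "\<alpha> \<in> \<Phi> \<Longrightarrow> \<beta> \<in> \<Phi> \<Longrightarrow> br (h \<alpha>) (e \<beta>) = sc (of_real (\<beta> \<bullet> coroot \<alpha>)) (e \<beta>)"
    and br_root_zero: "\<alpha> \<in> \<Phi> \<Longrightarrow> \<beta> \<in> \<Phi> \<Longrightarrow> \<alpha> + \<beta> \<notin> \<Phi> \<Longrightarrow> \<alpha> + \<beta> \<noteq> 0 \<Longrightarrow> br (e \<alpha>) (e \<beta>) = 0"
    and "\<alpha> \<in> \<Phi> \<Longrightarrow> \<beta> \<in> \<Phi> \<Longrightarrow> \<alpha> + \<beta> \<in> \<Phi> \<Longrightarrow>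
           (let p = (GREATEST k::nat. \<beta> - real k *\<^sub>R \<alpha> \<in> \<Phi>) in
              \<exists>\<epsilon>\<in>{1, -1}. br (e \<alpha>) (e \<beta>) = sc (\<epsilon> * of_nat (p + 1)) (e (\<alpha> + \<beta>)))"
  using chevalley unfolding chevalley_basis_def Let_def h_def by blast+

lemma br_h: "\<alpha> \<in> \<Phi> \<Longrightarrow> \<beta> \<in> \<Phi> \<Longrightarrow> br (h \<alpha>) (e \<beta>) = sc (of_real (\<beta> \<bullet> \<alpha>)) (e \<beta>)"
  using basis(3) by (simp add: coroot_def norm_root)

lemma br_root:
  assumes "\<alpha> \<in> \<Phi>" "\<beta> \<in> \<Phi>" "\<alpha> \<bullet> \<beta> = -1"
  shows "\<exists>\<epsilon>\<in>{1, -1}. br (e \<alpha>) (e \<beta>) = sc \<epsilon> (e (\<alpha> + \<beta>))"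
proof -
  have "(GREATEST k::nat. \<beta> - real k *\<^sub>R \<alpha> \<in> \<Phi>) = 0"
  proof (rule Greatest_equality)
    fix k :: nat assume "\<beta> - real k *\<^sub>R \<alpha> \<in> \<Phi>"
    then have "(\<beta> - real k *\<^sub>R \<alpha>) \<bullet> (\<beta> - real k *\<^sub>R \<alpha>) = 2" by (rule norm_root)
    then have "real k * (real k + 1) = 0"
      using assms by (simp add: inner_expand norm_root algebra_simps)
    then have "real k = 0 \<or> real k + 1 = 0" by (simp only: mult_eq_0_iff)
    then show "k \<le> 0" by linarith
  qed (use assms in simp)
  then show ?thesis using basis(5)[OF assms(1,2) add_root[OF assms]] by (simp add: Let_def)
qed

definition eps where "eps \<alpha> \<beta> = (SOME \<epsilon>. \<epsilon> \<in> {1, -1} \<and> br (e \<alpha>) (e \<beta>) = sc \<epsilon> (e (\<alpha> + \<beta>)))"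

lemma eps:
  assumes "\<alpha> \<in> \<Phi>" "\<beta> \<in> \<Phi>" "\<alpha> \<bullet> \<beta> = -1"
  shows "br (e \<alpha>) (e \<beta>) = sc (eps \<alpha> \<beta>) (e (\<alpha> + \<beta>))" "eps \<alpha> \<beta> \<noteq> 0"
proof -
  have "\<exists>\<epsilon>. \<epsilon> \<in> {1, -1} \<and> br (e \<alpha>) (e \<beta>) = sc \<epsilon> (e (\<alpha> + \<beta>))" using br_root[OF assms] by blast
  from someI_ex[OF this, folded eps_def] show "br (e \<alpha>) (e \<beta>) = sc (eps \<alpha> \<beta>) (e (\<alpha> + \<beta>))" "eps \<alpha> \<beta> \<noteq> 0"
    by auto
qed

lemma br_root_0:
  assumes "\<alpha> \<in> \<Phi>" "\<beta> \<in> \<Phi>" "\<alpha> \<bullet> \<beta> \<noteq> -1" "\<alpha> \<bullet> \<beta> \<noteq> -2"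
  shows "br (e \<alpha>) (e \<beta>) = 0"
proof (rule br_root_zero)
  show "\<alpha> + \<beta> \<noteq> 0" using ip_m2_iff[OF assms(1,2)] assms(4) by (auto simp: eq_neg_iff_add_eq_0)
qed (use assms add_root_iff in auto)

text \<open>A Chevalley basis is given by spanning and dimension, so linear independence is not
  immediate. If one root vector vanishes, so does its coroot; the coroot acts on neighbouring root
  vectors by -1, so these vanish too. By connectedness the algebra is zero, against its
  dimension.\<close>

lemma root_vector_nonzero:
  assumes "\<alpha> \<in> \<Phi>" shows "e \<alpha> \<noteq> 0"
proof
  assume z: "e \<alpha> = 0"
  have all: "e \<beta> = 0" if b: "\<beta> \<in> \<Phi>" for \<beta>
  proof (rule neighbour_connected[of "\<lambda>\<beta>. e \<beta> = 0", OF z assms b])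
    fix \<gamma> \<delta> assume a: "\<gamma> \<in> \<Phi>" "\<delta> \<in> \<Phi>" "\<gamma> \<bullet> \<delta> = -1" "e \<gamma> = 0"
    then have "h \<gamma> = 0" by (simp add: h_def br_zero)
    then have "sc (of_real (\<delta> \<bullet> \<gamma>)) (e \<delta>) = 0" using br_h[OF a(1,2)] by (simp add: br_zero)
    then show "e \<delta> = 0" using a by (simp add: inner_commute)
  qed
  have "h ` \<Phi> \<union> e ` \<Phi> \<subseteq> {0}" using all by (auto simp: h_def br_zero)
  then have "V.span (h ` \<Phi> \<union> e ` \<Phi>) \<subseteq> V.span {0}" by (rule V.span_mono)
  then have u: "(UNIV :: 'l set) = {0}" using basis(1) by (auto simp: V.span_insert_0)
  have "V.dim (UNIV :: 'l set) = 0"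
    using V.dim_span[of "{}"] V.dim_eq_card_independent[OF V.independent_empty]
    by (simp only: u V.span_empty card.empty)
  then have "card \<Phi> = 0" using basis(2) by simp
  then show False using assms finite_roots by auto
qed

text \<open>It is enough to test the spanning set. The longest string runs from
  \<open>e (- \<alpha>)\<close> over \<open>h \<alpha>\<close> to a multiple of
  \<open>e \<alpha>\<close>, which \<open>e \<alpha>\<close> annihilates. This turns all
  exponentials into quadratic polynomials.\<close>

lemma ad_nilpotent:
  assumes "\<alpha> \<in> \<Phi>" shows "br (e \<alpha>) (br (e \<alpha>) (br (e \<alpha>) v)) = 0"
proof -
  let ?D = "br (e \<alpha>)"
  have h: "?D (h \<beta>) = - sc (of_real (\<alpha> \<bullet> \<beta>)) (e \<alpha>)" if "\<beta> \<in> \<Phi>" for \<beta>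
    using br_anti[of "e \<alpha>" "h \<beta>"] br_h[OF that assms] by simp
  have h2: "?D (?D (h \<beta>)) = 0" if "\<beta> \<in> \<Phi>" for \<beta>
    unfolding h[OF that] V.scale_minus_left[symmetric] by (simp only: br_linear br_self V.scale_zero_right)
  have e: "?D (?D (?D (e \<beta>))) = 0" if b: "\<beta> \<in> \<Phi>" for \<beta>
  proof -
    consider "\<alpha> \<bullet> \<beta> = -1" | "\<alpha> \<bullet> \<beta> = -2" | "\<alpha> \<bullet> \<beta> \<noteq> -1" "\<alpha> \<bullet> \<beta> \<noteq> -2" by blast
    then show ?thesis
    proof cases
      case 1
      have "?D (e (\<alpha> + \<beta>)) = 0"
        by (rule br_root_0[OF assms add_root[OF assms b 1]]) (use 1 assms in \<open>auto simp: inner_add_right norm_root\<close>)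
      then show ?thesis using eps[OF assms b 1] by (simp add: br_linear br_zero)
    next
      case 2
      then have "\<beta> = - \<alpha>" using ip_m2_iff[OF assms b] by simp
      then have "?D (e \<beta>) = h \<alpha>" by (simp add: h_def)
      then show ?thesis using h2 assms by simp
    next
      case 3 then show ?thesis using br_root_0[OF assms b] by (simp add: br_zero)
    qed
  qed
  have "v \<in> V.span (h ` \<Phi> \<union> e ` \<Phi>)" using basis(1) by simp
  then show ?thesis
  proof (induction rule: V.span_induct)
    case base
    show ?case by (auto simp: V.subspace_def br_linear br_zero)
  next
    case (step x) then show ?case using e h2 by (auto simp: br_zero)
  qed
qed

definition x_root where "x_root \<alpha> y = nilpotent_exp sc (br (sc y (e \<alpha>)))"

lemma x_root_eq:
  assumes "\<alpha> \<in> \<Phi>"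
  shows "x_root \<alpha> y v = v + sc y (br (e \<alpha>) v) + sc (y * y / 2) (br (e \<alpha>) (br (e \<alpha>) v))"
proof -
  have "x_root \<alpha> y v = v + br (sc y (e \<alpha>)) v + sc (1/2) (br (sc y (e \<alpha>)) (br (sc y (e \<alpha>)) v))"
    unfolding x_root_def
    by (rule nilpotent_exp_cubic) (use ad_nilpotent[OF assms] V.vector_space_axioms in \<open>auto simp: br_linear br_zero\<close>)
  then show ?thesis by (simp add: br_linear)
qed

lemma x_root_linear:
  assumes "\<alpha> \<in> \<Phi>"
  shows "x_root \<alpha> y (v + w) = x_root \<alpha> y v + x_root \<alpha> y w" "x_root \<alpha> y (sc c v) = sc c (x_root \<alpha> y v)"
  using assms by (auto simp: x_root_eq br_linear V.scale_right_distrib mult.commute)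

lemma x_root_inverse:
  assumes "\<alpha> \<in> \<Phi>" shows "x_root \<alpha> (- y) (x_root \<alpha> y v) = v"
proof -
  define d where "d = br (e \<alpha>) v"
  define d2 where "d2 = br (e \<alpha>) d"
  have 0: "br (e \<alpha>) d2 = 0" using ad_nilpotent[OF assms] by (simp add: d2_def d_def)
  have "br (e \<alpha>) (x_root \<alpha> y v) = d + sc y d2"
    by (simp add: x_root_eq assms br_linear 0 flip: d_def d2_def)
  then have "x_root \<alpha> (- y) (x_root \<alpha> y v) = v + sc y d + sc (y * y / 2) d2 - sc y (d + sc y d2) + sc (y * y / 2) d2"
    by (simp add: x_root_eq[of _ "- y"] assms br_linear 0 flip: d2_def) (simp add: x_root_eq assms flip: d_def d2_def)
  also have "\<dots> = v + (sc (y * y / 2 + y * y / 2) d2 - sc (y * y) d2)"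
    unfolding V.scale_left_distrib V.scale_right_distrib by (simp add: algebra_simps)
  also have "y * y / 2 + y * y / 2 = y * y" by simp
  finally show ?thesis by simp
qed

lemma x_root_Bij: "\<alpha> \<in> \<Phi> \<Longrightarrow> x_root \<alpha> y \<in> carrier (BijGroup UNIV)"
  unfolding BijGroup_def Bij_def
  using x_root_inverse[of \<alpha> y] x_root_inverse[of \<alpha> "- y"]
  by (auto intro!: bij_betw_byWitness[where f' = "x_root \<alpha> (- y)"])

lemma x_root_e:
  assumes "\<alpha> \<in> \<Phi>" "\<beta> \<in> \<Phi>"
  shows "\<alpha> \<bullet> \<beta> = 0 \<Longrightarrow> x_root \<alpha> y (e \<beta>) = e \<beta>"
    "\<alpha> \<bullet> \<beta> = -1 \<Longrightarrow> x_root \<alpha> y (e \<beta>) = e \<beta> + sc (y * eps \<alpha> \<beta>) (e (\<alpha> + \<beta>))"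
proof -
  show "x_root \<alpha> y (e \<beta>) = e \<beta>" if "\<alpha> \<bullet> \<beta> = 0"
    using that assms by (simp add: x_root_eq br_root_0 br_zero)
  assume i: "\<alpha> \<bullet> \<beta> = -1"
  have "br (e \<alpha>) (e (\<alpha> + \<beta>)) = 0"
    by (rule br_root_0[OF assms(1) add_root[OF assms i]]) (use i assms in \<open>auto simp: inner_add_right norm_root\<close>)
  then show "x_root \<alpha> y (e \<beta>) = e \<beta> + sc (y * eps \<alpha> \<beta>) (e (\<alpha> + \<beta>))"
    using assms i by (simp add: x_root_eq eps br_linear br_zero)
qed

text \<open>In the Jacobi identity for the three root vectors the term with
  \<open>br (e \<gamma>) (e \<alpha>)\<close> vanishes because \<alpha> and \<gamma> are orthogonal;
  the other two terms compare the two bracketings.\<close>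

lemma eps_jacobi:
  assumes "\<alpha> \<in> \<Phi>" "\<beta> \<in> \<Phi>" "\<gamma> \<in> \<Phi>" "\<alpha> \<bullet> \<beta> = -1" "\<beta> \<bullet> \<gamma> = -1" "\<alpha> \<bullet> \<gamma> = 0"
  shows "eps \<beta> \<gamma> * eps \<alpha> (\<beta> + \<gamma>) = eps \<alpha> \<beta> * eps (\<alpha> + \<beta>) \<gamma>"
proof -
  have r: "\<alpha> + \<beta> \<in> \<Phi>" "\<beta> + \<gamma> \<in> \<Phi>" using assms add_root by blast+
  have i: "(\<alpha> + \<beta>) \<bullet> \<gamma> = -1" "\<alpha> \<bullet> (\<beta> + \<gamma>) = -1" using assms by (auto simp: inner_add_left inner_add_right)
  have "br (e \<gamma>) (e \<alpha>) = 0" using br_root_0[of \<gamma> \<alpha>] assms by (simp add: inner_commute)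
  then have "br (e \<alpha>) (br (e \<beta>) (e \<gamma>)) + br (e \<gamma>) (br (e \<alpha>) (e \<beta>)) = 0"
    using jacobi[of "e \<alpha>" "e \<beta>" "e \<gamma>"] by (simp add: br_zero)
  then have "br (e \<alpha>) (br (e \<beta>) (e \<gamma>)) = br (br (e \<alpha>) (e \<beta>)) (e \<gamma>)"
    using br_anti[of "e \<gamma>"] by simp
  then have "sc (eps \<beta> \<gamma> * eps \<alpha> (\<beta> + \<gamma>)) (e (\<alpha> + \<beta> + \<gamma>)) = sc (eps \<alpha> \<beta> * eps (\<alpha> + \<beta>) \<gamma>) (e (\<alpha> + \<beta> + \<gamma>))"
    using assms r i by (simp add: eps br_linear add.assoc)
  moreover have "e (\<alpha> + \<beta> + \<gamma>) \<noteq> 0" by (rule root_vector_nonzero[OF add_root[OF r(1) assms(3) i(1)]])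
  ultimately show ?thesis by (simp only: V.scale_cancel_right simp_thms)
qed

lemma eps_anti:
  assumes "\<alpha> \<in> \<Phi>" "\<beta> \<in> \<Phi>" "\<alpha> \<bullet> \<beta> = -1" shows "eps \<beta> \<alpha> = - eps \<alpha> \<beta>"
proof -
  have i: "\<beta> \<bullet> \<alpha> = -1" using assms by (simp add: inner_commute)
  have "sc (eps \<beta> \<alpha>) (e (\<alpha> + \<beta>)) = sc (- eps \<alpha> \<beta>) (e (\<alpha> + \<beta>))"
    using eps(1)[OF assms] eps(1)[OF assms(2,1) i] br_anti[of "e \<beta>" "e \<alpha>"] by (simp add: add.commute)
  then show ?thesis
    using root_vector_nonzero[OF add_root[OF assms]] by (simp only: V.scale_cancel_right simp_thms)
qed

section \<open>From the commutator formula to the sign identities\<close>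

context
  fixes t :: "'v \<Rightarrow> complex \<Rightarrow> 'l \<Rightarrow> 'l" and N :: "'v \<Rightarrow> 'v \<Rightarrow> int"
  assumes param: "root_subgroup_parametrizations \<Phi> sc br e t"
    and const: "structure_constants (adjoint_chevalley_group \<Phi> sc br e) \<Phi> t N"
begin

text \<open>The factors \<open>c\<close> describe a rescaling of the root vectors, so
  \<open>N\<close> and \<open>eps\<close> differ by a coboundary. Identities for \<open>eps\<close>,
  which come from the Lie bracket, can then be carried over to \<open>N\<close>.\<close>

lemma N_eq:
  obtains c :: "'v \<Rightarrow> complex" where "\<And>\<alpha>. \<alpha> \<in> \<Phi> \<Longrightarrow> c \<alpha> \<noteq> 0"
    "\<And>\<alpha> \<beta>. \<alpha> \<in> \<Phi> \<Longrightarrow> \<beta> \<in> \<Phi> \<Longrightarrow> \<alpha> \<bullet> \<beta> = -1 \<Longrightarrow> of_int (N \<alpha> \<beta>) = c \<alpha> * c \<beta> * eps \<alpha> \<beta> / c (\<alpha> + \<beta>)"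
proof -
  let ?H = "adjoint_chevalley_group \<Phi> sc br e"
  obtain c where c: "\<And>\<alpha>. \<alpha> \<in> \<Phi> \<Longrightarrow> c \<alpha> \<noteq> 0" "\<And>\<alpha> x. \<alpha> \<in> \<Phi> \<Longrightarrow> t \<alpha> x = x_root \<alpha> (c \<alpha> * x)"
    using param unfolding root_subgroup_parametrizations_def x_root_def by blast
  have B: "group (BijGroup (UNIV :: 'l set))" by (rule group_BijGroup)
  let ?R = "\<Union>\<alpha>\<in>\<Phi>. chevalley_root_subgroup sc br e \<alpha>"
  have R: "?R \<subseteq> carrier (BijGroup UNIV)"
    using x_root_Bij unfolding chevalley_root_subgroup_def x_root_def by blast
  have H: "group ?H" unfolding adjoint_chevalley_group_def
    by (rule subgroup.subgroup_is_group[OF group.generate_is_subgroup[OF B R] B])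
  have xH: "x_root \<alpha> y \<in> carrier ?H" if "\<alpha> \<in> \<Phi>" for \<alpha> y
    unfolding adjoint_chevalley_group_def x_root_def
    using that by (auto simp: chevalley_root_subgroup_def intro!: generate.incl)
  have mult: "(f \<otimes>\<^bsub>?H\<^esub> g) v = f (g v)" if "f \<in> carrier (BijGroup UNIV)" "g \<in> carrier (BijGroup UNIV)" for f g and v :: 'l
    using that by (simp add: adjoint_chevalley_group_def BijGroup_def compose_def)
  have main: "of_int (N \<alpha> \<beta>) = c \<alpha> * c \<beta> * eps \<alpha> \<beta> / c (\<alpha> + \<beta>)"
    if ab: "\<alpha> \<in> \<Phi>" "\<beta> \<in> \<Phi>" "\<alpha> \<bullet> \<beta> = -1" for \<alpha> \<beta>
  proof -
    define A B C where "A = x_root \<alpha> (c \<alpha>)" and "B = x_root \<beta> (c \<beta>)"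
      and "C = x_root (\<alpha> + \<beta>) (c (\<alpha> + \<beta>) * of_int (N \<alpha> \<beta>))"
    have r: "\<alpha> + \<beta> \<in> \<Phi>" using add_root ab by blast
    have "group_commutator ?H (t \<alpha> 1) (t \<beta> 1) = t (\<alpha> + \<beta>) (of_int (N \<alpha> \<beta>) * 1 * 1)"
      using const ab r unfolding structure_constants_def by blast
    then have comm: "group_commutator ?H A B = C"
      by (simp add: A_def B_def C_def c(2) ab r)
    have bij: "A \<in> carrier (BijGroup UNIV)" "B \<in> carrier (BijGroup UNIV)" "C \<in> carrier (BijGroup UNIV)"
      unfolding A_def B_def C_def using ab r x_root_Bij by blast+
    have "A \<otimes>\<^bsub>?H\<^esub> B = C \<otimes>\<^bsub>?H\<^esub> (B \<otimes>\<^bsub>?H\<^esub> A)"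
      using commutator_swap[OF H, of A B] comm xH ab by (simp add: A_def B_def)
    moreover have "B \<otimes>\<^bsub>?H\<^esub> A \<in> carrier (BijGroup UNIV)"
      using group.is_monoid[OF B] bij by (simp add: adjoint_chevalley_group_def monoid.m_closed)
    ultimately have eq: "A (B v) = C (B (A v))" for v
      using mult bij by metis
    \<comment> \<open>The relation \<open>A B = C B A\<close> is tested on
      \<open>e \<delta>\<close>. For this \<delta> no quadratic terms occur: \<open>A\<close> fixes
      \<open>e \<delta>\<close> and \<open>C\<close> fixes \<open>e (\<beta> + \<delta>)\<close>.
      The weight \<alpha> + \<beta> + \<delta> is reached on the left in two steps through \<beta> +
      \<delta>, on the right in one step by \<open>C\<close>.\<close>
    obtain \<delta> where d: "\<delta> \<in> \<Phi>" "\<delta> \<bullet> \<alpha> = 0" "\<delta> \<bullet> \<beta> = -1" using A3_extension[OF ab] by blast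
    have i: "\<alpha> \<bullet> \<delta> = 0" "\<beta> \<bullet> \<delta> = -1" "\<alpha> \<bullet> (\<beta> + \<delta>) = -1" "(\<alpha> + \<beta>) \<bullet> (\<beta> + \<delta>) = 0" "(\<alpha> + \<beta>) \<bullet> \<delta> = -1"
      using ab d by (auto simp: inner_add_left inner_add_right norm_root inner_commute[of \<beta> \<alpha>] inner_commute[of _ \<delta>])
    have rd: "\<beta> + \<delta> \<in> \<Phi>" using add_root i d ab by blast
    let ?a = "c \<beta> * eps \<beta> \<delta>"
    have l: "A (B (e \<delta>)) = e \<delta> + sc ?a (e (\<beta> + \<delta>)) + sc (?a * (c \<alpha> * eps \<alpha> (\<beta> + \<delta>))) (e (\<alpha> + \<beta> + \<delta>))"
      unfolding A_def B_def using ab d i rd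
      by (simp add: x_root_e x_root_linear V.scale_right_distrib add.assoc)
    have r': "C (B (A (e \<delta>))) = e \<delta> + sc (c (\<alpha> + \<beta>) * of_int (N \<alpha> \<beta>) * eps (\<alpha> + \<beta>) \<delta>) (e (\<alpha> + \<beta> + \<delta>)) + sc ?a (e (\<beta> + \<delta>))"
      unfolding A_def B_def C_def using ab d i rd r
      by (simp add: x_root_e x_root_linear)
    have "sc (?a * (c \<alpha> * eps \<alpha> (\<beta> + \<delta>))) (e (\<alpha> + \<beta> + \<delta>)) = sc (c (\<alpha> + \<beta>) * of_int (N \<alpha> \<beta>) * eps (\<alpha> + \<beta>) \<delta>) (e (\<alpha> + \<beta> + \<delta>))"
      using eq[of "e \<delta>"] l r' by (simp add: algebra_simps)
    moreover have "e (\<alpha> + \<beta> + \<delta>) \<noteq> 0" by (rule root_vector_nonzero[OF add_root[OF r d(1) i(5)]])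
    ultimately have "?a * (c \<alpha> * eps \<alpha> (\<beta> + \<delta>)) = c (\<alpha> + \<beta>) * of_int (N \<alpha> \<beta>) * eps (\<alpha> + \<beta>) \<delta>"
      by (simp only: V.scale_cancel_right simp_thms)
    moreover have "?a * (c \<alpha> * eps \<alpha> (\<beta> + \<delta>)) = c \<alpha> * c \<beta> * (eps \<alpha> \<beta> * eps (\<alpha> + \<beta>) \<delta>)"
      using eps_jacobi[OF ab(1,2) d(1) ab(3) i(2,1)] by (simp add: ac_simps)
    ultimately have "c (\<alpha> + \<beta>) * of_int (N \<alpha> \<beta>) = c \<alpha> * c \<beta> * eps \<alpha> \<beta>"
      using eps(2)[OF r d(1) i(5)] by (metis mult.assoc mult_cancel_right)
    then show ?thesis using c(1)[OF r] by (simp add: field_simps)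
  qed
  show thesis using that c(1) main by blast
qed

lemma N_anti:
  assumes "\<alpha> \<in> \<Phi>" "\<beta> \<in> \<Phi>" "\<alpha> \<bullet> \<beta> = -1"
  shows "N \<beta> \<alpha> = - N \<alpha> \<beta>"
proof -
  obtain c where c: "\<And>\<alpha>. \<alpha> \<in> \<Phi> \<Longrightarrow> c \<alpha> \<noteq> 0"
    "\<And>\<alpha> \<beta>. \<alpha> \<in> \<Phi> \<Longrightarrow> \<beta> \<in> \<Phi> \<Longrightarrow> \<alpha> \<bullet> \<beta> = -1 \<Longrightarrow> (of_int (N \<alpha> \<beta>) :: complex) = c \<alpha> * c \<beta> * eps \<alpha> \<beta> / c (\<alpha> + \<beta>)"
    using N_eq by blast
  have i: "\<beta> \<bullet> \<alpha> = -1" using assms by (simp add: inner_commute)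
  have "(of_int (N \<beta> \<alpha>) :: complex) = of_int (- N \<alpha> \<beta>)"
    using c(2)[OF assms] c(2)[OF assms(2,1) i] eps_anti[OF assms] by (simp add: ac_simps)
  then show ?thesis by (simp only: of_int_eq_iff)
qed

text \<open>The rescaling factors of the intermediate roots cancel, and what remains depends only on
  \<alpha>, \<beta>, \<gamma> and their sum. Both sides therefore reduce to
  \<open>eps_jacobi\<close>.\<close>

lemma N_cocycle:
  assumes "\<alpha> \<in> \<Phi>" "\<beta> \<in> \<Phi>" "\<gamma> \<in> \<Phi>" "\<alpha> \<bullet> \<beta> = -1" "\<beta> \<bullet> \<gamma> = -1" "\<alpha> \<bullet> \<gamma> = 0"
  shows "N \<alpha> \<beta> * N (\<alpha> + \<beta>) \<gamma> = N \<beta> \<gamma> * N \<alpha> (\<beta> + \<gamma>)"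
proof -
  obtain c where c: "\<And>\<alpha>. \<alpha> \<in> \<Phi> \<Longrightarrow> c \<alpha> \<noteq> 0"
    "\<And>\<alpha> \<beta>. \<alpha> \<in> \<Phi> \<Longrightarrow> \<beta> \<in> \<Phi> \<Longrightarrow> \<alpha> \<bullet> \<beta> = -1 \<Longrightarrow> (of_int (N \<alpha> \<beta>) :: complex) = c \<alpha> * c \<beta> * eps \<alpha> \<beta> / c (\<alpha> + \<beta>)"
    using N_eq by blast
  have r: "\<alpha> + \<beta> \<in> \<Phi>" "\<beta> + \<gamma> \<in> \<Phi>" using assms add_root by blast+
  have i: "(\<alpha> + \<beta>) \<bullet> \<gamma> = -1" "\<alpha> \<bullet> (\<beta> + \<gamma>) = -1" using assms by (auto simp: inner_add_left inner_add_right)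
  have "(of_int (N \<alpha> \<beta> * N (\<alpha> + \<beta>) \<gamma>) :: complex) = c \<alpha> * c \<beta> * c \<gamma> / c (\<alpha> + \<beta> + \<gamma>) * (eps \<alpha> \<beta> * eps (\<alpha> + \<beta>) \<gamma>)"
    using c(2)[OF assms(1,2,4)] c(2)[OF r(1) assms(3) i(1)] c(1)[OF r(1)] by simp
  also have "\<dots> = c \<alpha> * c \<beta> * c \<gamma> / c (\<alpha> + \<beta> + \<gamma>) * (eps \<beta> \<gamma> * eps \<alpha> (\<beta> + \<gamma>))"
    by (simp only: eps_jacobi[OF assms])
  also have "\<dots> = of_int (N \<beta> \<gamma> * N \<alpha> (\<beta> + \<gamma>))"
    using c(2)[OF assms(2,3,5)] c(2)[OF assms(1) r(2) i(2)] c(1)[OF r(2)] by (simp add: add.assoc)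
  finally show ?thesis by (simp only: of_int_eq_iff)
qed

lemma N_sign:
  "\<alpha> \<in> \<Phi> \<Longrightarrow> \<beta> \<in> \<Phi> \<Longrightarrow> \<alpha> \<bullet> \<beta> = -1 \<Longrightarrow> N \<alpha> \<beta> \<in> {-1, 1}"
  using const add_root unfolding structure_constants_def by blast

end

end

subsection \<open>Presented groups\<close>

definition word_eval :: "('g, 'c) monoid_scheme \<Rightarrow> ('s \<Rightarrow> 'g) \<Rightarrow> 's word \<Rightarrow> 'g" where
  "word_eval G f w = foldr (\<lambda>(s, b) a. (if b then f s else inv\<^bsub>G\<^esub> (f s)) \<otimes>\<^bsub>G\<^esub> a) w \<one>\<^bsub>G\<^esub>"

lemma word_eval_simps [simp]:
  "word_eval G f [] = \<one>\<^bsub>G\<^esub>"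
  "word_eval G f ((s, b) # w) = (if b then f s else inv\<^bsub>G\<^esub> (f s)) \<otimes>\<^bsub>G\<^esub> word_eval G f w"
  by (auto simp: word_eval_def)

lemma words_simps [simp]:
  "[] \<in> words S" "((s, b) # w) \<in> words S \<longleftrightarrow> s \<in> S \<and> w \<in> words S"
  "u @ v \<in> words S \<longleftrightarrow> u \<in> words S \<and> v \<in> words S"
  by (auto simp: words_def)

lemma word_congruence_words: "(u, v) \<in> word_congruence S R \<Longrightarrow> u \<in> words S \<and> v \<in> words S"
  by (induction rule: word_congruence.induct) auto

lemma equiv_word_congruence: "equiv (words S) (word_congruence S R)"
  by (intro equivI refl_onI symI transI subsetI)
     (auto intro: word_congruence.intros dest: word_congruence_words)

lemma word_class_eq_iff:
  assumes "u \<in> words S" "v \<in> words S"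
  shows "word_congruence S R `` {u} = word_congruence S R `` {v} \<longleftrightarrow> (u, v) \<in> word_congruence S R"
  using eq_equiv_class_iff[OF equiv_word_congruence assms] .

lemma presented_group_mult:
  assumes "u \<in> words S" "v \<in> words S"
  shows "word_congruence S R `` {u} \<otimes>\<^bsub>presented_group S R\<^esub> word_congruence S R `` {v} = word_congruence S R `` {u @ v}"
proof -
  have "word_congruence S R `` {u' @ v'} = word_congruence S R `` {u @ v}"
    if "u' \<in> word_congruence S R `` {u}" "v' \<in> word_congruence S R `` {v}" for u' v'
  proof -
    have "(u @ v, u' @ v') \<in> word_congruence S R" using that by (auto intro: word_congruence.append)
    then show ?thesis using word_class_eq_iff word_congruence_words by metis
  qed
  then have "(\<Union>u'\<in>word_congruence S R `` {u}. \<Union>v'\<in>word_congruence S R `` {v}. word_congruence S R `` {u' @ v'})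
      = (\<Union>u'\<in>word_congruence S R `` {u}. \<Union>v'\<in>word_congruence S R `` {v}. word_congruence S R `` {u @ v})"
    by (intro SUP_cong) (rule refl | blast)+
  moreover have "u \<in> word_congruence S R `` {u}" "v \<in> word_congruence S R `` {v}"
    using assms by (auto intro: word_congruence.refl)
  then have "word_congruence S R `` {u} \<noteq> {}" "word_congruence S R `` {v} \<noteq> {}" by blast+
  ultimately show ?thesis unfolding presented_group_def by simp
qed

lemma presented_group_carrier:
  "carrier (presented_group S R) = (\<lambda>w. word_congruence S R `` {w}) ` words S"
  by (auto simp: presented_group_def quotient_def)

context group
begin

lemma word_eval_closed: "f \<in> S \<rightarrow> carrier G \<Longrightarrow> w \<in> words S \<Longrightarrow> word_eval G f w \<in> carrier G"
  by (induction w) (auto simp: Pi_iff)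

lemma word_eval_append:
  assumes f: "f \<in> S \<rightarrow> carrier G" shows "u \<in> words S \<Longrightarrow> v \<in> words S \<Longrightarrow>
   word_eval G f (u @ v) = word_eval G f u \<otimes> word_eval G f v"
proof (induction u)
  case Nil then show ?case using word_eval_closed[OF f] by simp
next
  case (Cons a u)
  obtain s b where a: "a = (s, b)" by force
  have "f s \<in> carrier G" "word_eval G f u \<in> carrier G" "word_eval G f v \<in> carrier G"
    using Cons f a word_eval_closed[OF f] by auto
  then show ?case using Cons a by (auto simp: m_assoc)
qed

lemma word_eval_congruence:
  assumes f: "f \<in> S \<rightarrow> carrier G"
    and R: "\<And>u v. (u, v) \<in> R \<Longrightarrow> u \<in> words S \<Longrightarrow> v \<in> words S \<Longrightarrow> word_eval G f u = word_eval G f v"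
  shows "(u, v) \<in> word_congruence S R \<Longrightarrow> word_eval G f u = word_eval G f v"
proof (induction rule: word_congruence.induct)
  case (append u v u' v')
  then show ?case using word_eval_append[OF f] word_congruence_words by metis
next
  case (cancel s b) then show ?case using f by (auto simp: Pi_iff)
qed (use R in auto)

text \<open>The universal property, existence half: a word is evaluated in \<open>G\<close>, and
  congruent words have equal values, so any representative of a class may be chosen.\<close>

lemma presented_group_hom_exists:
  assumes f: "f \<in> S \<rightarrow> carrier G"
    and R: "\<And>u v. (u, v) \<in> R \<Longrightarrow> u \<in> words S \<Longrightarrow> v \<in> words S \<Longrightarrow> word_eval G f u = word_eval G f v"
  shows "\<exists>Q\<in>hom (presented_group S R) G. \<forall>s\<in>S. Q (presented_generator S R s) = f s"
proof -
  define Q where "Q = (\<lambda>A. word_eval G f (SOME w. w \<in> A))"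
  have Q: "Q (word_congruence S R `` {w}) = word_eval G f w" if "w \<in> words S" for w
  proof -
    have "w \<in> word_congruence S R `` {w}" using that by (auto intro: word_congruence.refl)
    then have "(SOME w'. w' \<in> word_congruence S R `` {w}) \<in> word_congruence S R `` {w}" by (rule someI)
    then show ?thesis unfolding Q_def using word_eval_congruence[OF f R] by auto
  qed
  show ?thesis
  proof (intro bexI ballI)
    fix s assume "s \<in> S"
    then show "Q (presented_generator S R s) = f s"
      using f Q[of "[(s, True)]"] by (auto simp: presented_generator_def Pi_iff)
  next
    show "Q \<in> hom (presented_group S R) G"
      unfolding hom_def presented_group_carrier
      using Q word_eval_closed[OF f] word_eval_append[OF f] by (auto simp: presented_group_mult)
  qed
qed

text \<open>This is the converse half: the images of the generators satisfy the relations. With both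
  halves, homomorphisms can be traded for families of group elements.\<close>

lemma presented_group_hom_relations:
  assumes Q: "Q \<in> hom (presented_group S R) G"
  defines "f \<equiv> \<lambda>s. Q (presented_generator S R s)"
  shows "f \<in> S \<rightarrow> carrier G"
    and "\<And>u v. (u, v) \<in> R \<Longrightarrow> u \<in> words S \<Longrightarrow> v \<in> words S \<Longrightarrow> word_eval G f u = word_eval G f v"
proof -
  let ?c = "\<lambda>w. word_congruence S R `` {w}"
  have cl: "Q (?c w) \<in> carrier G" if "w \<in> words S" for w
    using Q that by (auto simp: hom_def presented_group_carrier)
  have mult: "Q (?c (u @ v)) = Q (?c u) \<otimes> Q (?c v)" if "u \<in> words S" "v \<in> words S" for u v
    using Q that by (auto simp: hom_def presented_group_carrier presented_group_mult[symmetric])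
  have one: "Q (?c []) = \<one>"
    using mult[of "[]" "[]"] cl[of "[]"] by simp
  show f: "f \<in> S \<rightarrow> carrier G" using cl by (auto simp: f_def presented_generator_def)
  have letter: "Q (?c [(s, b)]) = (if b then f s else inv (f s))" if s: "s \<in> S" for s b
  proof (cases b)
    case False
    \<comment> \<open>The image of an inverse letter is forced by the cancellation relation and the
      uniqueness of inverses in \<open>G\<close>.\<close>
    have "?c ([(s, False)] @ [(s, True)]) = ?c []"
      using word_class_eq_iff[of "[(s, False), (s, True)]" S "[]" R] word_congruence.cancel[OF s, of False R] s by simp
    then have "Q (?c [(s, False)]) \<otimes> f s = \<one>"
      using mult[of "[(s, False)]" "[(s, True)]"] one s by (simp add: f_def presented_generator_def)
    then have "Q (?c [(s, False)]) = inv (f s)"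
      using cl[of "[(s, False)]"] f s by (intro inv_equality[symmetric]) auto
    then show ?thesis using False by simp
  qed (simp add: f_def presented_generator_def)
  have eval: "Q (?c w) = word_eval G f w" if "w \<in> words S" for w
    using that
  proof (induction w)
    case Nil then show ?case using one by simp
  next
    case (Cons a w)
    obtain s b where a: "a = (s, b)" by force
    then show ?case using Cons mult[of "[a]" w] letter[of s b] by simp
  qed
  show "word_eval G f u = word_eval G f v" if "(u, v) \<in> R" "u \<in> words S" "v \<in> words S" for u v
  proof -
    have "(u, v) \<in> word_congruence S R" using that by (rule word_congruence.relation)
    then have "?c u = ?c v" using that word_class_eq_iff by blast
    then show ?thesis using eval that by metis
  qed
qed

end

subsection \<open>Steinberg groups\<close>

text \<open>The Steinberg relations are read directly in \<open>G\<close> instead of in words. All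
  later arguments use such families, and words are confined to the next two lemmas on
  homomorphisms.\<close>

definition steinberg_family ::
  "('g, 'c) monoid_scheme \<Rightarrow> 'v::ab_group_add set \<Rightarrow> ('v \<Rightarrow> 'v \<Rightarrow> int) \<Rightarrow> ('k, 'd) ring_scheme
    \<Rightarrow> ('v \<Rightarrow> 'k \<Rightarrow> 'g) \<Rightarrow> bool" where
  "steinberg_family G \<Phi> N K f \<longleftrightarrow>
     (\<forall>\<alpha>\<in>\<Phi>. \<forall>x\<in>carrier K. f \<alpha> x \<in> carrier G)
   \<and> (\<forall>\<alpha>\<in>\<Phi>. \<forall>x\<in>carrier K. \<forall>y\<in>carrier K. f \<alpha> x \<otimes>\<^bsub>G\<^esub> f \<alpha> y = f \<alpha> (x \<oplus>\<^bsub>K\<^esub> y))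
   \<and> (\<forall>\<alpha>\<in>\<Phi>. \<forall>\<beta>\<in>\<Phi>. \<alpha> + \<beta> \<in> \<Phi> \<longrightarrow> (\<forall>x\<in>carrier K. \<forall>y\<in>carrier K.
        group_commutator G (f \<alpha> x) (f \<beta> y) = f (\<alpha> + \<beta>) ([N \<alpha> \<beta>] \<cdot>\<^bsub>K\<^esub> (x \<otimes>\<^bsub>K\<^esub> y))))
   \<and> (\<forall>\<alpha>\<in>\<Phi>. \<forall>\<beta>\<in>\<Phi>. \<beta> \<noteq> - \<alpha> \<and> \<alpha> + \<beta> \<notin> \<Phi> \<longrightarrow> (\<forall>x\<in>carrier K. \<forall>y\<in>carrier K.
        group_commutator G (f \<alpha> x) (f \<beta> y) = \<one>\<^bsub>G\<^esub>))"

context group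
begin

lemma word_eval_comm_word:
  assumes "f s \<in> carrier G" "f r \<in> carrier G"
  shows "word_eval G f (comm_word [(s, True)] [(r, True)]) = group_commutator G (f s) (f r)"
  using assms by (simp add: comm_word_def inv_word_def group_commutator_def m_assoc)

lemma steinberg_hom_exists:
  assumes K: "ring K" and F: "steinberg_family G \<Phi> N K f"
  shows "\<exists>Q\<in>hom (steinberg_group \<Phi> N K) G. \<forall>\<alpha>\<in>\<Phi>. \<forall>x\<in>carrier K. Q (steinberg_elt \<Phi> N K \<alpha> x) = f \<alpha> x"
proof -
  interpret K: ring K by fact
  let ?f = "\<lambda>(\<alpha>, x). f \<alpha> x"
  have f: "?f \<in> steinberg_generators \<Phi> K \<rightarrow> carrier G"
    using F unfolding steinberg_family_def steinberg_generators_def by auto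
  have "\<exists>Q\<in>hom (steinberg_group \<Phi> N K) G. \<forall>s\<in>steinberg_generators \<Phi> K.
      Q (presented_generator (steinberg_generators \<Phi> K) (steinberg_relations \<Phi> N K) s) = ?f s"
    unfolding steinberg_group_def
  proof (rule presented_group_hom_exists[OF f])
    fix u v assume "(u, v) \<in> steinberg_relations \<Phi> N K"
    then consider
      \<alpha> x y where "u = [((\<alpha>, x), True)] @ [((\<alpha>, y), True)]" "v = [((\<alpha>, x \<oplus>\<^bsub>K\<^esub> y), True)]"
        "\<alpha> \<in> \<Phi>" "x \<in> carrier K" "y \<in> carrier K"
    | \<alpha> \<beta> x y where "u = comm_word [((\<alpha>, x), True)] [((\<beta>, y), True)]"
        "v = [((\<alpha> + \<beta>, [N \<alpha> \<beta>] \<cdot>\<^bsub>K\<^esub> (x \<otimes>\<^bsub>K\<^esub> y)), True)]"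
        "\<alpha> \<in> \<Phi>" "\<beta> \<in> \<Phi>" "\<alpha> + \<beta> \<in> \<Phi>" "x \<in> carrier K" "y \<in> carrier K"
    | \<alpha> \<beta> x y where "u = comm_word [((\<alpha>, x), True)] [((\<beta>, y), True)]" "v = []"
        "\<alpha> \<in> \<Phi>" "\<beta> \<in> \<Phi>" "\<beta> \<noteq> - \<alpha>" "\<alpha> + \<beta> \<notin> \<Phi>" "x \<in> carrier K" "y \<in> carrier K"
      unfolding steinberg_relations_def Let_def by blast
    then show "word_eval G ?f u = word_eval G ?f v"
    proof cases
      case 1 then show ?thesis using F unfolding steinberg_family_def by simp
    next
      case 2
      then have "f (\<alpha> + \<beta>) ([N \<alpha> \<beta>] \<cdot>\<^bsub>K\<^esub> (x \<otimes>\<^bsub>K\<^esub> y)) \<in> carrier G"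
        using F unfolding steinberg_family_def by simp
      then show ?thesis using 2 F unfolding steinberg_family_def by (simp add: word_eval_comm_word)
    next
      case 3 then show ?thesis using F unfolding steinberg_family_def by (simp add: word_eval_comm_word)
    qed
  qed
  then obtain Q where Q: "Q \<in> hom (steinberg_group \<Phi> N K) G"
    "\<And>s. s \<in> steinberg_generators \<Phi> K \<Longrightarrow>
      Q (presented_generator (steinberg_generators \<Phi> K) (steinberg_relations \<Phi> N K) s) = ?f s" by blast
  show ?thesis
  proof (intro bexI[OF _ Q(1)] ballI)
    fix \<alpha> x assume "\<alpha> \<in> \<Phi>" "x \<in> carrier K"
    then have "(\<alpha>, x) \<in> steinberg_generators \<Phi> K" by (simp add: steinberg_generators_def)
    from Q(2)[OF this] show "Q (steinberg_elt \<Phi> N K \<alpha> x) = f \<alpha> x" by (simp add: steinberg_elt_def)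
  qed
qed

lemma steinberg_hom_family:
  assumes K: "ring K" and Q: "Q \<in> hom (steinberg_group \<Phi> N K) G"
  shows "steinberg_family G \<Phi> N K (\<lambda>\<alpha> x. Q (steinberg_elt \<Phi> N K \<alpha> x))"
proof -
  interpret K: ring K by fact
  let ?S = "steinberg_generators \<Phi> K" and ?R = "steinberg_relations \<Phi> N K"
  define f where "f = (\<lambda>s. Q (presented_generator ?S ?R s))"
  note rel = presented_group_hom_relations[OF Q[unfolded steinberg_group_def], folded f_def]
  have cl: "f (\<alpha>, x) \<in> carrier G" if "\<alpha> \<in> \<Phi>" "x \<in> carrier K" for \<alpha> x
    using rel(1) that by (auto simp: steinberg_generators_def)
  have 1: "f (\<alpha>, x) \<otimes> f (\<alpha>, y) = f (\<alpha>, x \<oplus>\<^bsub>K\<^esub> y)" if "\<alpha> \<in> \<Phi>" "x \<in> carrier K" "y \<in> carrier K" for \<alpha> x y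
  proof -
    have "([((\<alpha>, x), True)] @ [((\<alpha>, y), True)], [((\<alpha>, x \<oplus>\<^bsub>K\<^esub> y), True)]) \<in> ?R"
      unfolding steinberg_relations_def Let_def using that by blast
    from rel(2)[OF this] show ?thesis using that cl by (simp add: steinberg_generators_def)
  qed
  have 2: "group_commutator G (f (\<alpha>, x)) (f (\<beta>, y)) = f (\<alpha> + \<beta>, [N \<alpha> \<beta>] \<cdot>\<^bsub>K\<^esub> (x \<otimes>\<^bsub>K\<^esub> y))"
    if "\<alpha> \<in> \<Phi>" "\<beta> \<in> \<Phi>" "\<alpha> + \<beta> \<in> \<Phi>" "x \<in> carrier K" "y \<in> carrier K" for \<alpha> \<beta> x y
  proof -
    have c: "[N \<alpha> \<beta>] \<cdot>\<^bsub>K\<^esub> (x \<otimes>\<^bsub>K\<^esub> y) \<in> carrier K" using that by simp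
    have "(comm_word [((\<alpha>, x), True)] [((\<beta>, y), True)], [((\<alpha> + \<beta>, [N \<alpha> \<beta>] \<cdot>\<^bsub>K\<^esub> (x \<otimes>\<^bsub>K\<^esub> y)), True)]) \<in> ?R"
      unfolding steinberg_relations_def Let_def using that by blast
    from rel(2)[OF this] show ?thesis using that cl c
      by (simp add: steinberg_generators_def word_eval_comm_word) (simp add: comm_word_def inv_word_def)
  qed
  have 3: "group_commutator G (f (\<alpha>, x)) (f (\<beta>, y)) = \<one>"
    if "\<alpha> \<in> \<Phi>" "\<beta> \<in> \<Phi>" "\<beta> \<noteq> - \<alpha>" "\<alpha> + \<beta> \<notin> \<Phi>" "x \<in> carrier K" "y \<in> carrier K" for \<alpha> \<beta> x y
  proof -
    have "(comm_word [((\<alpha>, x), True)] [((\<beta>, y), True)], []) \<in> ?R"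
      unfolding steinberg_relations_def Let_def using that by blast
    from rel(2)[OF this] show ?thesis using that cl
      by (simp add: steinberg_generators_def word_eval_comm_word) (simp add: comm_word_def inv_word_def)
  qed
  show ?thesis unfolding steinberg_family_def steinberg_elt_def f_def[symmetric]
    using cl 1 2 3 by (auto simp: f_def)
qed

end

lemma (in ring) add_pow_sign:
  assumes "x \<in> carrier R" "n \<in> {-1, 1 :: int}"
  shows "[n] \<cdot> x = (if n = 1 then x else \<ominus> x)"
proof (cases "n = 1")
  case True then show ?thesis using add.int_pow_1[OF assms(1)] by simp
next
  case False
  then have "n = -1" using assms(2) by simp
  then show ?thesis using add.int_pow_neg[OF assms(1), of 1] add.int_pow_1[OF assms(1)] by simp
qed

lemma (in ring) add_pow_sign_inj:
  assumes "x \<in> carrier R" "y \<in> carrier R" "n \<in> {-1, 1 :: int}" "[n] \<cdot> x = [n] \<cdot> y"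
  shows "x = y"
proof (cases "n = 1")
  case True then show ?thesis using assms by (simp add: add_pow_sign)
next
  case False
  then have "\<ominus> x = \<ominus> y" using assms by (simp add: add_pow_sign)
  then have "\<ominus> (\<ominus> x) = \<ominus> (\<ominus> y)" by (rule arg_cong)
  then show ?thesis using assms(1,2) by simp
qed

lemma (in cring) unit_cancel:
  assumes "a \<in> Units R" "x \<in> carrier R" "y \<in> carrier R" "a \<otimes> x = a \<otimes> y" shows "x = y"
  using assms Units_l_cancel by blast

lemma (in cring) unit_mult_bij:
  assumes "a \<in> Units R" shows "bij_betw ((\<otimes>) a) (carrier R) (carrier R)"
proof (rule bij_betw_byWitness[where f' = "(\<otimes>) (inv a)"])
  have c: "a \<in> carrier R" "inv a \<in> carrier R" using assms by auto
  show "\<forall>x\<in>carrier R. inv a \<otimes> (a \<otimes> x) = x" "\<forall>x\<in>carrier R. a \<otimes> (inv a \<otimes> x) = x"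
    using c assms by (simp_all flip: m_assoc)
  show "(\<otimes>) a ` carrier R \<subseteq> carrier R" "(\<otimes>) (inv a) ` carrier R \<subseteq> carrier R"
    using c by auto
qed

subsection \<open>Comparison of two coordinatizations\<close>

text \<open>A version of \<open>induces_root_isos\<close> for a bare family of maps, so that it
  applies before any homomorphism has been constructed.\<close>

definition root_isos ::
  "('g, 'c) monoid_scheme \<Rightarrow> 'v set \<Rightarrow> ('v \<Rightarrow> 'g set) \<Rightarrow> ('k, 'd) ring_scheme \<Rightarrow> ('v \<Rightarrow> 'k \<Rightarrow> 'g) \<Rightarrow> bool" where
  "root_isos G \<Phi> U K f \<longleftrightarrow> (\<forall>\<alpha>\<in>\<Phi>. f \<alpha> \<in> iso (add_monoid K) (G\<lparr>carrier := U \<alpha>\<rparr>))"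

lemma root_isosD:
  assumes "root_isos G \<Phi> U K f" "\<alpha> \<in> \<Phi>"
  shows "bij_betw (f \<alpha>) (carrier K) (U \<alpha>)"
    and "x \<in> carrier K \<Longrightarrow> y \<in> carrier K \<Longrightarrow> f \<alpha> (x \<oplus>\<^bsub>K\<^esub> y) = f \<alpha> x \<otimes>\<^bsub>G\<^esub> f \<alpha> y"
  using assms by (auto simp: root_isos_def iso_def hom_def)

locale comparison = simply_laced \<Phi> + K: cring K + K': cring K'
  for \<Phi> :: "'v::euclidean_space set" and K :: "('k, 'c) ring_scheme" (structure) and K' :: "('m, 'd) ring_scheme" +
  fixes G :: "('g, 'b) monoid_scheme" and N :: "'v \<Rightarrow> 'v \<Rightarrow> int" and U :: "'v \<Rightarrow> 'g set"
    and f :: "'v \<Rightarrow> 'k \<Rightarrow> 'g" and f' :: "'v \<Rightarrow> 'm \<Rightarrow> 'g"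
  assumes N_sign: "\<alpha> \<in> \<Phi> \<Longrightarrow> \<beta> \<in> \<Phi> \<Longrightarrow> \<alpha> \<bullet> \<beta> = -1 \<Longrightarrow> N \<alpha> \<beta> \<in> {-1, 1}"
    and f: "steinberg_family G \<Phi> N K f" "root_isos G \<Phi> U K f"
    and f': "steinberg_family G \<Phi> N K' f'" "root_isos G \<Phi> U K' f'"
begin

text \<open>This is the coordinate change written \<open>g \<alpha>\<close> in the overview.\<close>

definition tr where "tr \<alpha> x = inv_into (carrier K) (f \<alpha>) (f' \<alpha> x)"

lemma tr_bij: "\<alpha> \<in> \<Phi> \<Longrightarrow> bij_betw (tr \<alpha>) (carrier K') (carrier K)"
  using bij_betw_trans[OF root_isosD(1)[OF f'(2)] bij_betw_inv_into[OF root_isosD(1)[OF f(2)]]]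
  by (simp add: tr_def[abs_def] comp_def)

lemma tr_closed [simp]: "\<alpha> \<in> \<Phi> \<Longrightarrow> x \<in> carrier K' \<Longrightarrow> tr \<alpha> x \<in> carrier K"
  using tr_bij bij_betwE by metis

lemma f_tr: "\<alpha> \<in> \<Phi> \<Longrightarrow> x \<in> carrier K' \<Longrightarrow> f \<alpha> (tr \<alpha> x) = f' \<alpha> x"
  unfolding tr_def using root_isosD(1)[OF f(2)] root_isosD(1)[OF f'(2)]
  by (metis bij_betw_inv_into_right bij_betwE)

lemma f_inj: "\<alpha> \<in> \<Phi> \<Longrightarrow> x \<in> carrier K \<Longrightarrow> y \<in> carrier K \<Longrightarrow> f \<alpha> x = f \<alpha> y \<Longrightarrow> x = y"
  using root_isosD(1)[OF f(2)] by (metis bij_betw_imp_inj_on inj_onD)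

lemma tr_add:
  assumes "\<alpha> \<in> \<Phi>" "x \<in> carrier K'" "y \<in> carrier K'"
  shows "tr \<alpha> (x \<oplus>\<^bsub>K'\<^esub> y) = tr \<alpha> x \<oplus> tr \<alpha> y"
  by (rule f_inj[OF assms(1)])
     (use assms in \<open>auto simp: f_tr root_isosD(2)[OF f(2)] root_isosD(2)[OF f'(2)]\<close>)

lemma tr_minus:
  assumes "\<alpha> \<in> \<Phi>" "x \<in> carrier K'" shows "tr \<alpha> (\<ominus>\<^bsub>K'\<^esub> x) = \<ominus> tr \<alpha> x"
proof -
  have z: "tr \<alpha> \<zero>\<^bsub>K'\<^esub> = \<zero>"
    using tr_add[OF assms(1), of "\<zero>\<^bsub>K'\<^esub>" "\<zero>\<^bsub>K'\<^esub>"] assms by simp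
  have "tr \<alpha> (\<ominus>\<^bsub>K'\<^esub> x) \<oplus> tr \<alpha> x = \<zero>"
    using tr_add[OF assms(1), of "\<ominus>\<^bsub>K'\<^esub> x" x] assms z by (simp add: K'.l_neg)
  then show ?thesis using assms K.minus_equality[of "tr \<alpha> (\<ominus>\<^bsub>K'\<^esub> x)" "tr \<alpha> x"] by simp
qed

text \<open>Both coordinatizations describe the same commutator with the same sign
  \<open>N \<alpha> \<beta>\<close>. Additive maps commute with the sign, so it cancels.\<close>

lemma tr_mult:
  assumes "\<alpha> \<in> \<Phi>" "\<beta> \<in> \<Phi>" "\<alpha> \<bullet> \<beta> = -1" "x \<in> carrier K'" "y \<in> carrier K'"
  shows "tr (\<alpha> + \<beta>) (x \<otimes>\<^bsub>K'\<^esub> y) = tr \<alpha> x \<otimes> tr \<beta> y"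
proof -
  note r = add_root[OF assms(1-3)]
  note n = N_sign[OF assms(1-3)]
  have "f (\<alpha> + \<beta>) ([N \<alpha> \<beta>] \<cdot> (tr \<alpha> x \<otimes> tr \<beta> y)) = group_commutator G (f \<alpha> (tr \<alpha> x)) (f \<beta> (tr \<beta> y))"
    using f(1) assms r tr_closed unfolding steinberg_family_def by metis
  also have "\<dots> = f' (\<alpha> + \<beta>) ([N \<alpha> \<beta>] \<cdot>\<^bsub>K'\<^esub> (x \<otimes>\<^bsub>K'\<^esub> y))"
    using f'(1) assms r unfolding steinberg_family_def by (simp add: f_tr)
  also have "\<dots> = f (\<alpha> + \<beta>) (tr (\<alpha> + \<beta>) ([N \<alpha> \<beta>] \<cdot>\<^bsub>K'\<^esub> (x \<otimes>\<^bsub>K'\<^esub> y)))"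
    using assms r by (simp add: f_tr)
  also have "tr (\<alpha> + \<beta>) ([N \<alpha> \<beta>] \<cdot>\<^bsub>K'\<^esub> (x \<otimes>\<^bsub>K'\<^esub> y)) = [N \<alpha> \<beta>] \<cdot> tr (\<alpha> + \<beta>) (x \<otimes>\<^bsub>K'\<^esub> y)"
    using n assms r by (simp add: K.add_pow_sign[OF _ n] K'.add_pow_sign[OF _ n] tr_minus)
  finally have "[N \<alpha> \<beta>] \<cdot> (tr \<alpha> x \<otimes> tr \<beta> y) = [N \<alpha> \<beta>] \<cdot> tr (\<alpha> + \<beta>) (x \<otimes>\<^bsub>K'\<^esub> y)"
    by (rule f_inj[OF r, rotated 2]) (use assms r in auto)
  from K.add_pow_sign_inj[OF _ _ n this] assms r show ?thesis by simp
qed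

definition scale where "scale \<alpha> = tr \<alpha> \<one>\<^bsub>K'\<^esub>"

lemma scale_Units: assumes "\<beta> \<in> \<Phi>" shows "scale \<beta> \<in> Units K"
proof -
  obtain \<alpha> where a: "\<alpha> \<in> \<Phi>" "\<beta> \<bullet> \<alpha> = -1" using neighbour_exists assms by blast
  then have ab: "\<alpha> \<bullet> \<beta> = -1" by (simp add: inner_commute)
  note r = add_root[OF a(1) assms ab]
  \<comment> \<open>Surjectivity at the sum provides the inverse: if x is sent to 1 there, then
    writing x as x times 1 exhibits \<open>tr \<alpha> x\<close> as inverse of
    \<open>scale \<beta>\<close>.\<close>
  have "\<one> \<in> tr (\<alpha> + \<beta>) ` carrier K'" using tr_bij[OF r] by (simp add: bij_betw_def)
  then obtain x where x: "x \<in> carrier K'" "\<one> = tr (\<alpha> + \<beta>) x" by blast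
  then have "\<one> = tr \<alpha> x \<otimes> scale \<beta>"
    using tr_mult[OF a(1) assms ab x(1) K'.one_closed] by (simp add: scale_def)
  then show ?thesis
    unfolding Units_def using a x assms by (auto simp: scale_def intro!: bexI[of _ "tr \<alpha> x"] K.m_comm)
qed

lemma scale_closed [simp]: "\<beta> \<in> \<Phi> \<Longrightarrow> scale \<beta> \<in> carrier K"
  by (simp add: scale_def)

lemma scale_add:
  assumes "\<alpha> \<in> \<Phi>" "\<beta> \<in> \<Phi>" "\<alpha> \<bullet> \<beta> = -1" shows "scale (\<alpha> + \<beta>) = scale \<alpha> \<otimes> scale \<beta>"
  using tr_mult[OF assms K'.one_closed K'.one_closed] by (simp add: scale_def)

lemma comparison_exists:
  "\<exists>F\<in>ring_iso K' K. \<exists>a\<in>adjoint_torus \<Phi> K. \<forall>\<alpha>\<in>\<Phi>. \<forall>x\<in>carrier K'. f' \<alpha> x = f \<alpha> (a \<alpha> \<otimes> F x)"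
proof -
  obtain \<rho> \<sigma> where rs: "\<rho> \<in> \<Phi>" "\<sigma> \<in> \<Phi>" "\<rho> \<bullet> \<sigma> = -1" using some_D4 by blast
  define F where "F = (\<lambda>x. inv (scale \<rho>) \<otimes> tr \<rho> x)"
  have inv_cl: "inv (scale \<rho>) \<in> carrier K" using scale_Units[OF rs(1)] by simp
  have F_cl: "F x \<in> carrier K" if "x \<in> carrier K'" for x
    using that rs inv_cl by (simp add: F_def)
  have eq: "\<forall>x\<in>carrier K'. tr \<alpha> x = scale \<alpha> \<otimes> F x" if a: "\<alpha> \<in> \<Phi>" for \<alpha>
  proof (rule neighbour_connected[of "\<lambda>\<alpha>. \<forall>x\<in>carrier K'. tr \<alpha> x = scale \<alpha> \<otimes> F x", OF _ rs(1) a])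
    show "\<forall>x\<in>carrier K'. tr \<rho> x = scale \<rho> \<otimes> F x"
      using scale_Units[OF rs(1)] rs inv_cl by (simp add: F_def flip: K.m_assoc)
  next
    fix \<gamma> \<delta> assume gd: "\<gamma> \<in> \<Phi>" "\<delta> \<in> \<Phi>" "\<gamma> \<bullet> \<delta> = -1" and IH: "\<forall>x\<in>carrier K'. tr \<gamma> x = scale \<gamma> \<otimes> F x"
    show "\<forall>x\<in>carrier K'. tr \<delta> x = scale \<delta> \<otimes> F x"
    proof
      fix x assume x: "x \<in> carrier K'"
      \<comment> \<open>The factorizations 1 times x and x times 1 are compared in the root
        \<open>\<gamma> + \<delta>\<close>; cancelling the unit \<open>scale \<gamma>\<close> moves
        the formula from \<gamma> to \<delta>.\<close>
      have "scale \<gamma> \<otimes> tr \<delta> x = tr (\<gamma> + \<delta>) x"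
        using tr_mult[OF gd K'.one_closed x] x by (simp add: scale_def)
      also have "\<dots> = tr \<gamma> x \<otimes> scale \<delta>"
        using tr_mult[OF gd x K'.one_closed] x by (simp add: scale_def)
      also have "\<dots> = scale \<gamma> \<otimes> (scale \<delta> \<otimes> F x)"
        using IH x gd F_cl[OF x] by (simp add: K.m_ac)
      finally show "tr \<delta> x = scale \<delta> \<otimes> F x"
        by (rule K.unit_cancel[OF scale_Units[OF gd(1)], rotated 2]) (use x gd F_cl in auto)
    qed
  qed
  have F_one: "F \<one>\<^bsub>K'\<^esub> = \<one>" using scale_Units[OF rs(1)] by (simp add: F_def flip: scale_def)
  have F_mult: "F (x \<otimes>\<^bsub>K'\<^esub> y) = F x \<otimes> F y" if xy: "x \<in> carrier K'" "y \<in> carrier K'" for x y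
  proof -
    note r = add_root[OF rs]
    have "scale (\<rho> + \<sigma>) \<otimes> F (x \<otimes>\<^bsub>K'\<^esub> y) = tr \<rho> x \<otimes> tr \<sigma> y"
      using eq[OF r] tr_mult[OF rs xy] xy by simp
    also have "\<dots> = scale (\<rho> + \<sigma>) \<otimes> (F x \<otimes> F y)"
      using eq[OF rs(1)] eq[OF rs(2)] xy rs F_cl by (simp add: scale_add K.m_ac)
    finally show ?thesis
      by (rule K.unit_cancel[OF scale_Units[OF r], rotated 2]) (use xy F_cl in auto)
  qed
  have F_bij: "bij_betw F (carrier K') (carrier K)"
    using bij_betw_trans[OF tr_bij[OF rs(1)] K.unit_mult_bij[OF K.Units_inv_Units[OF scale_Units[OF rs(1)]]]]
    by (simp add: F_def[abs_def] comp_def)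
  have F_iso: "F \<in> ring_iso K' K"
  proof (rule ring_iso_memI)
    show "F (x \<oplus>\<^bsub>K'\<^esub> y) = F x \<oplus> F y" if "x \<in> carrier K'" "y \<in> carrier K'" for x y
      using that rs inv_cl by (simp add: F_def tr_add K.r_distr)
  qed (use F_cl F_one F_mult F_bij in auto)
  define a where "a = restrict scale \<Phi>"
  have a: "a \<in> adjoint_torus \<Phi> K"
    unfolding adjoint_torus_def a_def using scale_Units scale_add by (auto simp: add_root_iff)
  have "\<forall>\<alpha>\<in>\<Phi>. \<forall>x\<in>carrier K'. f' \<alpha> x = f \<alpha> (a \<alpha> \<otimes> F x)"
    using eq f_tr by (simp add: a_def)
  then show ?thesis using F_iso a by blast
qed

end

section \<open>Twists by a ring isomorphism and a torus element\<close>

context simply_laced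
begin

lemma twisted_family:
  fixes K :: "('k, 'c) ring_scheme" (structure) and K' :: "('m, 'd) ring_scheme"
  assumes N_sign: "\<And>\<alpha> \<beta>. \<alpha> \<in> \<Phi> \<Longrightarrow> \<beta> \<in> \<Phi> \<Longrightarrow> \<alpha> \<bullet> \<beta> = -1 \<Longrightarrow> N \<alpha> \<beta> \<in> {-1, 1}"
    and K: "cring K" and K': "cring K'"
    and f: "steinberg_family G \<Phi> N K f"
    and F: "F \<in> ring_iso K' K" and a: "a \<in> adjoint_torus \<Phi> K"
  shows "steinberg_family G \<Phi> N K' (\<lambda>\<alpha> x. f \<alpha> (a \<alpha> \<otimes> F x))"
proof -
  interpret K: cring K by fact
  interpret K': cring K' by fact
  have h: "F \<in> ring_hom K' K" using F by (simp add: ring_iso_def)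
  have acl: "a \<alpha> \<in> carrier K" if "\<alpha> \<in> \<Phi>" for \<alpha>
    using a that unfolding adjoint_torus_def by (auto simp: PiE_iff)
  have Fcl: "F x \<in> carrier K" if "x \<in> carrier K'" for x using ring_hom_closed[OF h that] .
  have am: "a (\<alpha> + \<beta>) = a \<alpha> \<otimes> a \<beta>" if "\<alpha> \<in> \<Phi>" "\<beta> \<in> \<Phi>" "\<alpha> + \<beta> \<in> \<Phi>" for \<alpha> \<beta>
    using a that unfolding adjoint_torus_def by auto
  have Fm: "F (\<ominus>\<^bsub>K'\<^esub> x) = \<ominus> F x" if x: "x \<in> carrier K'" for x
    using ring_hom_cring.hom_a_inv[OF RingHom.ring_hom_cringI[OF RingHom.ring_hom_ringI2 K' K] x]
      h K'.ring_axioms K.ring_axioms by blast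
  have c: "group_commutator G (f \<alpha> (a \<alpha> \<otimes> F x)) (f \<beta> (a \<beta> \<otimes> F y)) =
       f (\<alpha> + \<beta>) (a (\<alpha> + \<beta>) \<otimes> F ([N \<alpha> \<beta>] \<cdot>\<^bsub>K'\<^esub> (x \<otimes>\<^bsub>K'\<^esub> y)))"
    if ab: "\<alpha> \<in> \<Phi>" "\<beta> \<in> \<Phi>" "\<alpha> + \<beta> \<in> \<Phi>" and xy: "x \<in> carrier K'" "y \<in> carrier K'" for \<alpha> \<beta> x y
  proof -
    have n: "N \<alpha> \<beta> \<in> {-1, 1}" using N_sign ab add_root_iff by blast
    have cl: "a \<alpha> \<otimes> F x \<in> carrier K" "a \<beta> \<otimes> F y \<in> carrier K" using ab xy acl Fcl by auto
    have "group_commutator G (f \<alpha> (a \<alpha> \<otimes> F x)) (f \<beta> (a \<beta> \<otimes> F y))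
        = f (\<alpha> + \<beta>) ([N \<alpha> \<beta>] \<cdot> ((a \<alpha> \<otimes> F x) \<otimes> (a \<beta> \<otimes> F y)))"
      using f ab cl unfolding steinberg_family_def by blast
    also have "(a \<alpha> \<otimes> F x) \<otimes> (a \<beta> \<otimes> F y) = a (\<alpha> + \<beta>) \<otimes> F (x \<otimes>\<^bsub>K'\<^esub> y)"
      using am[OF ab] ring_hom_mult[OF h xy] acl ab Fcl xy by (simp add: K.m_ac)
    also have "[N \<alpha> \<beta>] \<cdot> (a (\<alpha> + \<beta>) \<otimes> F (x \<otimes>\<^bsub>K'\<^esub> y)) = a (\<alpha> + \<beta>) \<otimes> F ([N \<alpha> \<beta>] \<cdot>\<^bsub>K'\<^esub> (x \<otimes>\<^bsub>K'\<^esub> y))"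
      using xy ab acl Fcl by (simp add: K.add_pow_sign[OF _ n] K'.add_pow_sign[OF _ n] Fm K.r_minus)
    finally show ?thesis .
  qed
  show ?thesis
    unfolding steinberg_family_def
  proof (intro conjI ballI impI)
    fix \<alpha> x y assume ax: "\<alpha> \<in> \<Phi>" "x \<in> carrier K'" "y \<in> carrier K'"
    then have "a \<alpha> \<otimes> F (x \<oplus>\<^bsub>K'\<^esub> y) = (a \<alpha> \<otimes> F x) \<oplus> (a \<alpha> \<otimes> F y)"
      using ring_hom_add[OF h] acl Fcl by (simp add: K.r_distr)
    then show "f \<alpha> (a \<alpha> \<otimes> F x) \<otimes>\<^bsub>G\<^esub> f \<alpha> (a \<alpha> \<otimes> F y) = f \<alpha> (a \<alpha> \<otimes> F (x \<oplus>\<^bsub>K'\<^esub> y))"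
      using f ax acl Fcl unfolding steinberg_family_def by simp
  qed (use f acl Fcl c in \<open>auto simp: steinberg_family_def\<close>)
qed

lemma twisted_root_isos:
  fixes K :: "('k, 'c) ring_scheme" (structure) and K' :: "('m, 'd) ring_scheme"
  assumes K: "cring K" and f: "root_isos G \<Phi> U K f"
    and F: "F \<in> ring_iso K' K" and a: "a \<in> adjoint_torus \<Phi> K"
  shows "root_isos G \<Phi> U K' (\<lambda>\<alpha> x. f \<alpha> (a \<alpha> \<otimes> F x))"
  unfolding root_isos_def
proof
  interpret K: cring K by fact
  fix \<alpha> assume al: "\<alpha> \<in> \<Phi>"
  have h: "F \<in> ring_hom K' K" "bij_betw F (carrier K') (carrier K)" using F by (auto simp: ring_iso_def)
  have au: "a \<alpha> \<in> Units K" using a al unfolding adjoint_torus_def by (auto simp: PiE_iff)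
  have "bij_betw (\<lambda>x. f \<alpha> (a \<alpha> \<otimes> F x)) (carrier K') (U \<alpha>)"
    using bij_betw_trans[OF bij_betw_trans[OF h(2) K.unit_mult_bij[OF au]] root_isosD(1)[OF f al]]
    by (simp add: comp_def)
  moreover have "f \<alpha> (a \<alpha> \<otimes> F (x \<oplus>\<^bsub>K'\<^esub> y)) = f \<alpha> (a \<alpha> \<otimes> F x) \<otimes>\<^bsub>G\<^esub> f \<alpha> (a \<alpha> \<otimes> F y)"
    if "x \<in> carrier K'" "y \<in> carrier K'" for x y
    using that au ring_hom_add[OF h(1)] ring_hom_closed[OF h(1)] root_isosD(2)[OF f al]
    by (simp add: K.r_distr K.Units_closed)
  ultimately show "(\<lambda>x. f \<alpha> (a \<alpha> \<otimes> F x)) \<in> iso (add_monoid K') (G\<lparr>carrier := U \<alpha>\<rparr>)"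
    by (auto simp: iso_def hom_def dest: bij_betwE)
qed

text \<open>Ring homomorphisms preserve 1, so x = 1 isolates the torus element, and cancelling its
  unit values gives \<open>F\<close>. Torus elements are extensional on the roots and hence equal as
  functions; ring isomorphisms are compared on the carrier.\<close>

lemma twist_unique:
  fixes K :: "('k, 'c) ring_scheme" (structure) and K' :: "('m, 'd) ring_scheme"
  assumes K: "cring K" and K': "cring K'" and f: "root_isos G \<Phi> U K f"
    and F: "F1 \<in> ring_iso K' K" "F2 \<in> ring_iso K' K" and a: "a1 \<in> adjoint_torus \<Phi> K" "a2 \<in> adjoint_torus \<Phi> K"
    and eq: "\<And>\<alpha> x. \<alpha> \<in> \<Phi> \<Longrightarrow> x \<in> carrier K' \<Longrightarrow> f \<alpha> (a1 \<alpha> \<otimes> F1 x) = f \<alpha> (a2 \<alpha> \<otimes> F2 x)"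
  shows "a1 = a2" "x \<in> carrier K' \<Longrightarrow> F1 x = F2 x"
proof -
  interpret K: cring K by fact
  interpret K': cring K' by fact
  have h: "F1 \<in> ring_hom K' K" "F2 \<in> ring_hom K' K" using F by (auto simp: ring_iso_def)
  have au: "a1 \<alpha> \<in> Units K" "a2 \<alpha> \<in> Units K" if "\<alpha> \<in> \<Phi>" for \<alpha>
    using a that unfolding adjoint_torus_def by (auto simp: PiE_iff)
  have e: "a1 \<alpha> \<otimes> F1 x = a2 \<alpha> \<otimes> F2 x" if "\<alpha> \<in> \<Phi>" "x \<in> carrier K'" for \<alpha> x
    using eq[OF that] root_isosD(1)[OF f that(1)] that au h ring_hom_closed
    by (metis K.Units_closed K.m_closed bij_betw_imp_inj_on inj_onD)
  have a_eq: "a1 \<alpha> = a2 \<alpha>" if "\<alpha> \<in> \<Phi>" for \<alpha>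
    using e[OF that K'.one_closed] ring_hom_one[OF h(1)] ring_hom_one[OF h(2)] au[OF that] by (simp add: K.Units_closed)
  show "a1 = a2"
    using a unfolding adjoint_torus_def by (auto intro!: PiE_ext[of a1 \<Phi> "\<lambda>_. Units K" a2] a_eq)
  assume x: "x \<in> carrier K'"
  obtain \<alpha> where al: "\<alpha> \<in> \<Phi>" using some_D4 by blast
  show "F1 x = F2 x"
    using e[OF al x] a_eq[OF al] K.unit_cancel[OF au(1)[OF al]] ring_hom_closed[OF h(1) x] ring_hom_closed[OF h(2) x] by simp
qed

end

subsection \<open>Commutator maps in a graded group\<close>

context simply_laced
begin

text \<open>The inner products of the combination with \<alpha> and \<beta> determine a and b by
  Cramer's rule. Each of these is an integer between -2 and 2, so finitely many cases remain, and
  squared norm 2 with positive coefficients leaves one.\<close>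

lemma positive_combination:
  assumes "\<alpha> \<in> \<Phi>" "\<beta> \<in> \<Phi>" "a *\<^sub>R \<alpha> + b *\<^sub>R \<beta> \<in> \<Phi>" "a > 0" "b > 0" "\<bar>\<alpha> \<bullet> \<beta>\<bar> \<le> 1"
  shows "\<alpha> \<bullet> \<beta> = -1 \<and> a *\<^sub>R \<alpha> + b *\<^sub>R \<beta> = \<alpha> + \<beta>"
proof -
  define \<zeta> where "\<zeta> = a *\<^sub>R \<alpha> + b *\<^sub>R \<beta>"
  define k where "k = \<alpha> \<bullet> \<beta>"
  have z: "\<zeta> \<in> \<Phi>" using assms by (simp add: \<zeta>_def)
  have m: "\<zeta> \<bullet> \<alpha> = 2 * a + k * b" "\<zeta> \<bullet> \<beta> = k * a + 2 * b"
    using assms by (auto simp: \<zeta>_def k_def inner_add_left norm_root inner_commute[of \<beta> \<alpha>])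
  have n: "a * (\<zeta> \<bullet> \<alpha>) + b * (\<zeta> \<bullet> \<beta>) = 2"
    using norm_root[OF z] by (simp add: \<zeta>_def inner_add_left inner_add_right inner_commute algebra_simps)
  have k: "k = -1 \<or> k = 0 \<or> k = 1"
    using ip_cases[OF assms(1,2)] assms(6) by (auto simp: k_def)
  have p: "\<zeta> \<bullet> \<alpha> = 2 \<or> \<zeta> \<bullet> \<alpha> = 1 \<or> \<zeta> \<bullet> \<alpha> = 0 \<or> \<zeta> \<bullet> \<alpha> = -1 \<or> \<zeta> \<bullet> \<alpha> = -2"
    "\<zeta> \<bullet> \<beta> = 2 \<or> \<zeta> \<bullet> \<beta> = 1 \<or> \<zeta> \<bullet> \<beta> = 0 \<or> \<zeta> \<bullet> \<beta> = -1 \<or> \<zeta> \<bullet> \<beta> = -2"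
    using ip_cases z assms by blast+
  have "k = -1 \<and> \<zeta> \<bullet> \<alpha> = 1 \<and> \<zeta> \<bullet> \<beta> = 1"
    using k
  proof (elim disjE)
    assume k: "k = -1"
    \<comment> \<open>The denominator 3 is the Gram determinant 4 - \<open>k * k\<close> for k =
      -1.\<close>
    then have a: "a = (2 * (\<zeta> \<bullet> \<alpha>) + \<zeta> \<bullet> \<beta>) / 3" "b = (\<zeta> \<bullet> \<alpha> + 2 * (\<zeta> \<bullet> \<beta>)) / 3"
      using m by (auto simp: field_simps)
    then show ?thesis using k p n assms(4,5) by (elim disjE) auto
  next
    assume "k = 0"
    then have a: "a = (\<zeta> \<bullet> \<alpha>) / 2" "b = (\<zeta> \<bullet> \<beta>) / 2"
      using m by (auto simp: field_simps)
    then show ?thesis using p n assms(4,5) by (elim disjE) auto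
  next
    assume "k = 1"
    then have a: "a = (2 * (\<zeta> \<bullet> \<alpha>) - \<zeta> \<bullet> \<beta>) / 3" "b = (2 * (\<zeta> \<bullet> \<beta>) - \<zeta> \<bullet> \<alpha>) / 3"
      using m by (auto simp: field_simps)
    then show ?thesis using p n assms(4,5) by (elim disjE) auto
  qed
  moreover from this have "a = 1" "b = 1" using m by auto
  ultimately show ?thesis by (simp add: k_def)
qed

lemma open_root_interval_eq:
  assumes "\<alpha> \<in> \<Phi>" "\<beta> \<in> \<Phi>"
  shows "\<alpha> \<bullet> \<beta> = -1 \<Longrightarrow> open_root_interval \<Phi> \<alpha> \<beta> \<subseteq> {\<alpha> + \<beta>}"
    "\<alpha> \<bullet> \<beta> = 0 \<or> \<alpha> \<bullet> \<beta> = 1 \<Longrightarrow> open_root_interval \<Phi> \<alpha> \<beta> = {}"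
  using positive_combination[OF assms] by (fastforce simp: open_root_interval_def)+

lemma root_pair_independent:
  assumes "\<alpha> \<in> \<Phi>" "\<beta> \<in> \<Phi>" "\<alpha> \<bullet> \<beta> = 0 \<or> \<alpha> \<bullet> \<beta> = 1 \<or> \<alpha> \<bullet> \<beta> = -1"
  shows "\<alpha> \<noteq> \<beta>" "independent {\<alpha>, \<beta>}"
proof -
  show ne: "\<alpha> \<noteq> \<beta>" using assms norm_root by auto
  have b: "independent {\<beta>}" using assms by (simp add: dependent_single) (metis zero_not_root)
  have "\<alpha> \<notin> span {\<beta>}"
  proof
    assume "\<alpha> \<in> span {\<beta>}"
    then obtain k where k: "\<alpha> = k *\<^sub>R \<beta>" by (auto simp: span_singleton)
    then have "\<alpha> \<bullet> \<beta> = 2 * k" "\<alpha> \<bullet> \<alpha> = 2 * (k * k)" using assms norm_root by auto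
    then have "k * k = 1" "2 * k = 0 \<or> 2 * k = 1 \<or> 2 * k = -1" using assms norm_root by auto
    then have "(2 * k) * (2 * k) = 0 \<or> (2 * k) * (2 * k) = 1" by (elim disjE) simp_all
    moreover have "(2 * k) * (2 * k) = 4 * (k * k)" by simp
    ultimately show False using \<open>k * k = 1\<close> by linarith
  qed
  then show "independent {\<alpha>, \<beta>}" using b ne by (simp add: independent_insert)
qed

text \<open>This makes the second axiom of a root grading applicable to two roots with inner product
  1: by \<open>positive_combination\<close> the cone they span contains no further root.\<close>

lemma acute_pair_special_closed:
  assumes "\<alpha> \<in> \<Phi>" "\<beta> \<in> \<Phi>" "\<alpha> \<bullet> \<beta> = 1"
  shows "special_closed \<Phi> {\<alpha>, \<beta>}" "extreme_root {\<alpha>, \<beta>} \<alpha>"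
proof -
  define C where "C = {a *\<^sub>R \<alpha> + b *\<^sub>R \<beta> | a b. a \<ge> 0 \<and> b \<ge> 0}"
  have cc: "convex_cone C"
    unfolding convex_cone_def convex_def cone_def conic_def C_def
  proof (intro conjI ballI allI impI)
    show "{a *\<^sub>R \<alpha> + b *\<^sub>R \<beta> |a b. 0 \<le> a \<and> 0 \<le> b} \<noteq> {}" by auto
  next
    fix x y u v :: real and p q
    assume "p \<in> {a *\<^sub>R \<alpha> + b *\<^sub>R \<beta> |a b. 0 \<le> a \<and> 0 \<le> b}" "q \<in> {a *\<^sub>R \<alpha> + b *\<^sub>R \<beta> |a b. 0 \<le> a \<and> 0 \<le> b}"
      and uv: "0 \<le> u" "0 \<le> v"
    then obtain a b a' b' where e: "p = a *\<^sub>R \<alpha> + b *\<^sub>R \<beta>" "q = a' *\<^sub>R \<alpha> + b' *\<^sub>R \<beta>" "0 \<le> a" "0 \<le> b" "0 \<le> a'" "0 \<le> b'"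
      by blast
    show "u *\<^sub>R p + v *\<^sub>R q \<in> {a *\<^sub>R \<alpha> + b *\<^sub>R \<beta> |a b. 0 \<le> a \<and> 0 \<le> b}"
      by (rule CollectI, rule exI[of _ "u * a + v * a'"], rule exI[of _ "u * b + v * b'"])
         (use e uv in \<open>auto simp: algebra_simps\<close>)
  next
    fix p and c :: real
    assume "p \<in> {a *\<^sub>R \<alpha> + b *\<^sub>R \<beta> |a b. 0 \<le> a \<and> 0 \<le> b}" and c: "0 \<le> c"
    then obtain a b where e: "p = a *\<^sub>R \<alpha> + b *\<^sub>R \<beta>" "0 \<le> a" "0 \<le> b" by blast
    show "c *\<^sub>R p \<in> {a *\<^sub>R \<alpha> + b *\<^sub>R \<beta> |a b. 0 \<le> a \<and> 0 \<le> b}"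
      by (rule CollectI, rule exI[of _ "c * a"], rule exI[of _ "c * b"])
         (use e c in \<open>auto simp: algebra_simps\<close>)
  qed
  have incl: "\<alpha> \<in> C" "\<beta> \<in> C" unfolding C_def
    by (rule CollectI, rule exI[of _ 1], rule exI[of _ 0], simp) (rule CollectI, rule exI[of _ 0], rule exI[of _ 1], simp)
  have pos: "\<forall>v\<in>C. - v \<in> C \<longrightarrow> v = 0"
  proof (intro ballI impI)
    fix v assume "v \<in> C" "- v \<in> C"
    then obtain a b a' b' where e: "v = a *\<^sub>R \<alpha> + b *\<^sub>R \<beta>" "- v = a' *\<^sub>R \<alpha> + b' *\<^sub>R \<beta>" "0 \<le> a" "0 \<le> b" "0 \<le> a'" "0 \<le> b'"
      unfolding C_def by blast
    \<comment> \<open>Pairing with \<open>\<alpha> + \<beta>\<close> is positive on both generators,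
      so the cone contains no opposite non-zero vectors.\<close>
    have "v \<bullet> (\<alpha> + \<beta>) = 3 * a + 3 * b" unfolding e(1) using assms
      by (simp add: inner_expand norm_root)
    moreover have "(- v) \<bullet> (\<alpha> + \<beta>) = 3 * a' + 3 * b'" unfolding e(2) using assms
      by (simp add: inner_expand norm_root)
    ultimately have "a = 0" "b = 0" using e(3-6) by (auto simp: inner_minus_left)
    then show "v = 0" using e by simp
  qed
  have cap: "\<Phi> \<inter> C = {\<alpha>, \<beta>}"
  proof
    show "\<Phi> \<inter> C \<subseteq> {\<alpha>, \<beta>}"
    proof
      fix v assume "v \<in> \<Phi> \<inter> C"
      then obtain a b where e: "v = a *\<^sub>R \<alpha> + b *\<^sub>R \<beta>" "0 \<le> a" "0 \<le> b" and v: "v \<in> \<Phi>" unfolding C_def by blast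
      have "a = 0 \<or> b = 0" using positive_combination[OF assms(1,2), of a b] v e assms(3) by force
      moreover have "v = \<beta>" if "a = 0"
      proof -
        have "v \<bullet> v = 2" using norm_root v by blast
        then have "b * b = 1" using e that assms norm_root by simp
        then have "b = 1" using e(3) by (simp add: square_eq_1_iff)
        then show ?thesis using e that by simp
      qed
      moreover have "v = \<alpha>" if "b = 0"
      proof -
        have "v \<bullet> v = 2" using norm_root v by blast
        then have "a * a = 1" using e that assms norm_root by simp
        then have "a = 1" using e(2) by (simp add: square_eq_1_iff)
        then show ?thesis using e that by simp
      qed
      ultimately show "v \<in> {\<alpha>, \<beta>}" by blast
    qed
  qed (use assms incl in auto)
  show "special_closed \<Phi> {\<alpha>, \<beta>}" unfolding special_closed_def using cc pos cap by blast
  define H where "H = convex_cone hull {\<alpha>, \<beta>}"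
  have HC: "H \<subseteq> C" unfolding H_def by (rule hull_minimal) (use incl cc in auto)
  have ccH: "convex_cone H" unfolding H_def by (simp add: convex_cone_convex_cone_hull)
  have aH: "\<alpha> \<in> H" unfolding H_def by (simp add: hull_inc)
  \<comment> \<open>A functional that vanishes on \<alpha> and takes the value 3 on \<beta>: its
    kernel supports the cone exactly along the ray of \<alpha>.\<close>
  define f where "f = 2 *\<^sub>R \<beta> - \<alpha>"
  have fC: "f \<bullet> (a *\<^sub>R \<alpha> + b *\<^sub>R \<beta>) = 3 * b" for a b
    using assms by (simp add: f_def inner_expand norm_root)
  have "(H \<inter> {x. f \<bullet> x = 0}) face_of H"
  proof (rule face_of_Int_supporting_hyperplane_ge)
    show "convex H" using ccH by (simp add: convex_cone_def)
    show "f \<bullet> x \<ge> 0" if "x \<in> H" for x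
      using that HC fC unfolding C_def by fastforce
  qed
  moreover have "H \<inter> {x. f \<bullet> x = 0} = {c *\<^sub>R \<alpha> | c. c \<ge> 0}"
  proof
    show "H \<inter> {x. f \<bullet> x = 0} \<subseteq> {c *\<^sub>R \<alpha> | c. c \<ge> 0}"
    proof
      fix x assume x: "x \<in> H \<inter> {x. f \<bullet> x = 0}"
      then obtain a b where e: "x = a *\<^sub>R \<alpha> + b *\<^sub>R \<beta>" "0 \<le> a" using HC unfolding C_def by blast
      then have "b = 0" using x fC by simp
      then show "x \<in> {c *\<^sub>R \<alpha> | c. c \<ge> 0}" using e by auto
    qed
    show "{c *\<^sub>R \<alpha> | c. c \<ge> 0} \<subseteq> H \<inter> {x. f \<bullet> x = 0}"
    proof
      fix x assume "x \<in> {c *\<^sub>R \<alpha> | c. c \<ge> 0}"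
      then obtain c where c: "x = c *\<^sub>R \<alpha>" "c \<ge> 0" by blast
      have "x \<in> H" using ccH aH c by (simp add: convex_cone_def conic_def)
      then show "x \<in> H \<inter> {x. f \<bullet> x = 0}" using fC[of c 0] c by simp
    qed
  qed
  moreover have "\<alpha> \<noteq> 0" using assms by auto
  ultimately have "extreme_ray_of {c *\<^sub>R \<alpha> | c. c \<ge> 0} H"
    unfolding extreme_ray_of_def by auto
  moreover have "\<alpha> \<in> {c *\<^sub>R \<alpha> | c. c \<ge> 0}" by (rule CollectI, rule exI[of _ 1]) simp
  ultimately show "extreme_root {\<alpha>, \<beta>} \<alpha>"
    unfolding extreme_root_def H_def by blast
qed

lemma reflection_conj:
  assumes "\<alpha> \<in> \<Phi>" "\<beta> \<in> \<Phi>" "\<alpha> \<bullet> \<beta> = -1"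
  shows "reflection \<beta> (reflection \<alpha> (reflection \<beta> \<gamma>)) = reflection (\<alpha> + \<beta>) \<gamma>"
  using assms add_root[OF assms]
  by (simp add: reflection_eq inner_expand norm_root) (simp add: algebra_simps)

lemma reflection_reflection: "\<alpha> \<in> \<Phi> \<Longrightarrow> reflection \<alpha> (reflection \<alpha> \<beta>) = \<beta>"
  by (simp add: reflection_eq inner_diff_left norm_root)

end

section \<open>Weyl elements, abelian root subgroups and associativity of commutators\<close>

locale graded_by = simply_laced \<Phi> + group G
  for \<Phi> :: "'v::euclidean_space set" and G :: "('g, 'c) monoid_scheme" (structure) +
  fixes U :: "'v \<Rightarrow> 'g set"
  assumes graded: "root_graded_group G \<Phi> U"
begin

abbreviation comm where "comm x y \<equiv> group_commutator G x y"

lemma U_subgroup: "\<alpha> \<in> \<Phi> \<Longrightarrow> subgroup (U \<alpha>) G"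
  using graded unfolding root_graded_group_def commutator_relations_def by blast

lemma U_carrier [simp]: "\<alpha> \<in> \<Phi> \<Longrightarrow> x \<in> U \<alpha> \<Longrightarrow> x \<in> carrier G"
  using U_subgroup subgroup.mem_carrier by metis

lemma U_closed:
  assumes "\<alpha> \<in> \<Phi>"
  shows "x \<in> U \<alpha> \<Longrightarrow> y \<in> U \<alpha> \<Longrightarrow> x \<otimes> y \<in> U \<alpha>" "x \<in> U \<alpha> \<Longrightarrow> inv x \<in> U \<alpha>" "\<one> \<in> U \<alpha>"
  using subgroup.m_closed[OF U_subgroup[OF assms]] subgroup.m_inv_closed[OF U_subgroup[OF assms]]
    subgroup.one_closed[OF U_subgroup[OF assms]] by blast+

lemma comm_in_interval:
  assumes "\<alpha> \<in> \<Phi>" "\<beta> \<in> \<Phi>" "\<alpha> \<bullet> \<beta> = 0 \<or> \<alpha> \<bullet> \<beta> = 1 \<or> \<alpha> \<bullet> \<beta> = -1" "x \<in> U \<alpha>" "y \<in> U \<beta>"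
  shows "comm x y \<in> generate G (\<Union>\<gamma> \<in> open_root_interval \<Phi> \<alpha> \<beta>. U \<gamma>)"
proof -
  have "comm x y \<in> commutator_subgroup G (U \<alpha>) (U \<beta>)"
    unfolding commutator_subgroup_def using assms by (intro generate.incl) blast
  then show ?thesis
    using graded root_pair_independent[OF assms(1-3)] assms(1,2)
    unfolding root_graded_group_def commutator_relations_def by blast
qed

lemma comm_closed:
  assumes "\<alpha> \<in> \<Phi>" "\<beta> \<in> \<Phi>" "\<alpha> \<bullet> \<beta> = -1" "x \<in> U \<alpha>" "y \<in> U \<beta>"
  shows "comm x y \<in> U (\<alpha> + \<beta>)"
proof -
  have "(\<Union>\<gamma> \<in> open_root_interval \<Phi> \<alpha> \<beta>. U \<gamma>) \<subseteq> U (\<alpha> + \<beta>)"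
    using open_root_interval_eq(1)[OF assms(1-3)] by blast
  then have "generate G (\<Union>\<gamma> \<in> open_root_interval \<Phi> \<alpha> \<beta>. U \<gamma>) \<subseteq> U (\<alpha> + \<beta>)"
    by (rule generate_subgroup_incl) (rule U_subgroup[OF add_root[OF assms(1-3)]])
  then show ?thesis using comm_in_interval assms by blast
qed

lemma comm_mult:
  assumes "x \<in> carrier G" "y \<in> carrier G" shows "x \<otimes> y = comm x y \<otimes> (y \<otimes> x)"
  using commutator_swap[OF group_axioms assms] .

lemma comm_unique:
  assumes "x \<in> carrier G" "y \<in> carrier G" "c \<in> carrier G" "x \<otimes> y = c \<otimes> (y \<otimes> x)" shows "comm x y = c"
proof -
  have "comm x y \<in> carrier G" using assms by (simp add: group_commutator_def)
  moreover have "comm x y \<otimes> (y \<otimes> x) = c \<otimes> (y \<otimes> x)" using comm_mult assms by metis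
  ultimately show ?thesis using assms by (metis m_closed right_cancel)
qed

lemma comm_carrier [simp]: "x \<in> carrier G \<Longrightarrow> y \<in> carrier G \<Longrightarrow> comm x y \<in> carrier G"
  by (simp add: group_commutator_def)

lemma comm_one: "x \<in> carrier G \<Longrightarrow> comm x \<one> = \<one>"
  by (rule comm_unique) auto

lemma commute:
  assumes "\<alpha> \<in> \<Phi>" "\<beta> \<in> \<Phi>" "\<alpha> \<bullet> \<beta> = 0 \<or> \<alpha> \<bullet> \<beta> = 1" "x \<in> U \<alpha>" "y \<in> U \<beta>"
  shows "x \<otimes> y = y \<otimes> x"
proof -
  have "comm x y = \<one>"
    using comm_in_interval[of \<alpha> \<beta> x y] open_root_interval_eq(2)[OF assms(1-3)] assms generate_empty by auto
  then show ?thesis using comm_mult[of x y] assms by simp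
qed

text \<open>Its purpose is to eliminate the surplus factor in the action of a Weyl element in
  \<open>weyl_pair_exists\<close>.\<close>

lemma acute_trivial_intersection:
  assumes "\<alpha> \<in> \<Phi>" "\<beta> \<in> \<Phi>" "\<alpha> \<bullet> \<beta> = 1" "x \<in> U \<alpha>" "x \<in> U \<beta>" shows "x = \<one>"
proof -
  have "\<alpha> \<noteq> \<beta>" using assms norm_root by auto
  then have d: "{\<alpha>, \<beta>} - {\<alpha>} = {\<beta>}" by auto
  have "U \<alpha> \<inter> generate G (\<Union>\<gamma> \<in> {\<alpha>, \<beta>} - {\<alpha>}. U \<gamma>) = {\<one>}"
    using graded acute_pair_special_closed[OF assms(1-3)]
    unfolding root_graded_group_def commutator_relations_def by blast
  then have "U \<alpha> \<inter> generate G (U \<beta>) = {\<one>}" unfolding d by simp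
  moreover have "x \<in> generate G (U \<beta>)" by (rule generate.incl[OF assms(5)])
  ultimately show ?thesis using assms(4) by auto
qed

lemma weyl_element_conj:
  assumes "\<alpha> \<in> \<Phi>" "weyl_element G \<Phi> U \<alpha> n" "\<beta> \<in> \<Phi>" "x \<in> U \<beta>"
  shows "n \<otimes> x \<otimes> inv n \<in> U (reflection \<alpha> \<beta>)"
  using assms unfolding weyl_element_def by blast

lemma weyl_element_carrier:
  assumes "\<alpha> \<in> \<Phi>" "weyl_element G \<Phi> U \<alpha> n" shows "n \<in> carrier G"
proof -
  have m: "- \<alpha> \<in> \<Phi>" using assms by simp
  obtain b1 b2 b3 where "n = b1 \<otimes> b2 \<otimes> b3" "b1 \<in> U \<alpha>" "b2 \<in> U (- \<alpha>)" "b3 \<in> U \<alpha>"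
    using assms(2) unfolding weyl_element_def set_mult_def by blast
  then show ?thesis using U_carrier[OF assms(1)] U_carrier[OF m] by simp
qed

lemma weyl_element_conj_surj:
  assumes "\<alpha> \<in> \<Phi>" "weyl_element G \<Phi> U \<alpha> n" "\<beta> \<in> \<Phi>" "x \<in> U (reflection \<alpha> \<beta>)"
  shows "\<exists>y\<in>U \<beta>. x = n \<otimes> y \<otimes> inv n"
  using assms unfolding weyl_element_def by blast

lemma conj_inj:
  assumes "n \<in> carrier G" "x \<in> carrier G" "y \<in> carrier G" "n \<otimes> x \<otimes> inv n = n \<otimes> y \<otimes> inv n"
  shows "x = y"
  using assms by simp

lemma conj_mult:
  assumes "n \<in> carrier G" "x \<in> carrier G" "y \<in> carrier G"
  shows "n \<otimes> (x \<otimes> y) \<otimes> inv n = (n \<otimes> x \<otimes> inv n) \<otimes> (n \<otimes> y \<otimes> inv n)"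
  using assms by (simp add: m_assoc) (simp flip: m_assoc)

lemma conj_comm:
  assumes "n \<in> carrier G" "x \<in> carrier G" "y \<in> carrier G"
  shows "n \<otimes> comm x y \<otimes> inv n = comm (n \<otimes> x \<otimes> inv n) (n \<otimes> y \<otimes> inv n)"
proof -
  have "n \<otimes> (x \<otimes> y) \<otimes> inv n = n \<otimes> (comm x y \<otimes> (y \<otimes> x)) \<otimes> inv n" using comm_mult assms by metis
  then show ?thesis
    by (intro comm_unique[symmetric]) (use assms in \<open>auto simp: conj_mult\<close>)
qed

lemma conj_eq: "x \<in> carrier G \<Longrightarrow> y \<in> carrier G \<Longrightarrow> x \<otimes> y \<otimes> inv x = comm x y \<otimes> y"
  using comm_mult[of x y] by (simp add: m_assoc)

text \<open>
  Here \<open>b\<close> stands for the last factor of \<open>n\<close> in \<open>U \<beta> U (- \<beta>) U \<beta>\<close>.  Only its action is recorded, since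
  this is preserved by conjugation with Weyl elements.
\<close>

definition weyl_pair where
  "weyl_pair \<beta> n b \<longleftrightarrow> weyl_element G \<Phi> U \<beta> n \<and> b \<in> U \<beta>
     \<and> (\<forall>\<gamma>\<in>\<Phi>. \<beta> \<bullet> \<gamma> = -1 \<longrightarrow> (\<forall>x\<in>U \<gamma>. n \<otimes> x \<otimes> inv n = comm b x))"

lemma weyl_pair_exists: assumes "\<beta> \<in> \<Phi>" shows "\<exists>n b. weyl_pair \<beta> n b"
proof -
  obtain n where n: "weyl_element G \<Phi> U \<beta> n"
    using graded assms unfolding root_graded_group_def by blast
  have mb: "- \<beta> \<in> \<Phi>" using assms by simp
  obtain b1 b2 b3 where b: "n = b1 \<otimes> b2 \<otimes> b3" "b1 \<in> U \<beta>" "b2 \<in> U (- \<beta>)" "b3 \<in> U \<beta>"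
    using n unfolding weyl_element_def set_mult_def by blast
  note bc = U_carrier[OF assms b(2)] U_carrier[OF mb b(3)] U_carrier[OF assms b(4)]
  have "n \<otimes> x \<otimes> inv n = comm b3 x" if g: "\<gamma> \<in> \<Phi>" "\<beta> \<bullet> \<gamma> = -1" and x: "x \<in> U \<gamma>" for \<gamma> x
  proof -
    note r = add_root[OF assms g]
    define c where "c = comm b3 x"
    define d where "d = comm b2 c"
    \<comment> \<open>Conjugating x by the three factors of n in turn produces an element of
      \<open>U (\<beta> + \<gamma>)\<close> times z times c, where z collects everything that lies
      in \<open>U \<gamma>\<close>.\<close>
    define z where "z = d \<otimes> x"
    have c: "c \<in> U (\<beta> + \<gamma>)" unfolding c_def by (rule comm_closed[OF assms g b(4) x])
    have i: "(- \<beta>) \<bullet> (\<beta> + \<gamma>) = -1" "(- \<beta>) \<bullet> \<gamma> = 1" "(\<beta> + \<gamma>) \<bullet> \<gamma> = 1" "\<beta> \<bullet> (\<beta> + \<gamma>) = 1" "\<gamma> \<bullet> (\<beta> + \<gamma>) = 1"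
      using g assms by (auto simp: inner_add_right inner_add_left norm_root inner_commute[of \<gamma> \<beta>])
    have d: "d \<in> U \<gamma>" unfolding d_def using comm_closed[OF mb r i(1) b(3) c] by simp
    have z: "z \<in> U \<gamma>" unfolding z_def using U_closed d x g by blast
    note cl = U_carrier[OF g(1) x] U_carrier[OF r c] U_carrier[OF g(1) d] U_carrier[OF g(1) z]
    have "n \<otimes> x \<otimes> inv n = b1 \<otimes> (b2 \<otimes> (b3 \<otimes> x \<otimes> inv b3) \<otimes> inv b2) \<otimes> inv b1"
      using bc cl by (simp add: b(1) inv_mult_group m_assoc)
    also have "b3 \<otimes> x \<otimes> inv b3 = c \<otimes> x" using conj_eq bc cl by (simp add: c_def)
    also have "b2 \<otimes> (c \<otimes> x) \<otimes> inv b2 = (b2 \<otimes> c \<otimes> inv b2) \<otimes> (b2 \<otimes> x \<otimes> inv b2)"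
      using conj_mult bc cl by blast
    also have "b2 \<otimes> c \<otimes> inv b2 = d \<otimes> c" using conj_eq bc cl by (simp add: d_def)
    also have "b2 \<otimes> x \<otimes> inv b2 = x"
      using commute[OF mb g(1) _ b(3) x] i bc cl by (metis disjI2 inv_solve_right m_closed)
    also have "d \<otimes> c \<otimes> x = z \<otimes> c"
      using commute[OF r g(1) _ c x] i cl by (simp add: z_def m_assoc)
    also have "b1 \<otimes> (z \<otimes> c) \<otimes> inv b1 = (b1 \<otimes> z \<otimes> inv b1) \<otimes> (b1 \<otimes> c \<otimes> inv b1)"
      using conj_mult bc cl by blast
    also have "b1 \<otimes> z \<otimes> inv b1 = comm b1 z \<otimes> z" using conj_eq bc cl by simp
    also have "b1 \<otimes> c \<otimes> inv b1 = c"
      using commute[OF assms r _ b(2) c] i bc cl by (metis disjI2 inv_solve_right m_closed)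
    finally have eq: "n \<otimes> x \<otimes> inv n = comm b1 z \<otimes> z \<otimes> c" .
    have "reflection \<beta> \<gamma> = \<beta> + \<gamma>" using assms g by (simp add: reflection_eq inner_commute[of \<gamma> \<beta>])
    then have in1: "comm b1 z \<otimes> z \<otimes> c \<in> U (\<beta> + \<gamma>)"
      using weyl_element_conj[OF assms n g(1) x] eq by simp
    have in2: "comm b1 z \<in> U (\<beta> + \<gamma>)" by (rule comm_closed[OF assms g b(2) z])
    \<comment> \<open>The conjugate of x lies in \<open>U (\<beta> + \<gamma>)\<close> since n acts
      as a reflection, and so do the factors around z. Hence z belongs to two root subgroups at
      inner product 1 and is trivial, which leaves c.\<close>
    have "inv (comm b1 z) \<otimes> (comm b1 z \<otimes> z \<otimes> c) \<otimes> inv c \<in> U (\<beta> + \<gamma>)"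
      by (intro U_closed[OF r] in1 in2 c)
    moreover have "inv (comm b1 z) \<otimes> (comm b1 z \<otimes> z \<otimes> c) \<otimes> inv c = z"
    proof -
      have "inv (comm b1 z) \<otimes> (comm b1 z \<otimes> z \<otimes> c) \<otimes> inv c = (inv (comm b1 z) \<otimes> comm b1 z) \<otimes> z \<otimes> (c \<otimes> inv c)"
        using bc cl by (simp only: m_assoc m_closed inv_closed comm_carrier)
      then show ?thesis using bc cl by simp
    qed
    ultimately have "z \<in> U (\<beta> + \<gamma>)" by simp
    then have "z = \<one>" using acute_trivial_intersection[OF g(1) r i(5) z] by blast
    then show ?thesis using eq comm_one bc cl by (simp add: c_def)
  qed
  then show ?thesis unfolding weyl_pair_def using n b by blast
qed

text \<open>Conjugating one Weyl element by another gives a Weyl element for the reflected root, and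
  the recorded factor a becomes its conjugate \<open>comm b a\<close>. Thus the invertible elements
  are closed under commutators, as \<open>W_mul\<close> will require.\<close>

lemma weyl_pair_conj:
  assumes "\<alpha> \<in> \<Phi>" "\<beta> \<in> \<Phi>" "\<alpha> \<bullet> \<beta> = -1" "weyl_pair \<beta> n b" "weyl_pair \<alpha> m a"
  shows "weyl_pair (\<alpha> + \<beta>) (n \<otimes> m \<otimes> inv n) (comm b a)"
proof -
  note r = add_root[OF assms(1-3)]
  have ba: "\<beta> \<bullet> \<alpha> = -1" using assms by (simp add: inner_commute)
  have n: "weyl_element G \<Phi> U \<beta> n" "b \<in> U \<beta>" and m: "weyl_element G \<Phi> U \<alpha> m" "a \<in> U \<alpha>"
    using assms(4,5) by (auto simp: weyl_pair_def)
  note nc = weyl_element_carrier[OF assms(2) n(1)] and mc = weyl_element_carrier[OF assms(1) m(1)]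
  note ac = U_carrier[OF assms(1) m(2)] and bc = U_carrier[OF assms(2) n(2)]
  have na: "n \<otimes> a \<otimes> inv n = comm b a"
    using assms(4) assms(1) ba m(2) unfolding weyl_pair_def by blast
  have refl: "reflection \<beta> \<alpha> = \<alpha> + \<beta>" "reflection \<beta> (- \<alpha>) = - (\<alpha> + \<beta>)" "reflection \<alpha> \<beta> = \<alpha> + \<beta>"
    using assms ba by (auto simp: reflection_eq)
  have inv_nmn: "inv (n \<otimes> m \<otimes> inv n) = n \<otimes> inv m \<otimes> inv n"
    using nc mc by (simp add: inv_mult_group m_assoc)
  have pull: "\<exists>y\<in>U (reflection \<beta> \<gamma>). x = n \<otimes> y \<otimes> inv n" if "\<gamma> \<in> \<Phi>" "x \<in> U \<gamma>" for \<gamma> x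
    using weyl_element_conj_surj[OF assms(2) n(1) reflection_root[OF assms(2) that(1)]] that
    by (simp add: reflection_reflection assms(2))
  have act: "(n \<otimes> m \<otimes> inv n) \<otimes> (n \<otimes> y \<otimes> inv n) \<otimes> inv (n \<otimes> m \<otimes> inv n) = n \<otimes> (m \<otimes> y \<otimes> inv m) \<otimes> inv n"
    if "y \<in> carrier G" for y
  proof -
    have "(n \<otimes> m \<otimes> inv n) \<otimes> (n \<otimes> y \<otimes> inv n) \<otimes> inv (n \<otimes> m \<otimes> inv n)
       = n \<otimes> (m \<otimes> ((inv n \<otimes> n) \<otimes> (y \<otimes> ((inv n \<otimes> n) \<otimes> (inv m \<otimes> inv n)))))"
      unfolding inv_nmn using nc mc that by (simp only: m_assoc m_closed inv_closed)
    then show ?thesis using nc mc that by (simp add: m_assoc)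
  qed
  have "n \<otimes> m \<otimes> inv n \<in> (U (\<alpha> + \<beta>) <#> U (- (\<alpha> + \<beta>))) <#> U (\<alpha> + \<beta>)"
  proof -
    have ma: "- \<alpha> \<in> \<Phi>" using assms by simp
    obtain a1 a2 a3 where a: "m = a1 \<otimes> a2 \<otimes> a3" "a1 \<in> U \<alpha>" "a2 \<in> U (- \<alpha>)" "a3 \<in> U \<alpha>"
      using m(1) unfolding weyl_element_def set_mult_def by blast
    have "n \<otimes> m \<otimes> inv n = (n \<otimes> a1 \<otimes> inv n) \<otimes> (n \<otimes> a2 \<otimes> inv n) \<otimes> (n \<otimes> a3 \<otimes> inv n)"
      using nc U_carrier[OF assms(1) a(2)] U_carrier[OF ma a(3)] U_carrier[OF assms(1) a(4)]
      by (simp add: a(1) conj_mult)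
    moreover have "n \<otimes> a1 \<otimes> inv n \<in> U (\<alpha> + \<beta>)" "n \<otimes> a3 \<otimes> inv n \<in> U (\<alpha> + \<beta>)" "n \<otimes> a2 \<otimes> inv n \<in> U (- (\<alpha> + \<beta>))"
      using weyl_element_conj[OF assms(2) n(1) assms(1)] weyl_element_conj[OF assms(2) n(1) ma] a refl by auto
    ultimately show ?thesis unfolding set_mult_def by blast
  qed
  moreover have "{(n \<otimes> m \<otimes> inv n) \<otimes> g \<otimes> inv (n \<otimes> m \<otimes> inv n) | g. g \<in> U \<gamma>} = U (reflection (\<alpha> + \<beta>) \<gamma>)"
    if g: "\<gamma> \<in> \<Phi>" for \<gamma>
  proof -
    note g' = reflection_root[OF assms(2) g]
    have rc: "reflection \<beta> (reflection \<alpha> (reflection \<beta> \<gamma>)) = reflection (\<alpha> + \<beta>) \<gamma>"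
      by (rule reflection_conj[OF assms(1-3)])
    show ?thesis
    proof (intro equalityI subsetI)
      fix x assume "x \<in> {(n \<otimes> m \<otimes> inv n) \<otimes> g \<otimes> inv (n \<otimes> m \<otimes> inv n) | g. g \<in> U \<gamma>}"
      then obtain g0 where g0: "g0 \<in> U \<gamma>" "x = (n \<otimes> m \<otimes> inv n) \<otimes> g0 \<otimes> inv (n \<otimes> m \<otimes> inv n)" by blast
      obtain y where y: "y \<in> U (reflection \<beta> \<gamma>)" "g0 = n \<otimes> y \<otimes> inv n" using pull[OF g g0(1)] by blast
      have "x = n \<otimes> (m \<otimes> y \<otimes> inv m) \<otimes> inv n" using act U_carrier[OF g' y(1)] g0(2) y(2) by simp
      then show "x \<in> U (reflection (\<alpha> + \<beta>) \<gamma>)"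
        using weyl_element_conj[OF assms(2) n(1) reflection_root[OF assms(1) g'] weyl_element_conj[OF assms(1) m(1) g' y(1)]] rc
        by simp
    next
      fix x assume "x \<in> U (reflection (\<alpha> + \<beta>) \<gamma>)"
      then obtain y where y: "y \<in> U (reflection \<alpha> (reflection \<beta> \<gamma>))" "x = n \<otimes> y \<otimes> inv n"
        using weyl_element_conj_surj[OF assms(2) n(1) reflection_root[OF assms(1) g'], of x] rc by auto
      obtain z where z: "z \<in> U (reflection \<beta> \<gamma>)" "y = m \<otimes> z \<otimes> inv m"
        using weyl_element_conj_surj[OF assms(1) m(1) g' y(1)] by blast
      have "n \<otimes> z \<otimes> inv n \<in> U \<gamma>"
        using weyl_element_conj[OF assms(2) n(1) g' z(1)] by (simp add: reflection_reflection assms(2))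
      moreover have "x = (n \<otimes> m \<otimes> inv n) \<otimes> (n \<otimes> z \<otimes> inv n) \<otimes> inv (n \<otimes> m \<otimes> inv n)"
        using act U_carrier[OF g' z(1)] y(2) z(2) by simp
      ultimately show "x \<in> {(n \<otimes> m \<otimes> inv n) \<otimes> g \<otimes> inv (n \<otimes> m \<otimes> inv n) | g. g \<in> U \<gamma>}" by blast
    qed
  qed
  ultimately have "weyl_element G \<Phi> U (\<alpha> + \<beta>) (n \<otimes> m \<otimes> inv n)"
    unfolding weyl_element_def by blast
  moreover have "comm b a \<in> U (\<alpha> + \<beta>)"
    using comm_closed[OF assms(2,1) ba n(2) m(2)] by (simp add: add.commute)
  moreover have "(n \<otimes> m \<otimes> inv n) \<otimes> x \<otimes> inv (n \<otimes> m \<otimes> inv n) = comm (comm b a) x"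
    if g: "\<gamma> \<in> \<Phi>" "(\<alpha> + \<beta>) \<bullet> \<gamma> = -1" "x \<in> U \<gamma>" for \<gamma> x
  proof -
    note g' = reflection_root[OF assms(2) g(1)]
    obtain y where y: "y \<in> U (reflection \<beta> \<gamma>)" "x = n \<otimes> y \<otimes> inv n" using pull[OF g(1,3)] by blast
    note yc = U_carrier[OF g' y(1)]
    \<comment> \<open>Reflection in \<beta> is an isometry taking \<alpha> to \<alpha> + \<beta>, so
      the action of m on the pulled-back element y is known.\<close>
    have "\<alpha> \<bullet> reflection \<beta> \<gamma> = -1"
      using g(2) ba assms(2,3) by (simp add: reflection_eq inner_diff_right inner_add_left inner_commute[of \<gamma>])
    then have "m \<otimes> y \<otimes> inv m = comm a y" using assms(5) g' y(1) unfolding weyl_pair_def by blast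
    then show ?thesis
      using act[OF yc] conj_comm[OF nc ac yc] na y(2) by simp
  qed
  ultimately show ?thesis unfolding weyl_pair_def by blast
qed

text \<open>Write \<alpha> as the sum of \<alpha> + \<delta> and -\<delta>. By surjectivity of Weyl
  conjugation x is a commutator of elements of these two root subgroups, and both commute with
  \<open>U \<alpha>\<close> because the inner products with \<alpha> are 1.\<close>

lemma U_abelian:
  assumes "\<alpha> \<in> \<Phi>" "x \<in> U \<alpha>" "y \<in> U \<alpha>" shows "x \<otimes> y = y \<otimes> x"
proof -
  obtain \<delta> where d: "\<delta> \<in> \<Phi>" "\<alpha> \<bullet> \<delta> = -1" using neighbour_exists assms by blast
  have b: "\<alpha> + \<delta> \<in> \<Phi>" "- \<delta> \<in> \<Phi>" using add_root assms d by auto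
  have i: "(\<alpha> + \<delta>) \<bullet> (- \<delta>) = -1" "(\<alpha> + \<delta>) \<bullet> \<alpha> = 1" "(- \<delta>) \<bullet> \<alpha> = 1"
    using assms d by (auto simp: inner_add_left norm_root inner_commute[of \<delta> \<alpha>])
  obtain n b where nb: "weyl_pair (\<alpha> + \<delta>) n b" using weyl_pair_exists b by blast
  have "reflection (\<alpha> + \<delta>) (- \<delta>) = \<alpha>" using b i by (simp add: reflection_eq inner_commute)
  then obtain z where z: "z \<in> U (- \<delta>)" "x = n \<otimes> z \<otimes> inv n"
    using weyl_element_conj_surj[of "\<alpha> + \<delta>" n "- \<delta>" x] nb b assms by (auto simp: weyl_pair_def)
  then have x: "x = comm b z" using nb b i unfolding weyl_pair_def by blast
  have bU: "b \<in> U (\<alpha> + \<delta>)" using nb by (simp add: weyl_pair_def)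
  note cl = U_carrier[OF b(1) bU] U_carrier[OF b(2) z(1)] U_carrier[OF assms(1,3)]
  have "b \<otimes> y = y \<otimes> b" "z \<otimes> y = y \<otimes> z"
    using commute[OF b(1) assms(1) _ bU assms(3)] commute[OF b(2) assms(1) _ z(1) assms(3)] i by auto
  then have yb: "y \<otimes> b \<otimes> inv y = b" "y \<otimes> z \<otimes> inv y = z"
    using cl by (metis inv_solve_right m_closed)+
  have "y \<otimes> x \<otimes> inv y = x" using conj_comm[of y b z] cl yb x by simp
  then have "y \<otimes> x \<otimes> inv y \<otimes> y = x \<otimes> y" by simp
  then show ?thesis using cl assms by (simp add: m_assoc)
qed

text \<open>The only obstruction to additivity is moving \<open>comm x' y\<close> past x, which is
  allowed since \<alpha> and \<alpha> + \<beta> have inner product 1.\<close>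

lemma comm_bilinear:
  assumes "\<alpha> \<in> \<Phi>" "\<beta> \<in> \<Phi>" "\<alpha> \<bullet> \<beta> = -1" "x \<in> U \<alpha>" "x' \<in> U \<alpha>" "y \<in> U \<beta>"
  shows "comm (x \<otimes> x') y = comm x y \<otimes> comm x' y"
proof -
  note r = add_root[OF assms(1-3)]
  have i: "\<alpha> \<bullet> (\<alpha> + \<beta>) = 1" using assms by (simp add: inner_add_right norm_root)
  note c = comm_closed[OF assms(1-4,6)] comm_closed[OF assms(1-3,5,6)]
  note cl = U_carrier[OF assms(1,4)] U_carrier[OF assms(1,5)] U_carrier[OF assms(2,6)] U_carrier[OF r c(1)] U_carrier[OF r c(2)]
  have "x \<otimes> x' \<otimes> y = x \<otimes> (comm x' y \<otimes> (y \<otimes> x'))" using comm_mult[of x' y] cl by (simp add: m_assoc)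
  also have "\<dots> = (x \<otimes> comm x' y) \<otimes> y \<otimes> x'" using cl by (simp add: m_assoc)
  also have "x \<otimes> comm x' y = comm x' y \<otimes> x" using commute[OF assms(1) r _ assms(4) c(2)] i by simp
  also have "comm x' y \<otimes> x \<otimes> y \<otimes> x' = comm x' y \<otimes> (x \<otimes> y) \<otimes> x'" using cl by (simp add: m_assoc)
  also have "\<dots> = comm x' y \<otimes> comm x y \<otimes> (y \<otimes> (x \<otimes> x'))" using comm_mult[of x y] cl by (simp add: m_assoc)
  also have "comm x' y \<otimes> comm x y = comm x y \<otimes> comm x' y" using U_abelian[OF r c] by simp
  finally show ?thesis by (intro comm_unique) (use cl in auto)
qed

lemma comm_swap: "x \<in> carrier G \<Longrightarrow> y \<in> carrier G \<Longrightarrow> comm y x = inv (comm x y)"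
  by (simp add: group_commutator_def inv_mult_group m_assoc)

lemma comm_inv_left:
  assumes "\<alpha> \<in> \<Phi>" "\<beta> \<in> \<Phi>" "\<alpha> \<bullet> \<beta> = -1" "x \<in> U \<alpha>" "y \<in> U \<beta>"
  shows "comm (inv x) y = inv (comm x y)"
proof -
  have cl: "x \<in> carrier G" "y \<in> carrier G" "inv x \<in> U \<alpha>" using assms U_carrier U_closed by auto
  have "comm (inv x) y \<otimes> comm x y = comm (inv x \<otimes> x) y"
    using comm_bilinear[OF assms(1-3) cl(3) assms(4,5)] by simp
  also have "\<dots> = \<one>" using cl by (simp, intro comm_unique) auto
  finally show ?thesis using cl by (intro inv_equality[symmetric]) auto
qed

lemma comm_inv_right:
  assumes "\<alpha> \<in> \<Phi>" "\<beta> \<in> \<Phi>" "\<alpha> \<bullet> \<beta> = -1" "x \<in> U \<alpha>" "y \<in> U \<beta>"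
  shows "comm x (inv y) = inv (comm x y)"
proof -
  have cl: "x \<in> carrier G" "y \<in> carrier G" using assms U_carrier by auto
  have "comm (inv y) x = inv (comm y x)" by (rule comm_inv_left) (use assms in \<open>auto simp: inner_commute\<close>)
  then show ?thesis using comm_swap[of "inv y" x] comm_swap[of y x] cl by simp
qed

text \<open>The word xyz is reordered in two ways, once starting with xy and once with yz. The other
  factors commute: x with z, \<open>comm x y\<close> with \<open>comm y z\<close>, and the triple
  commutator with \<open>comm y z\<close>, since the inner products are 0, 0 and 1.\<close>

lemma comm_assoc:
  assumes "\<alpha> \<in> \<Phi>" "\<beta> \<in> \<Phi>" "\<gamma> \<in> \<Phi>" "\<alpha> \<bullet> \<beta> = -1" "\<beta> \<bullet> \<gamma> = -1" "\<alpha> \<bullet> \<gamma> = 0"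
    and xyz: "x \<in> U \<alpha>" "y \<in> U \<beta>" "z \<in> U \<gamma>"
  shows "comm (comm x y) z = comm x (comm y z)"
proof -
  note r = add_root[OF assms(1,2,4)] add_root[OF assms(2,3,5)]
  define c d where "c = comm x y" and "d = comm y z"
  have c: "c \<in> U (\<alpha> + \<beta>)" and d: "d \<in> U (\<beta> + \<gamma>)"
    unfolding c_def d_def using comm_closed[OF assms(1,2,4) xyz(1,2)] comm_closed[OF assms(2,3,5) xyz(2,3)] by auto
  have i: "(\<alpha> + \<beta>) \<bullet> \<gamma> = -1" "\<alpha> \<bullet> (\<beta> + \<gamma>) = -1" "(\<alpha> + \<beta>) \<bullet> (\<beta> + \<gamma>) = 0" "(\<alpha> + \<beta> + \<gamma>) \<bullet> (\<beta> + \<gamma>) = 1"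
    using assms(1-6) by (auto simp: inner_add_left inner_add_right norm_root
      inner_commute[of \<beta> \<alpha>] inner_commute[of \<gamma> \<alpha>] inner_commute[of \<gamma> \<beta>])
  note r3 = add_root[OF r(1) assms(3) i(1)]
  have e: "comm c z \<in> U (\<alpha> + \<beta> + \<gamma>)" using comm_closed[OF r(1) assms(3) i(1) c xyz(3)] .
  have "comm x d \<in> U (\<alpha> + (\<beta> + \<gamma>))" using comm_closed[OF assms(1) r(2) i(2) xyz(1) d] .
  note cl = U_carrier[OF assms(1) xyz(1)] U_carrier[OF assms(2) xyz(2)] U_carrier[OF assms(3) xyz(3)]
    U_carrier[OF r(1) c] U_carrier[OF r(2) d]
  have xz: "x \<otimes> z = z \<otimes> x" using commute[OF assms(1,3) _ xyz(1,3)] assms(6) by simp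
  have xy: "x \<otimes> y = c \<otimes> (y \<otimes> x)" unfolding c_def by (rule comm_mult) (use cl in auto)
  have yz: "y \<otimes> z = d \<otimes> (z \<otimes> y)" unfolding d_def by (rule comm_mult) (use cl in auto)
  have "c \<otimes> d \<otimes> z \<otimes> (y \<otimes> x) = c \<otimes> (d \<otimes> (z \<otimes> y)) \<otimes> x" using cl by (simp add: m_assoc)
  also have "\<dots> = c \<otimes> (y \<otimes> z) \<otimes> x" by (simp only: yz)
  also have "\<dots> = c \<otimes> y \<otimes> (z \<otimes> x)" using cl by (simp add: m_assoc)
  also have "\<dots> = c \<otimes> y \<otimes> (x \<otimes> z)" by (simp only: xz)
  also have "\<dots> = c \<otimes> (y \<otimes> x) \<otimes> z" using cl by (simp add: m_assoc)
  also have "\<dots> = x \<otimes> (y \<otimes> z)" using cl by (simp add: m_assoc flip: xy)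
  also have "\<dots> = x \<otimes> d \<otimes> (z \<otimes> y)" unfolding yz using cl by (simp add: m_assoc)
  also have "x \<otimes> d = comm x d \<otimes> (d \<otimes> x)" using comm_mult cl by blast
  also have "comm x d \<otimes> (d \<otimes> x) \<otimes> (z \<otimes> y) = comm x d \<otimes> d \<otimes> (x \<otimes> z) \<otimes> y" using cl by (simp add: m_assoc)
  also have "\<dots> = comm x d \<otimes> d \<otimes> z \<otimes> (x \<otimes> y)" unfolding xz using cl by (simp add: m_assoc)
  also have "\<dots> = comm x d \<otimes> d \<otimes> z \<otimes> c \<otimes> (y \<otimes> x)" unfolding xy using cl by (simp add: m_assoc)
  \<comment> \<open>Both reorderings of xyz end in \<open>y \<otimes> x\<close>, which is cancelled.
    Commuting c past d and z on the left brings out \<open>comm c z\<close> in the place of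
    \<open>comm x d\<close>.\<close>
  finally have 1: "c \<otimes> d \<otimes> z = comm x d \<otimes> d \<otimes> z \<otimes> c" using cl by simp
  have "c \<otimes> d \<otimes> z = d \<otimes> (c \<otimes> z)" using commute[OF r _ c d] i cl by (simp add: m_assoc)
  also have "\<dots> = d \<otimes> (comm c z \<otimes> (z \<otimes> c))" using comm_mult[of c z] cl by simp
  also have "\<dots> = (d \<otimes> comm c z) \<otimes> (z \<otimes> c)" using cl by (simp add: m_assoc)
  also have "d \<otimes> comm c z = comm c z \<otimes> d" using commute[OF r3 r(2) _ e d] i by simp
  finally have "comm c z \<otimes> d \<otimes> (z \<otimes> c) = comm x d \<otimes> d \<otimes> (z \<otimes> c)" using 1 cl by (simp add: m_assoc)
  then have "comm c z = comm x d" using cl by (metis m_closed comm_carrier right_cancel)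
  then show ?thesis by (simp add: c_def d_def)
qed

end

subsection \<open>Coordinatization\<close>

lemma finite_maximal_value:
  fixes f :: "'a \<Rightarrow> real"
  assumes "finite S" "S \<noteq> {}" shows "\<exists>x\<in>S. \<forall>y\<in>S. f y \<le> f x"
proof -
  have "Max (f ` S) \<in> f ` S" using assms by simp
  then obtain x where "x \<in> S" "f x = Max (f ` S)" by auto
  then show ?thesis using assms(1) by (intro bexI[of _ x]) auto
qed

text \<open>
  The commutator maps, with the signs of the structure constants removed, form a commutative and
  associative partial multiplication on the root subgroups.  The elements of \<open>W \<alpha>\<close> are invertible.
\<close>

locale graded_product = simply_laced \<Phi> + group G
  for \<Phi> :: "'v::euclidean_space set" and G :: "('g, 'c) monoid_scheme" (structure) +
  fixes U :: "'v \<Rightarrow> 'g set" and mul :: "'v \<Rightarrow> 'v \<Rightarrow> 'g \<Rightarrow> 'g \<Rightarrow> 'g" and W :: "'v \<Rightarrow> 'g set"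
  assumes U_sub: "\<alpha> \<in> \<Phi> \<Longrightarrow> subgroup (U \<alpha>) G"
    and U_comm: "\<alpha> \<in> \<Phi> \<Longrightarrow> x \<in> U \<alpha> \<Longrightarrow> y \<in> U \<alpha> \<Longrightarrow> x \<otimes> y = y \<otimes> x"
    and mul_closed: "\<alpha> \<in> \<Phi> \<Longrightarrow> \<beta> \<in> \<Phi> \<Longrightarrow> \<alpha> \<bullet> \<beta> = -1 \<Longrightarrow> x \<in> U \<alpha> \<Longrightarrow> y \<in> U \<beta> \<Longrightarrow> mul \<alpha> \<beta> x y \<in> U (\<alpha> + \<beta>)"
    and mul_sym: "\<alpha> \<in> \<Phi> \<Longrightarrow> \<beta> \<in> \<Phi> \<Longrightarrow> \<alpha> \<bullet> \<beta> = -1 \<Longrightarrow> x \<in> U \<alpha> \<Longrightarrow> y \<in> U \<beta> \<Longrightarrow> mul \<beta> \<alpha> y x = mul \<alpha> \<beta> x y"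
    and mul_left: "\<alpha> \<in> \<Phi> \<Longrightarrow> \<beta> \<in> \<Phi> \<Longrightarrow> \<alpha> \<bullet> \<beta> = -1 \<Longrightarrow> x \<in> U \<alpha> \<Longrightarrow> x' \<in> U \<alpha> \<Longrightarrow> y \<in> U \<beta> \<Longrightarrow>
       mul \<alpha> \<beta> (x \<otimes> x') y = mul \<alpha> \<beta> x y \<otimes> mul \<alpha> \<beta> x' y"
    and mul_assoc: "\<alpha> \<in> \<Phi> \<Longrightarrow> \<beta> \<in> \<Phi> \<Longrightarrow> \<gamma> \<in> \<Phi> \<Longrightarrow> \<alpha> \<bullet> \<beta> = -1 \<Longrightarrow> \<beta> \<bullet> \<gamma> = -1 \<Longrightarrow> \<alpha> \<bullet> \<gamma> = 0 \<Longrightarrow>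
       x \<in> U \<alpha> \<Longrightarrow> y \<in> U \<beta> \<Longrightarrow> z \<in> U \<gamma> \<Longrightarrow>
       mul (\<alpha> + \<beta>) \<gamma> (mul \<alpha> \<beta> x y) z = mul \<alpha> (\<beta> + \<gamma>) x (mul \<beta> \<gamma> y z)"
    and W_U: "\<alpha> \<in> \<Phi> \<Longrightarrow> u \<in> W \<alpha> \<Longrightarrow> u \<in> U \<alpha>"
    and W_nonempty: "\<alpha> \<in> \<Phi> \<Longrightarrow> \<exists>u. u \<in> W \<alpha>"
    and W_mul: "\<alpha> \<in> \<Phi> \<Longrightarrow> \<beta> \<in> \<Phi> \<Longrightarrow> \<alpha> \<bullet> \<beta> = -1 \<Longrightarrow> u \<in> W \<alpha> \<Longrightarrow> v \<in> W \<beta> \<Longrightarrow> mul \<alpha> \<beta> u v \<in> W (\<alpha> + \<beta>)"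
    and W_bij: "\<alpha> \<in> \<Phi> \<Longrightarrow> \<beta> \<in> \<Phi> \<Longrightarrow> \<alpha> \<bullet> \<beta> = -1 \<Longrightarrow> u \<in> W \<alpha> \<Longrightarrow> bij_betw (mul \<alpha> \<beta> u) (U \<beta>) (U (\<alpha> + \<beta>))"
begin

lemma mul_right:
  assumes "\<alpha> \<in> \<Phi>" "\<beta> \<in> \<Phi>" "\<alpha> \<bullet> \<beta> = -1" "x \<in> U \<alpha>" "y \<in> U \<beta>" "y' \<in> U \<beta>"
  shows "mul \<alpha> \<beta> x (y \<otimes> y') = mul \<alpha> \<beta> x y \<otimes> mul \<alpha> \<beta> x y'"
proof -
  have i: "\<beta> \<bullet> \<alpha> = -1" using assms(3) by (simp add: inner_commute)
  have "y \<otimes> y' \<in> U \<beta>" using subgroup.m_closed[OF U_sub[OF assms(2)] assms(5,6)] .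
  from mul_sym[OF assms(1-4) this, symmetric] have "mul \<alpha> \<beta> x (y \<otimes> y') = mul \<beta> \<alpha> (y \<otimes> y') x" .
  also have "\<dots> = mul \<beta> \<alpha> y x \<otimes> mul \<beta> \<alpha> y' x" by (rule mul_left[OF assms(2,1) i assms(5,6,4)])
  finally show ?thesis using mul_sym[OF assms(1-4)] assms(5,6) by simp
qed

text \<open>Finitely many hyperplanes form a negligible set and cannot cover a ball, so a vector
  near \<theta> is non-zero on every root.\<close>

lemma generic_functional:
  obtains w where "\<And>\<gamma>. \<gamma> \<in> \<Phi> \<Longrightarrow> w \<bullet> \<gamma> \<noteq> 0" "\<And>\<gamma>. \<gamma> \<in> \<Phi> \<Longrightarrow> \<bar>w \<bullet> \<gamma> - \<theta> \<bullet> \<gamma>\<bar> < 1/2"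
proof -
  have "negligible (\<Union>\<gamma>\<in>\<Phi>. {x. \<gamma> \<bullet> x = 0})"
    using finite_roots by (intro negligible_Union) (auto intro!: negligible_hyperplane)
  \<comment> \<open>The radius 1/4 is half the tolerance 1/2, because roots have norm at most
    2.\<close>
  then have "\<not> ball \<theta> (1/4) \<subseteq> (\<Union>\<gamma>\<in>\<Phi>. {x. \<gamma> \<bullet> x = 0})"
    using open_not_negligible[of "ball \<theta> (1/4)"] negligible_subset by auto
  then obtain w where w: "w \<in> ball \<theta> (1/4)" "\<And>\<gamma>. \<gamma> \<in> \<Phi> \<Longrightarrow> \<gamma> \<bullet> w \<noteq> 0" by blast
  have "\<bar>w \<bullet> \<gamma> - \<theta> \<bullet> \<gamma>\<bar> < 1/2" if g: "\<gamma> \<in> \<Phi>" for \<gamma>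
  proof -
    have "norm \<gamma> = sqrt 2" using norm_root[OF g] by (simp add: norm_eq_sqrt_inner)
    also have "sqrt 2 \<le> 2" by (rule real_le_lsqrt) auto
    finally have n: "norm \<gamma> \<le> 2" .
    have "\<bar>(w - \<theta>) \<bullet> \<gamma>\<bar> \<le> norm (w - \<theta>) * norm \<gamma>" by (rule Cauchy_Schwarz_ineq2)
    also have "\<dots> \<le> norm (w - \<theta>) * 2" using n by (intro mult_left_mono) auto
    also have "\<dots> < 1/2" using w(1) by (simp add: dist_norm norm_minus_commute)
    finally show ?thesis by (simp add: inner_diff_left)
  qed
  moreover have "w \<bullet> \<gamma> \<noteq> 0" if "\<gamma> \<in> \<Phi>" for \<gamma> using w(2)[OF that] by (simp add: inner_commute)
  ultimately show thesis using that by blast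
qed

end

section \<open>A multiplicative choice of invertible elements on the positive roots\<close>

locale graded_product_functional = graded_product +
  fixes \<theta> w
  assumes \<theta>: "\<theta> \<in> \<Phi>"
    and w_nonzero: "\<gamma> \<in> \<Phi> \<Longrightarrow> w \<bullet> \<gamma> \<noteq> 0"
    and w_near: "\<gamma> \<in> \<Phi> \<Longrightarrow> \<bar>w \<bullet> \<gamma> - \<theta> \<bullet> \<gamma>\<bar> < 1/2"
begin

definition pos where "pos = {\<gamma> \<in> \<Phi>. w \<bullet> \<gamma> > 0}"

lemma pos_iff: "\<gamma> \<in> pos \<longleftrightarrow> \<gamma> \<in> \<Phi> \<and> w \<bullet> \<gamma> > 0"
  by (simp add: pos_def)

text \<open>All decompositions of \<gamma> into positive roots must give the same product. They are
  compared with one fixed decomposition \<gamma> = \<sigma> + \<tau>. If \<gamma> has no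
  decomposition, any element of \<open>W \<gamma>\<close> will do.\<close>

lemma unit_system_step:
  assumes S: "\<gamma> \<in> pos" "\<And>\<delta>. \<delta> \<in> pos \<Longrightarrow> w \<bullet> \<delta> < w \<bullet> \<gamma> \<Longrightarrow> \<delta> \<in> S"
    and uW: "\<And>\<delta>. \<delta> \<in> S \<Longrightarrow> u \<delta> \<in> W \<delta>"
    and umul: "\<And>\<alpha> \<beta>. \<alpha> \<in> pos \<Longrightarrow> \<beta> \<in> pos \<Longrightarrow> \<alpha> \<bullet> \<beta> = -1 \<Longrightarrow> \<alpha> + \<beta> \<in> S \<Longrightarrow> mul \<alpha> \<beta> (u \<alpha>) (u \<beta>) = u (\<alpha> + \<beta>)"
  shows "\<exists>v\<in>W \<gamma>. \<forall>\<alpha>\<in>pos. \<forall>\<beta>\<in>pos. \<alpha> \<bullet> \<beta> = -1 \<and> \<alpha> + \<beta> = \<gamma> \<longrightarrow> mul \<alpha> \<beta> (u \<alpha>) (u \<beta>) = v"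
proof (cases "\<exists>\<alpha>\<in>pos. \<gamma> \<bullet> \<alpha> = 1 \<and> w \<bullet> \<alpha> < w \<bullet> \<gamma>")
  case False
  have "w \<bullet> \<alpha> < w \<bullet> (\<alpha> + \<beta>)" "(\<alpha> + \<beta>) \<bullet> \<alpha> = 1" if "\<alpha> \<in> pos" "\<beta> \<in> pos" "\<alpha> \<bullet> \<beta> = -1" for \<alpha> \<beta>
    using that by (auto simp: pos_iff inner_add_right inner_add_left norm_root inner_commute[of \<beta> \<alpha>])
  then have "\<not> (\<alpha> \<bullet> \<beta> = -1 \<and> \<alpha> + \<beta> = \<gamma>)" if "\<alpha> \<in> pos" "\<beta> \<in> pos" for \<alpha> \<beta> using that False by blast
  moreover obtain v where "v \<in> W \<gamma>" using W_nonempty S(1) by (auto simp: pos_iff)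
  ultimately show ?thesis by blast
next
  case True
  define D where "D = {\<alpha> \<in> pos. \<gamma> \<bullet> \<alpha> = 1}"
  have "finite D" using finite_roots by (simp add: D_def pos_def)
  moreover have "D \<noteq> {}" using True by (auto simp: D_def)
  \<comment> \<open>\<sigma> is the lowest positive root with \<gamma> \<bullet> \<sigma> = 1, so
    that subtracting it from any other summand of \<gamma> that has inner product 1 with it stays
    positive.\<close>
  ultimately obtain \<sigma> where s: "\<sigma> \<in> D" "\<forall>\<alpha>\<in>D. - (w \<bullet> \<alpha>) \<le> - (w \<bullet> \<sigma>)"
    using finite_maximal_value[of D "\<lambda>\<alpha>. - (w \<bullet> \<alpha>)"] by blast
  have g: "\<gamma> \<in> \<Phi>" "w \<bullet> \<gamma> > 0" using S(1) by (auto simp: pos_iff)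
  have sp: "\<sigma> \<in> \<Phi>" "w \<bullet> \<sigma> > 0" "\<gamma> \<bullet> \<sigma> = 1" "w \<bullet> \<sigma> < w \<bullet> \<gamma>"
    using s True by (force simp: D_def pos_iff)+
  define \<tau> where "\<tau> = \<gamma> - \<sigma>"
  have t: "\<tau> \<in> \<Phi>" "w \<bullet> \<tau> > 0" "\<sigma> + \<tau> = \<gamma>" "\<sigma> \<bullet> \<tau> = -1"
    using diff_root[OF g(1) sp(1,3)] sp by (auto simp: \<tau>_def inner_diff_right norm_root inner_commute[of \<sigma> \<gamma>])
  have inS: "\<delta> \<in> S" if "\<delta> \<in> \<Phi>" "w \<bullet> \<delta> > 0" "w \<bullet> \<delta> < w \<bullet> \<gamma>" for \<delta>
    using that S(2) by (simp add: pos_iff)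
  have sS: "\<sigma> \<in> S" "\<tau> \<in> S" using inS sp t by (auto simp: \<tau>_def inner_diff_right)
  show ?thesis
  proof (intro bexI ballI impI)
    have "mul \<sigma> \<tau> (u \<sigma>) (u \<tau>) \<in> W (\<sigma> + \<tau>)"
      using W_mul[OF sp(1) t(1,4) uW[OF sS(1)] uW[OF sS(2)]] .
    then show "mul \<sigma> \<tau> (u \<sigma>) (u \<tau>) \<in> W \<gamma>" by (simp only: t)
  next
    have half: "mul \<alpha> \<beta> (u \<alpha>) (u \<beta>) = mul \<sigma> \<tau> (u \<sigma>) (u \<tau>)"
      if ab: "\<alpha> \<in> pos" "\<beta> \<in> pos" "\<alpha> \<bullet> \<beta> = -1" "\<alpha> + \<beta> = \<gamma>" "\<alpha> \<bullet> \<sigma> = 2 \<or> \<alpha> \<bullet> \<sigma> = 1 \<and> \<beta> \<bullet> \<sigma> = 0" for \<alpha> \<beta>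
    proof (cases "\<alpha> \<bullet> \<sigma> = 2")
      case True
      then have "\<alpha> = \<sigma>" using ip_2_iff ab sp by (auto simp: pos_iff)
      then show ?thesis using ab by (auto simp: \<tau>_def)
    next
      case False
      then have i: "\<alpha> \<bullet> \<sigma> = 1" "\<beta> \<bullet> \<sigma> = 0" using ab by auto
      have a: "\<alpha> \<in> \<Phi>" "\<beta> \<in> \<Phi>" "w \<bullet> \<alpha> > 0" "w \<bullet> \<beta> > 0" using ab by (auto simp: pos_iff)
      have wab: "w \<bullet> \<gamma> = w \<bullet> \<alpha> + w \<bullet> \<beta>" using ab(4) by (auto simp: inner_add_right)
      have ga: "\<gamma> \<bullet> \<alpha> = 1" using ab a by (auto simp: inner_add_left norm_root inner_commute[of \<beta> \<alpha>])
      \<comment> \<open>Associativity for \<sigma>, \<open>\<alpha>'\<close>, \<beta> compares the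
        bracketings (\<sigma> + \<open>\<alpha>'\<close>) + \<beta> = \<alpha> + \<beta> and
        \<sigma> + (\<open>\<alpha>'\<close> + \<beta>) = \<sigma> + \<tau>. The inner products are
        known earlier and below \<gamma>.\<close>
      define \<alpha>' where "\<alpha>' = \<alpha> - \<sigma>"
      have a': "\<alpha>' \<in> \<Phi>" using diff_root[OF a(1) sp(1) i(1)] by (simp add: \<alpha>'_def)
      have "\<alpha> \<in> D" using ab ga by (simp add: D_def)
      then have "w \<bullet> \<sigma> \<le> w \<bullet> \<alpha>" using s by force
      then have w': "w \<bullet> \<alpha>' > 0" using w_nonzero[OF a'] by (simp add: \<alpha>'_def inner_diff_right)
      have i': "\<sigma> \<bullet> \<alpha>' = -1" "\<alpha>' \<bullet> \<beta> = -1" "\<sigma> \<bullet> \<beta> = 0"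
        using i ab a sp by (auto simp: \<alpha>'_def inner_diff_left inner_diff_right norm_root inner_commute[of \<sigma> \<alpha>] inner_commute[of \<sigma> \<beta>])
      have eqs: "\<sigma> + \<alpha>' = \<alpha>" "\<alpha>' + \<beta> = \<tau>" using ab by (auto simp: \<alpha>'_def \<tau>_def algebra_simps)
      have "w \<bullet> \<alpha>' < w \<bullet> \<gamma>" using wab a sp by (simp add: \<alpha>'_def inner_diff_right)
      then have S': "\<alpha>' \<in> S" "\<alpha> \<in> S" "\<beta> \<in> S" using inS a a' w' wab by auto
      have P: "\<sigma> \<in> pos" "\<alpha>' \<in> pos" "\<beta> \<in> pos" using sp a a' w' by (auto simp: pos_iff)
      have m1: "mul \<sigma> \<alpha>' (u \<sigma>) (u \<alpha>') = u \<alpha>"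
        using umul[OF P(1,2) i'(1)] S' eqs by simp
      have m2: "mul \<alpha>' \<beta> (u \<alpha>') (u \<beta>) = u \<tau>"
        using umul[OF P(2,3) i'(2)] sS eqs by simp
      have "mul (\<sigma> + \<alpha>') \<beta> (mul \<sigma> \<alpha>' (u \<sigma>) (u \<alpha>')) (u \<beta>) = mul \<sigma> (\<alpha>' + \<beta>) (u \<sigma>) (mul \<alpha>' \<beta> (u \<alpha>') (u \<beta>))"
        by (rule mul_assoc[OF sp(1) a' a(2) i' W_U[OF sp(1) uW[OF sS(1)]] W_U[OF a' uW[OF S'(1)]] W_U[OF a(2) uW[OF S'(3)]]])
      then show ?thesis unfolding m1 m2 eqs .
    qed
    fix \<alpha> \<beta> assume ab: "\<alpha> \<in> pos" "\<beta> \<in> pos" "\<alpha> \<bullet> \<beta> = -1 \<and> \<alpha> + \<beta> = \<gamma>"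
    have a: "\<alpha> \<in> \<Phi>" "\<beta> \<in> \<Phi>" "\<alpha> \<bullet> \<beta> = -1" "\<beta> \<bullet> \<alpha> = -1" "w \<bullet> \<alpha> > 0" "w \<bullet> \<beta> > 0"
      using ab by (auto simp: pos_iff inner_commute)
    have sum: "\<alpha> \<bullet> \<sigma> + \<beta> \<bullet> \<sigma> = 1" using sp(3) ab by (auto simp: inner_add_left)
    have "w \<bullet> \<gamma> = w \<bullet> \<alpha> + w \<bullet> \<beta>" using ab by (auto simp: inner_add_right)
    then have abS: "\<alpha> \<in> S" "\<beta> \<in> S" using inS a by auto
    \<comment> \<open>The two inner products with \<sigma> add up to \<gamma> \<bullet> \<sigma> =
      1, so one of the summands satisfies the hypothesis of \<open>half\<close>; symmetry of
      \<open>mul\<close> covers \<beta>.\<close>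
    have "\<alpha> \<bullet> \<sigma> = 2 \<or> \<alpha> \<bullet> \<sigma> = 1 \<and> \<beta> \<bullet> \<sigma> = 0 \<or> \<beta> \<bullet> \<sigma> = 2 \<or> \<beta> \<bullet> \<sigma> = 1 \<and> \<alpha> \<bullet> \<sigma> = 0"
      using ip_cases[OF a(1) sp(1)] ip_cases[OF a(2) sp(1)] sum by auto
    then show "mul \<alpha> \<beta> (u \<alpha>) (u \<beta>) = mul \<sigma> \<tau> (u \<sigma>) (u \<tau>)"
    proof (elim disjE)
      assume h: "\<beta> \<bullet> \<sigma> = 2"
      have "mul \<beta> \<alpha> (u \<beta>) (u \<alpha>) = mul \<sigma> \<tau> (u \<sigma>) (u \<tau>)"
        by (rule half) (use ab a h in \<open>auto simp: add.commute\<close>)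
      then show ?thesis using mul_sym[OF a(1,2,3) W_U[OF a(1) uW[OF abS(1)]] W_U[OF a(2) uW[OF abS(2)]]] by simp
    next
      assume h: "\<beta> \<bullet> \<sigma> = 1 \<and> \<alpha> \<bullet> \<sigma> = 0"
      have "mul \<beta> \<alpha> (u \<beta>) (u \<alpha>) = mul \<sigma> \<tau> (u \<sigma>) (u \<tau>)"
        by (rule half) (use ab a h in \<open>auto simp: add.commute\<close>)
      then show ?thesis using mul_sym[OF a(1,2,3) W_U[OF a(1) uW[OF abS(1)]] W_U[OF a(2) uW[OF abS(2)]]] by simp
    qed (use half ab in auto)
  qed
qed

text \<open>Induction over lower sets of positive roots, adding a highest root each time. It cannot
  be a summand of a root in the set, so redefining \<open>u\<close> there leaves the earlier factors
  unchanged.\<close>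

lemma unit_system:
  "\<exists>u. (\<forall>\<gamma>\<in>pos. u \<gamma> \<in> W \<gamma>) \<and>
     (\<forall>\<alpha>\<in>pos. \<forall>\<beta>\<in>pos. \<alpha> \<bullet> \<beta> = -1 \<longrightarrow> mul \<alpha> \<beta> (u \<alpha>) (u \<beta>) = u (\<alpha> + \<beta>))"
proof -
  have fin: "finite pos" using finite_roots by (simp add: pos_def)
  have "\<exists>u. (\<forall>\<gamma>\<in>S. u \<gamma> \<in> W \<gamma>) \<and>
     (\<forall>\<alpha>\<in>pos. \<forall>\<beta>\<in>pos. \<alpha> \<bullet> \<beta> = -1 \<and> \<alpha> + \<beta> \<in> S \<longrightarrow> mul \<alpha> \<beta> (u \<alpha>) (u \<beta>) = u (\<alpha> + \<beta>))"
    if "S \<subseteq> pos" "\<forall>\<gamma>\<in>S. \<forall>\<delta>\<in>pos. w \<bullet> \<delta> < w \<bullet> \<gamma> \<longrightarrow> \<delta> \<in> S" for S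
    using finite_subset[OF that(1) fin] that
  proof (induction S rule: finite_psubset_induct)
    case (psubset S)
    show ?case
    proof (cases "S = {}")
      case True then show ?thesis by simp
    next
      case False
      then obtain \<gamma> where g: "\<gamma> \<in> S" "\<forall>\<delta>\<in>S. w \<bullet> \<delta> \<le> w \<bullet> \<gamma>"
        using finite_maximal_value[OF psubset.hyps(1), of "\<lambda>x. w \<bullet> x"] by blast
      define S' where "S' = S - {\<gamma>}"
      have S': "S' \<subset> S" "S' \<subseteq> pos" "\<forall>\<delta>\<in>S'. \<forall>\<epsilon>\<in>pos. w \<bullet> \<epsilon> < w \<bullet> \<delta> \<longrightarrow> \<epsilon> \<in> S'"
        using g psubset.prems by (force simp: S'_def)+
      from psubset.IH[OF this] obtain u where u: "\<forall>\<gamma>\<in>S'. u \<gamma> \<in> W \<gamma>"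
        "\<forall>\<alpha>\<in>pos. \<forall>\<beta>\<in>pos. \<alpha> \<bullet> \<beta> = -1 \<and> \<alpha> + \<beta> \<in> S' \<longrightarrow> mul \<alpha> \<beta> (u \<alpha>) (u \<beta>) = u (\<alpha> + \<beta>)"
        by blast
      have gp: "\<gamma> \<in> pos" using g psubset.prems by blast
      have low: "\<delta> \<in> S'" if "\<delta> \<in> pos" "w \<bullet> \<delta> < w \<bullet> \<gamma>" for \<delta>
        using that g psubset.prems by (auto simp: S'_def)
      obtain v where v: "v \<in> W \<gamma>"
        "\<forall>\<alpha>\<in>pos. \<forall>\<beta>\<in>pos. \<alpha> \<bullet> \<beta> = -1 \<and> \<alpha> + \<beta> = \<gamma> \<longrightarrow> mul \<alpha> \<beta> (u \<alpha>) (u \<beta>) = v"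
        using unit_system_step[of \<gamma> S' u] gp low u by (auto simp: S'_def)
      have ne: "\<alpha> \<noteq> \<gamma>" "\<beta> \<noteq> \<gamma>" if "\<alpha> \<in> pos" "\<beta> \<in> pos" "\<alpha> + \<beta> \<in> S" for \<alpha> \<beta>
        using g(2) that by (force simp: pos_iff inner_add_right)+
      show ?thesis
      proof (intro exI[of _ "u(\<gamma> := v)"] conjI ballI impI)
        show "(u(\<gamma> := v)) \<delta> \<in> W \<delta>" if "\<delta> \<in> S" for \<delta>
          using that u(1) v(1) by (auto simp: S'_def)
        fix \<alpha> \<beta> assume ab: "\<alpha> \<in> pos" "\<beta> \<in> pos" "\<alpha> \<bullet> \<beta> = -1 \<and> \<alpha> + \<beta> \<in> S"
        show "mul \<alpha> \<beta> ((u(\<gamma> := v)) \<alpha>) ((u(\<gamma> := v)) \<beta>) = (u(\<gamma> := v)) (\<alpha> + \<beta>)"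
          using ne[OF ab(1,2)] ab u(2) v(2) by (cases "\<alpha> + \<beta> = \<gamma>") (auto simp: S'_def)
      qed
    qed
  qed
  from this[of pos] show ?thesis by (fastforce simp: pos_iff inner_add_right add_root)
qed

text \<open>It is enough to raise the level \<theta> \<bullet> \<gamma> by 1. At level 1 take
  \<theta>, at level -1 take \<theta> + \<gamma>, and at level -2 any neighbour of \<theta>. At
  level 0 a root non-orthogonal to both \<theta> and \<gamma> is corrected by a sign or by
  subtraction from \<theta>.\<close>

lemma upper_neighbour:
  assumes g: "\<gamma> \<in> \<Phi>" "\<gamma> \<noteq> \<theta>"
  obtains \<delta> where "\<delta> \<in> \<Phi>" "\<delta> \<bullet> \<gamma> = 1" "w \<bullet> \<gamma> < w \<bullet> \<delta>"
proof -
  have near: "\<bar>w \<bullet> \<gamma> - \<theta> \<bullet> \<gamma>\<bar> < 1/2" using w_near g by blast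
  have "\<theta> \<bullet> \<gamma> \<noteq> 2" using ip_2_iff \<theta> g by auto
  then consider "\<theta> \<bullet> \<gamma> = 1" | "\<theta> \<bullet> \<gamma> = 0" | "\<theta> \<bullet> \<gamma> = -1" | "\<theta> \<bullet> \<gamma> = -2" using ip_cases[OF \<theta> g(1)] by blast
  then have "\<exists>\<delta>\<in>\<Phi>. \<delta> \<bullet> \<gamma> = 1 \<and> \<theta> \<bullet> \<delta> \<ge> \<theta> \<bullet> \<gamma> + 1"
  proof cases
    case 1 then show ?thesis using \<theta> norm_root by (intro bexI[of _ \<theta>]) auto
  next
    case 2
    obtain \<delta> where d: "\<delta> \<in> \<Phi>" "\<delta> \<bullet> \<theta> \<noteq> 0" "\<delta> \<bullet> \<gamma> \<noteq> 0" using common_nonorthogonal[OF \<theta> g(1)] by blast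
    have d2: "\<delta> \<bullet> \<theta> \<noteq> 2" "\<delta> \<bullet> \<theta> \<noteq> -2" "\<delta> \<bullet> \<gamma> \<noteq> 2" "\<delta> \<bullet> \<gamma> \<noteq> -2"
      using ip_2_iff[OF d(1)] ip_m2_iff[OF d(1)] \<theta> g 2 d by (auto simp: inner_commute[of \<gamma> \<theta>])
    define \<epsilon> where "\<epsilon> = (if \<delta> \<bullet> \<theta> = 1 then \<delta> else - \<delta>)"
    have e: "\<epsilon> \<in> \<Phi>" "\<epsilon> \<bullet> \<theta> = 1" "\<epsilon> \<bullet> \<gamma> = 1 \<or> \<epsilon> \<bullet> \<gamma> = -1"
      using d d2 ip_cases[OF d(1) \<theta>] ip_cases[OF d(1) g(1)] by (auto simp: \<epsilon>_def)
    show ?thesis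
    proof (cases "\<epsilon> \<bullet> \<gamma> = 1")
      case True then show ?thesis using e 2 by (intro bexI[of _ \<epsilon>]) (auto simp: inner_commute[of \<theta> \<epsilon>])
    next
      case False
      have "\<theta> - \<epsilon> \<in> \<Phi>" using diff_root[OF \<theta> e(1)] e(2) by (simp add: inner_commute)
      then show ?thesis using e False 2 norm_root[OF \<theta>]
        by (intro bexI[of _ "\<theta> - \<epsilon>"]) (auto simp: inner_diff_left inner_diff_right inner_commute[of \<theta> \<epsilon>])
    qed
  next
    case 3
    then have "\<theta> + \<gamma> \<in> \<Phi>" using add_root \<theta> g by blast
    then show ?thesis using 3 \<theta> g by (intro bexI[of _ "\<theta> + \<gamma>"]) (auto simp: inner_add_left inner_add_right norm_root)
  next
    case 4
    then have t: "\<theta> = - \<gamma>" using ip_m2_iff \<theta> g by blast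
    obtain \<delta> where "\<delta> \<in> \<Phi>" "\<theta> \<bullet> \<delta> = -1" using neighbour_exists \<theta> by blast
    then show ?thesis using 4 t by (intro bexI[of _ \<delta>]) (auto simp: inner_commute)
  qed
  then obtain \<delta> where d: "\<delta> \<in> \<Phi>" "\<delta> \<bullet> \<gamma> = 1" "\<theta> \<bullet> \<delta> \<ge> \<theta> \<bullet> \<gamma> + 1" by blast
  moreover have "w \<bullet> \<gamma> < w \<bullet> \<delta>" using near w_near[OF d(1)] d(3) by linarith
  ultimately show thesis using that by blast
qed

text \<open>For \<gamma> = \<delta> + \<delta>', whose summands both lie above it, the step to
  \<epsilon> forms a triangle with one of the two given steps and a square with the other. The
  negative values of w allow only the levels 0 and -1 for the summands, once -2 has been
  excluded.\<close>

lemma third_upper_neighbour: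
  assumes d: "\<delta> \<in> \<Phi>" "\<delta>' \<in> \<Phi>" "\<delta> \<bullet> \<delta>' = -1" and low: "w \<bullet> \<delta> < 0" "w \<bullet> \<delta>' < 0"
  obtains \<epsilon> where "\<epsilon> \<in> \<Phi>" "w \<bullet> (\<delta> + \<delta>') < w \<bullet> \<epsilon>"
    "\<epsilon> \<bullet> \<delta> = 1 \<and> \<epsilon> \<bullet> \<delta>' = 0 \<or> \<epsilon> \<bullet> \<delta> = 0 \<and> \<epsilon> \<bullet> \<delta>' = 1"
proof -
  note s = add_root[OF d]
  have dd: "\<delta>' \<bullet> \<delta> = -1" using d by (simp add: inner_commute)
  have near: "\<bar>w \<bullet> \<delta> - \<theta> \<bullet> \<delta>\<bar> < 1/2" "\<bar>w \<bullet> \<delta>' - \<theta> \<bullet> \<delta>'\<bar> < 1/2" "\<bar>w \<bullet> (\<delta> + \<delta>') - \<theta> \<bullet> (\<delta> + \<delta>')\<bar> < 1/2"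
    using w_near d s by blast+
  have up: "w \<bullet> (\<delta> + \<delta>') < w \<bullet> \<epsilon>" if "\<epsilon> \<in> \<Phi>" "\<theta> \<bullet> \<epsilon> \<ge> \<theta> \<bullet> (\<delta> + \<delta>') + 1" for \<epsilon>
    using w_near[OF that(1)] that(2) near(3) by linarith
  have lev: "\<theta> \<bullet> \<delta> = 0 \<or> \<theta> \<bullet> \<delta> = -1 \<or> \<theta> \<bullet> \<delta> = -2" "\<theta> \<bullet> \<delta>' = 0 \<or> \<theta> \<bullet> \<delta>' = -1 \<or> \<theta> \<bullet> \<delta>' = -2"
    using ip_cases[OF \<theta> d(1)] ip_cases[OF \<theta> d(2)] near low by auto
  have m2: False if "\<theta> \<bullet> \<eta> = -2" "\<eta> \<in> \<Phi>" "\<eta>' \<in> \<Phi>" "\<eta> \<bullet> \<eta>' = -1" "\<theta> \<bullet> \<eta>' = 0 \<or> \<theta> \<bullet> \<eta>' = -1 \<or> \<theta> \<bullet> \<eta>' = -2" for \<eta> \<eta>'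
    using ip_m2_iff[OF \<theta> that(2)] that by auto
  have lev': "\<theta> \<bullet> \<delta> = 0 \<or> \<theta> \<bullet> \<delta> = -1" "\<theta> \<bullet> \<delta>' = 0 \<or> \<theta> \<bullet> \<delta>' = -1"
    using lev m2[of \<delta> \<delta>'] m2[of \<delta>' \<delta>] d dd by auto
  have "\<exists>\<epsilon>\<in>\<Phi>. \<theta> \<bullet> \<epsilon> \<ge> \<theta> \<bullet> (\<delta> + \<delta>') + 1 \<and> (\<epsilon> \<bullet> \<delta> = 1 \<and> \<epsilon> \<bullet> \<delta>' = 0 \<or> \<epsilon> \<bullet> \<delta> = 0 \<and> \<epsilon> \<bullet> \<delta>' = 1)"
  proof (cases "\<theta> \<bullet> (\<delta> + \<delta>') = -1")
    case True
    then have r: "\<theta> + (\<delta> + \<delta>') \<in> \<Phi>" using add_root[OF \<theta> s] by blast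
    show ?thesis
      by (rule bexI[OF _ r])
         (use True lev' d dd in \<open>auto simp: inner_add_left inner_add_right norm_root \<theta>\<close>)
  next
    case False
    then consider "\<theta> \<bullet> \<delta> = -1" "\<theta> \<bullet> \<delta>' = -1" | "\<theta> \<bullet> \<delta> = 0" "\<theta> \<bullet> \<delta>' = 0"
      using lev' by (auto simp: inner_add_right)
    then show ?thesis
    proof cases
      case 1
      then have t: "\<theta> = - (\<delta> + \<delta>')" using ip_m2_iff[OF \<theta> s] by (simp add: inner_add_right)
      obtain \<epsilon> where e: "\<epsilon> \<in> \<Phi>" "\<epsilon> \<bullet> \<delta>' = 0" "\<epsilon> \<bullet> \<delta> = -1" using A3_extension[OF d(2,1) dd] by blast
      \<comment> \<open>In this case \<delta> + \<delta>' = -\<theta> has the lowest level -2, and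
        level -1 is high enough.\<close>
      have "\<theta> \<bullet> (- \<epsilon>) = -1" unfolding t using e
        by (simp add: inner_add_left inner_diff_left inner_diff_right inner_commute[of _ \<epsilon>])
      then show ?thesis using 1 e by (intro bexI[of _ "- \<epsilon>"]) (auto simp: inner_add_right)
    next
      case 2
      obtain \<epsilon>0 where e0: "\<epsilon>0 \<in> \<Phi>" "\<epsilon>0 \<bullet> \<theta> \<noteq> 0" "\<epsilon>0 \<bullet> \<delta> \<noteq> 0" using common_nonorthogonal[OF \<theta> d(1)] by blast
      have n2: "\<epsilon>0 \<bullet> \<theta> \<noteq> 2" "\<epsilon>0 \<bullet> \<theta> \<noteq> -2" "\<epsilon>0 \<bullet> \<delta> \<noteq> 2" "\<epsilon>0 \<bullet> \<delta> \<noteq> -2"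
        using ip_2_iff[OF e0(1)] ip_m2_iff[OF e0(1)] \<theta> d 2 e0 by (auto simp: inner_commute[of \<delta> \<theta>])
      define \<epsilon>1 where "\<epsilon>1 = (if \<epsilon>0 \<bullet> \<theta> = 1 then \<epsilon>0 else - \<epsilon>0)"
      have e1: "\<epsilon>1 \<in> \<Phi>" "\<epsilon>1 \<bullet> \<theta> = 1" "\<epsilon>1 \<bullet> \<delta> = 1 \<or> \<epsilon>1 \<bullet> \<delta> = -1"
        using e0 n2 ip_cases[OF e0(1) \<theta>] ip_cases[OF e0(1) d(1)] by (auto simp: \<epsilon>1_def)
      have t1: "\<theta> - \<epsilon>1 \<in> \<Phi>" using diff_root[OF \<theta> e1(1)] e1(2) by (simp add: inner_commute)
      define \<epsilon> where "\<epsilon> = (if \<epsilon>1 \<bullet> \<delta> = 1 then \<epsilon>1 else \<theta> - \<epsilon>1)"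
      have e: "\<epsilon> \<in> \<Phi>" "\<epsilon> \<bullet> \<theta> = 1" "\<epsilon> \<bullet> \<delta> = 1"
        using e1 t1 2 norm_root[OF \<theta>] by (auto simp: \<epsilon>_def inner_diff_left)
      have lev0: "\<theta> \<bullet> (\<delta> + \<delta>') = 0" using 2 by (simp add: inner_add_right)
      have c1: "\<epsilon> \<bullet> \<delta>' \<noteq> 1"
      proof
        assume "\<epsilon> \<bullet> \<delta>' = 1"
        then have "\<epsilon> = \<delta> + \<delta>'" using ip_2_iff[OF e(1) s] e by (simp add: inner_add_right)
        then show False using e(2) lev0 by (simp add: inner_commute)
      qed
      have c2: "\<epsilon> \<bullet> \<delta>' \<noteq> 2" "\<epsilon> \<bullet> \<delta>' \<noteq> -2"
        using ip_2_iff[OF e(1) d(2)] ip_m2_iff[OF e(1) d(2)] e 2 by (auto simp: inner_commute[of \<delta>' \<theta>])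
      then consider "\<epsilon> \<bullet> \<delta>' = 0" | "\<epsilon> \<bullet> \<delta>' = -1" using ip_cases[OF e(1) d(2)] c1 by blast
      then show ?thesis
      proof cases
        case 1 then show ?thesis using e lev0 by (intro bexI[of _ \<epsilon>]) (auto simp: inner_commute[of \<theta> \<epsilon>])
      next
        case c: 2
        \<comment> \<open>Adding \<open>\<delta>'\<close> keeps the level 1 and changes the inner
          products with \<delta> and \<open>\<delta>'\<close> from (1, -1) to (0, 1).\<close>
        have "\<epsilon> + \<delta>' \<in> \<Phi>" using add_root[OF e(1) d(2) c] .
        then show ?thesis using e lev0 c dd 2 norm_root[OF d(2)]
          by (intro bexI[of _ "\<epsilon> + \<delta>'"]) (auto simp: inner_add_left inner_add_right inner_commute[of \<theta> \<epsilon>])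
      qed
    qed
  qed
  then show thesis using that up by blast
qed

end

section \<open>Path-independent transport to the top root subgroup\<close>

locale graded_product_units = graded_product_functional +
  fixes u
  assumes u_W: "\<gamma> \<in> pos \<Longrightarrow> u \<gamma> \<in> W \<gamma>"
    and u_mul: "\<alpha> \<in> pos \<Longrightarrow> \<beta> \<in> pos \<Longrightarrow> \<alpha> \<bullet> \<beta> = -1 \<Longrightarrow> mul \<alpha> \<beta> (u \<alpha>) (u \<beta>) = u (\<alpha> + \<beta>)"
begin

definition up where "up \<gamma> \<delta> \<longleftrightarrow> \<gamma> \<in> \<Phi> \<and> \<delta> \<in> \<Phi> \<and> \<gamma> \<bullet> \<delta> = 1 \<and> w \<bullet> \<gamma> < w \<bullet> \<delta>"

definition shift where "shift \<gamma> \<delta> x = mul (\<delta> - \<gamma>) \<gamma> (u (\<delta> - \<gamma>)) x"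

lemma up_diff:
  assumes "up \<gamma> \<delta>"
  shows "\<delta> - \<gamma> \<in> pos" "\<delta> - \<gamma> \<in> \<Phi>" "(\<delta> - \<gamma>) \<bullet> \<gamma> = -1" "u (\<delta> - \<gamma>) \<in> W (\<delta> - \<gamma>)" "u (\<delta> - \<gamma>) \<in> U (\<delta> - \<gamma>)"
proof -
  show r: "\<delta> - \<gamma> \<in> \<Phi>" using assms diff_root[of \<delta> \<gamma>] by (simp add: up_def inner_commute)
  then show p: "\<delta> - \<gamma> \<in> pos" using assms by (simp add: up_def pos_iff inner_diff_right)
  show "(\<delta> - \<gamma>) \<bullet> \<gamma> = -1" using assms by (simp add: up_def inner_diff_left norm_root inner_commute[of \<delta> \<gamma>])
  show "u (\<delta> - \<gamma>) \<in> W (\<delta> - \<gamma>)" by (rule u_W[OF p])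
  then show "u (\<delta> - \<gamma>) \<in> U (\<delta> - \<gamma>)" by (rule W_U[OF r])
qed

lemma shift_bij: "up \<gamma> \<delta> \<Longrightarrow> bij_betw (shift \<gamma> \<delta>) (U \<gamma>) (U \<delta>)"
  using W_bij[OF up_diff(2) _ up_diff(3,4), of \<gamma> \<delta>] by (simp add: shift_def[abs_def] up_def)

lemma shift_closed: "up \<gamma> \<delta> \<Longrightarrow> x \<in> U \<gamma> \<Longrightarrow> shift \<gamma> \<delta> x \<in> U \<delta>"
  using shift_bij bij_betwE by blast

lemma shift_mult: "up \<gamma> \<delta> \<Longrightarrow> x \<in> U \<gamma> \<Longrightarrow> y \<in> U \<gamma> \<Longrightarrow> shift \<gamma> \<delta> (x \<otimes> y) = shift \<gamma> \<delta> x \<otimes> shift \<gamma> \<delta> y"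
  unfolding shift_def by (rule mul_right[OF up_diff(2) _ up_diff(3,5)]) (auto simp: up_def)

text \<open>By associativity the two steps multiply by the product of their invertible elements, and
  \<open>u_mul\<close> identifies this product with the element of the direct step.\<close>

lemma shift_triangle:
  assumes up: "up \<gamma> \<delta>" "up \<delta> \<epsilon>" "up \<gamma> \<epsilon>" and x: "x \<in> U \<gamma>"
  shows "shift \<delta> \<epsilon> (shift \<gamma> \<delta> x) = shift \<gamma> \<epsilon> x"
proof -
  have g: "\<gamma> \<in> \<Phi>" "\<delta> \<in> \<Phi>" "\<gamma> \<bullet> \<delta> = 1" "\<delta> \<bullet> \<epsilon> = 1" "\<gamma> \<bullet> \<epsilon> = 1" using up by (auto simp: up_def)
  have i: "(\<epsilon> - \<delta>) \<bullet> (\<delta> - \<gamma>) = -1" "(\<epsilon> - \<delta>) \<bullet> \<gamma> = 0"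
    using g by (auto simp: inner_diff_left inner_diff_right norm_root inner_commute[of \<epsilon> \<delta>] inner_commute[of \<epsilon> \<gamma>] inner_commute[of \<delta> \<gamma>])
  have e: "(\<epsilon> - \<delta>) + (\<delta> - \<gamma>) = \<epsilon> - \<gamma>" "(\<delta> - \<gamma>) + \<gamma> = \<delta>" by auto
  have "mul (\<epsilon> - \<gamma>) \<gamma> (mul (\<epsilon> - \<delta>) (\<delta> - \<gamma>) (u (\<epsilon> - \<delta>)) (u (\<delta> - \<gamma>))) x = shift \<delta> \<epsilon> (shift \<gamma> \<delta> x)"
    using mul_assoc[OF up_diff(2)[OF up(2)] up_diff(2)[OF up(1)] g(1) i(1) up_diff(3)[OF up(1)] i(2)
        up_diff(5)[OF up(2)] up_diff(5)[OF up(1)] x] by (simp add: shift_def)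
  then show ?thesis
    using u_mul[OF up_diff(1)[OF up(2)] up_diff(1)[OF up(1)] i(1)] by (simp add: shift_def)
qed

text \<open>With a = \<delta> - \<gamma> and b = \<delta>' - \<gamma> orthogonal, the claim is that
  multiplying by \<open>u a\<close> and by \<open>u b\<close> can be done in either order. This
  follows from symmetry and associativity, with x as middle factor.\<close>

lemma shift_square:
  assumes up: "up \<gamma> \<delta>" "up \<gamma> \<delta>'" and o: "\<delta> \<bullet> \<delta>' = 0" and x: "x \<in> U \<gamma>"
  defines "\<zeta> \<equiv> \<delta> + \<delta>' - \<gamma>"
  shows "up \<delta> \<zeta>" "up \<delta>' \<zeta>" "shift \<delta> \<zeta> (shift \<gamma> \<delta> x) = shift \<delta>' \<zeta> (shift \<gamma> \<delta>' x)"
proof -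
  have g: "\<gamma> \<in> \<Phi>" "\<delta> \<in> \<Phi>" "\<delta>' \<in> \<Phi>" "\<gamma> \<bullet> \<delta> = 1" "\<delta> \<bullet> \<gamma> = 1" "\<gamma> \<bullet> \<delta>' = 1" "\<delta>' \<bullet> \<gamma> = 1" "\<delta>' \<bullet> \<delta> = 0"
    using up o by (auto simp: up_def inner_commute)
  define a b where "a = \<delta> - \<gamma>" and "b = \<delta>' - \<gamma>"
  note ab = up_diff[OF up(1), folded a_def] up_diff[OF up(2), folded b_def]
  have i: "a \<bullet> b = 0" "b \<bullet> a = 0" "\<gamma> \<bullet> b = -1" "b \<bullet> \<delta> = -1" "a \<bullet> \<delta>' = -1" "\<delta> \<bullet> b = -1"
    using g o by (auto simp: a_def b_def inner_diff_left inner_diff_right norm_root)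
  have z: "\<delta> + b = \<zeta>" "\<delta>' + a = \<zeta>" "\<zeta> - \<delta> = b" "\<zeta> - \<delta>' = a" by (auto simp: a_def b_def \<zeta>_def)
  have zr: "\<zeta> \<in> \<Phi>" using add_root[OF g(2) ab(7) i(6)] z by simp
  have wz: "w \<bullet> \<zeta> = w \<bullet> \<delta> + w \<bullet> b" "w \<bullet> \<zeta> = w \<bullet> \<delta>' + w \<bullet> a" "w \<bullet> a > 0" "w \<bullet> b > 0"
    using ab(1,6) by (auto simp: pos_iff inner_add_right simp flip: z(1,2)) (auto simp: a_def b_def inner_diff_right)
  show "up \<delta> \<zeta>" "up \<delta>' \<zeta>"
    using zr g o wz by (auto simp: up_def \<zeta>_def inner_diff_right inner_add_right norm_root)
  have e: "a + \<gamma> = \<delta>" "b + \<gamma> = \<delta>'" by (auto simp: a_def b_def)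
  have s1: "shift \<gamma> \<delta> x = mul a \<gamma> (u a) x" "shift \<gamma> \<delta>' x = mul b \<gamma> (u b) x" by (auto simp: shift_def a_def b_def)
  have c1: "mul a \<gamma> (u a) x \<in> U \<delta>" using shift_closed[OF up(1) x] s1 by simp
  have "shift \<delta> \<zeta> (shift \<gamma> \<delta> x) = mul b \<delta> (u b) (mul a \<gamma> (u a) x)" unfolding s1 by (simp add: shift_def z)
  also have "\<dots> = mul \<delta> b (mul a \<gamma> (u a) x) (u b)" by (rule mul_sym[OF g(2) ab(7) i(6) c1 ab(10)])
  also have "\<dots> = mul a (\<gamma> + b) (u a) (mul \<gamma> b x (u b))"
    using mul_assoc[OF ab(2) g(1) ab(7) ab(3) i(3) i(1) ab(5) x ab(10)] e by simp
  also have "\<dots> = mul a \<delta>' (u a) (mul b \<gamma> (u b) x)"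
    using mul_sym[OF g(1) ab(7) i(3) x ab(10)] e by (simp add: add.commute)
  also have "\<dots> = shift \<delta>' \<zeta> (shift \<gamma> \<delta>' x)" unfolding s1 by (simp add: shift_def z)
  finally show "shift \<delta> \<zeta> (shift \<gamma> \<delta> x) = shift \<delta>' \<zeta> (shift \<gamma> \<delta>' x)" .
qed

definition coherent where
  "coherent S \<psi> \<longleftrightarrow> (\<forall>\<gamma>\<in>S. bij_betw (\<psi> \<gamma>) (U \<gamma>) (U \<theta>))
    \<and> (\<forall>\<gamma>\<in>S. \<forall>x\<in>U \<gamma>. \<forall>y\<in>U \<gamma>. \<psi> \<gamma> (x \<otimes> y) = \<psi> \<gamma> x \<otimes> \<psi> \<gamma> y)
    \<and> (\<forall>\<gamma>\<in>S. \<forall>\<delta>\<in>S. up \<gamma> \<delta> \<longrightarrow> (\<forall>x\<in>U \<gamma>. \<psi> \<delta> (shift \<gamma> \<delta> x) = \<psi> \<gamma> x))"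

text \<open>The map to \<open>U \<theta>\<close> that is to be defined at \<gamma> does not depend
  on the first upward step. Inner product 1 of the two targets gives a triangle, 0 a square, -1 a
  detour through a third step, and -2 contradicts both targets having inner product 1 with
  \<gamma>.\<close>

lemma coherent_up:
  assumes c: "coherent S \<psi>" and S: "\<And>\<delta>. \<delta> \<in> \<Phi> \<Longrightarrow> w \<bullet> \<gamma> < w \<bullet> \<delta> \<Longrightarrow> \<delta> \<in> S"
    and up: "up \<gamma> \<delta>" "up \<gamma> \<delta>'" and x: "x \<in> U \<gamma>"
  shows "\<psi> \<delta> (shift \<gamma> \<delta> x) = \<psi> \<delta>' (shift \<gamma> \<delta>' x)"
proof -
  have step: "\<psi> \<epsilon> (shift \<delta> \<epsilon> y) = \<psi> \<delta> y" if "up \<gamma> \<delta>" "up \<delta> \<epsilon>" "y \<in> U \<delta>" for \<delta> \<epsilon> y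
  proof -
    have "\<delta> \<in> S" "\<epsilon> \<in> S" using that by (auto simp: up_def intro!: S)
    then show ?thesis using c that unfolding coherent_def by blast
  qed
  have one: "\<psi> \<delta> (shift \<gamma> \<delta> x) = \<psi> \<delta>' (shift \<gamma> \<delta>' x)" if u: "up \<gamma> \<delta>" "up \<gamma> \<delta>'" "\<delta> \<bullet> \<delta>' = 1" for \<delta> \<delta>'
  proof -
    have d: "\<delta> \<in> \<Phi>" "\<delta>' \<in> \<Phi>" "\<delta>' \<bullet> \<delta> = 1" using u by (auto simp: up_def inner_commute)
    have "w \<bullet> (\<delta> - \<delta>') \<noteq> 0" by (rule w_nonzero[OF diff_root[OF d(1,2) u(3)]])
    then consider "up \<delta> \<delta>'" | "up \<delta>' \<delta>" using d u(3) by (force simp: up_def inner_diff_right)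
    then show ?thesis
    proof cases
      case 1
      then show ?thesis using step[OF u(1) 1 shift_closed[OF u(1) x]] shift_triangle[OF u(1) 1 u(2) x] by simp
    next
      case 2
      then show ?thesis using step[OF u(2) 2 shift_closed[OF u(2) x]] shift_triangle[OF u(2) 2 u(1) x] by simp
    qed
  qed
  have zero: "\<psi> \<delta> (shift \<gamma> \<delta> x) = \<psi> \<delta>' (shift \<gamma> \<delta>' x)" if u: "up \<gamma> \<delta>" "up \<gamma> \<delta>'" "\<delta> \<bullet> \<delta>' = 0" for \<delta> \<delta>'
    using shift_square[OF u x] step[OF u(1) _ shift_closed[OF u(1) x]] step[OF u(2) _ shift_closed[OF u(2) x]] by metis
  have d: "\<delta> \<in> \<Phi>" "\<delta>' \<in> \<Phi>" using up by (auto simp: up_def)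
  consider "\<delta> \<bullet> \<delta>' = 2" | "\<delta> \<bullet> \<delta>' = 1" | "\<delta> \<bullet> \<delta>' = 0" | "\<delta> \<bullet> \<delta>' = -1" | "\<delta> \<bullet> \<delta>' = -2"
    using ip_cases[OF d] by blast
  then show ?thesis
  proof cases
    case 1 then show ?thesis using ip_2_iff[OF d] by simp
  next
    case 2 then show ?thesis using one up by blast
  next
    case 3 then show ?thesis using zero up by blast
  next
    case 4
    \<comment> \<open>Inner product 2 forces \<gamma> = \<delta> + \<delta>'. As both summands lie
      above \<gamma>, each has a negative w-value.\<close>
    have g: "\<gamma> \<in> \<Phi>" "\<gamma> \<bullet> (\<delta> + \<delta>') = 2" using up by (auto simp: up_def inner_add_right)
    then have gs: "\<gamma> = \<delta> + \<delta>'" using ip_2_iff[OF g(1) add_root[OF d 4]] by blast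
    have low: "w \<bullet> \<delta> < 0" "w \<bullet> \<delta>' < 0" using up gs by (auto simp: up_def inner_add_right)
    obtain \<epsilon> where e: "\<epsilon> \<in> \<Phi>" "w \<bullet> (\<delta> + \<delta>') < w \<bullet> \<epsilon>"
      "\<epsilon> \<bullet> \<delta> = 1 \<and> \<epsilon> \<bullet> \<delta>' = 0 \<or> \<epsilon> \<bullet> \<delta> = 0 \<and> \<epsilon> \<bullet> \<delta>' = 1"
      by (rule third_upper_neighbour[OF d 4 low])
    then have ue: "up \<gamma> \<epsilon>" using g by (auto simp: up_def gs inner_add_left inner_add_right inner_commute[of _ \<epsilon>])
    show ?thesis using e(3) one[OF up(1) ue] zero[OF up(1) ue] one[OF up(2) ue] zero[OF up(2) ue]
      by (auto simp: inner_commute[of _ \<epsilon>])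
  next
    case 5
    then have "\<delta> = - \<delta>'" using ip_m2_iff[OF d] by simp
    then show ?thesis using up by (auto simp: up_def)
  qed
qed

text \<open>\<open>S\<close> contains all roots above \<gamma> and none below, so only steps leaving
  \<gamma> have to be made compatible. At \<theta> there are none, and the identity starts the
  construction.\<close>

lemma coherent_step:
  assumes c: "coherent S \<psi>" and S: "\<And>\<delta>. \<delta> \<in> \<Phi> \<Longrightarrow> w \<bullet> \<gamma> < w \<bullet> \<delta> \<Longrightarrow> \<delta> \<in> S"
    and min: "\<And>\<delta>. \<delta> \<in> S \<Longrightarrow> w \<bullet> \<gamma> \<le> w \<bullet> \<delta>" and g: "\<gamma> \<in> \<Phi>"
  shows "\<exists>\<psi>'. coherent (insert \<gamma> S) \<psi>'"
proof -
  have "\<exists>f. bij_betw f (U \<gamma>) (U \<theta>) \<and> (\<forall>x\<in>U \<gamma>. \<forall>y\<in>U \<gamma>. f (x \<otimes> y) = f x \<otimes> f y)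
     \<and> (\<forall>\<delta>\<in>S. up \<gamma> \<delta> \<longrightarrow> (\<forall>x\<in>U \<gamma>. \<psi> \<delta> (shift \<gamma> \<delta> x) = f x))"
  proof (cases "\<gamma> = \<theta>")
    case True
    have "\<not> up \<gamma> \<delta>" for \<delta>
    proof
      assume u: "up \<gamma> \<delta>"
      then have "\<theta> \<bullet> \<delta> = 1" "\<theta> \<bullet> \<gamma> = 2" "\<delta> \<in> \<Phi>" using True \<theta> norm_root by (auto simp: up_def)
      then have "w \<bullet> \<delta> < w \<bullet> \<gamma>" using w_near[of \<delta>] w_near[OF g] by linarith
      then show False using u by (simp add: up_def)
    qed
    then show ?thesis using True by (intro exI[of _ "\<lambda>x. x"]) (simp add: bij_betw_def)
  next
    case False
    obtain \<delta> where d: "\<delta> \<in> \<Phi>" "\<delta> \<bullet> \<gamma> = 1" "w \<bullet> \<gamma> < w \<bullet> \<delta>" using upper_neighbour[OF g False] by blast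
    have dS: "\<delta> \<in> S" using S d by blast
    have u: "up \<gamma> \<delta>" using d g by (simp add: up_def inner_commute)
    show ?thesis
    proof (intro exI[of _ "\<lambda>x. \<psi> \<delta> (shift \<gamma> \<delta> x)"] conjI ballI impI)
      show "bij_betw (\<lambda>x. \<psi> \<delta> (shift \<gamma> \<delta> x)) (U \<gamma>) (U \<theta>)"
        using bij_betw_trans[OF shift_bij[OF u], of "\<psi> \<delta>" "U \<theta>"] c dS by (simp add: coherent_def comp_def)
      show "\<psi> \<delta> (shift \<gamma> \<delta> (x \<otimes> y)) = \<psi> \<delta> (shift \<gamma> \<delta> x) \<otimes> \<psi> \<delta> (shift \<gamma> \<delta> y)"
        if "x \<in> U \<gamma>" "y \<in> U \<gamma>" for x y
        using c dS that shift_closed[OF u] by (simp add: shift_mult[OF u] coherent_def)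
      show "\<psi> \<delta>' (shift \<gamma> \<delta>' x) = \<psi> \<delta> (shift \<gamma> \<delta> x)" if "up \<gamma> \<delta>'" "x \<in> U \<gamma>" for \<delta>' x
        by (rule coherent_up[OF c S that(1) u that(2)])
    qed
  qed
  then obtain f where f: "bij_betw f (U \<gamma>) (U \<theta>)" "\<forall>x\<in>U \<gamma>. \<forall>y\<in>U \<gamma>. f (x \<otimes> y) = f x \<otimes> f y"
     "\<forall>\<delta>\<in>S. up \<gamma> \<delta> \<longrightarrow> (\<forall>x\<in>U \<gamma>. \<psi> \<delta> (shift \<gamma> \<delta> x) = f x)" by blast
  have nu: "\<not> up \<delta> \<gamma>" if "\<delta> \<in> insert \<gamma> S" for \<delta> using min that by (force simp: up_def)
  have "coherent (insert \<gamma> S) (\<psi>(\<gamma> := f))"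
    unfolding coherent_def
  proof (intro conjI ballI impI)
    fix \<delta> assume d: "\<delta> \<in> insert \<gamma> S"
    show "bij_betw ((\<psi>(\<gamma> := f)) \<delta>) (U \<delta>) (U \<theta>)"
      using d f(1) c by (auto simp: coherent_def)
    show "(\<psi>(\<gamma> := f)) \<delta> (x \<otimes> y) = (\<psi>(\<gamma> := f)) \<delta> x \<otimes> (\<psi>(\<gamma> := f)) \<delta> y" if "x \<in> U \<delta>" "y \<in> U \<delta>" for x y
      using that d f(2) c by (auto simp: coherent_def)
    show "(\<psi>(\<gamma> := f)) \<epsilon> (shift \<delta> \<epsilon> x) = (\<psi>(\<gamma> := f)) \<delta> x"
      if "\<epsilon> \<in> insert \<gamma> S" "up \<delta> \<epsilon>" "x \<in> U \<delta>" for \<epsilon> x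
    proof -
      have "\<epsilon> \<noteq> \<gamma>" using nu d that by blast
      then show ?thesis using that d f(3) c by (cases "\<delta> = \<gamma>") (auto simp: coherent_def)
    qed
  qed
  then show ?thesis by blast
qed

lemma coherent_exists: "\<exists>\<psi>. coherent \<Phi> \<psi>"
proof -
  have "\<exists>\<psi>. coherent S \<psi>"
    if "S \<subseteq> \<Phi>" "\<forall>\<gamma>\<in>S. \<forall>\<delta>\<in>\<Phi>. w \<bullet> \<gamma> < w \<bullet> \<delta> \<longrightarrow> \<delta> \<in> S" for S
    using finite_subset[OF that(1) finite_roots] that
  proof (induction S rule: finite_psubset_induct)
    case (psubset S)
    show ?case
    proof (cases "S = {}")
      case True then show ?thesis by (simp add: coherent_def)
    next
      case False
      then obtain \<gamma> where g: "\<gamma> \<in> S" "\<forall>\<delta>\<in>S. - (w \<bullet> \<delta>) \<le> - (w \<bullet> \<gamma>)"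
        using finite_maximal_value[OF psubset.hyps(1), of "\<lambda>x. - (w \<bullet> x)"] by blast
      define S' where "S' = S - {\<gamma>}"
      have S': "S' \<subset> S" "S' \<subseteq> \<Phi>" "\<forall>\<delta>\<in>S'. \<forall>\<epsilon>\<in>\<Phi>. w \<bullet> \<delta> < w \<bullet> \<epsilon> \<longrightarrow> \<epsilon> \<in> S'"
        using g psubset.prems by (force simp: S'_def)+
      from psubset.IH[OF this] obtain \<psi> where c: "coherent S' \<psi>" by blast
      have "\<exists>\<psi>'. coherent (insert \<gamma> S') \<psi>'"
        by (rule coherent_step[OF c]) (use g psubset.prems in \<open>auto simp: S'_def\<close>)
      moreover have "insert \<gamma> S' = S" using g by (auto simp: S'_def)
      ultimately show ?thesis by simp
    qed
  qed
  then show ?thesis by simp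
qed

end

section \<open>The commutative ring on the top root subgroup\<close>

locale graded_product_coordinates = graded_product_units +
  fixes \<psi>
  assumes coherent: "coherent \<Phi> \<psi>"
begin

definition \<phi> where "\<phi> \<alpha> = inv_into (U \<alpha>) (\<psi> \<alpha>)"

lemma U_one: "\<alpha> \<in> \<Phi> \<Longrightarrow> \<one> \<in> U \<alpha>"
  by (rule subgroup.one_closed[OF U_sub])

lemma U_m_closed: "\<alpha> \<in> \<Phi> \<Longrightarrow> x \<in> U \<alpha> \<Longrightarrow> y \<in> U \<alpha> \<Longrightarrow> x \<otimes> y \<in> U \<alpha>"
  by (rule subgroup.m_closed[OF U_sub])

lemma psi_bij: "\<alpha> \<in> \<Phi> \<Longrightarrow> bij_betw (\<psi> \<alpha>) (U \<alpha>) (U \<theta>)"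
  using coherent unfolding coherent_def by blast

lemma psi_mult: "\<alpha> \<in> \<Phi> \<Longrightarrow> x \<in> U \<alpha> \<Longrightarrow> y \<in> U \<alpha> \<Longrightarrow> \<psi> \<alpha> (x \<otimes> y) = \<psi> \<alpha> x \<otimes> \<psi> \<alpha> y"
  using coherent unfolding coherent_def by blast

lemma psi_shift: "up \<alpha> \<beta> \<Longrightarrow> x \<in> U \<alpha> \<Longrightarrow> \<psi> \<beta> (shift \<alpha> \<beta> x) = \<psi> \<alpha> x"
  using coherent unfolding coherent_def up_def by blast

lemma psi_closed: "\<alpha> \<in> \<Phi> \<Longrightarrow> x \<in> U \<alpha> \<Longrightarrow> \<psi> \<alpha> x \<in> U \<theta>"
  using psi_bij bij_betwE by blast

lemma phi_bij: "\<alpha> \<in> \<Phi> \<Longrightarrow> bij_betw (\<phi> \<alpha>) (U \<theta>) (U \<alpha>)"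
  unfolding \<phi>_def by (rule bij_betw_inv_into[OF psi_bij])

lemma phi_closed: "\<alpha> \<in> \<Phi> \<Longrightarrow> a \<in> U \<theta> \<Longrightarrow> \<phi> \<alpha> a \<in> U \<alpha>"
  using phi_bij bij_betwE by blast

lemma psi_phi: "\<alpha> \<in> \<Phi> \<Longrightarrow> a \<in> U \<theta> \<Longrightarrow> \<psi> \<alpha> (\<phi> \<alpha> a) = a"
  unfolding \<phi>_def by (rule bij_betw_inv_into_right[OF psi_bij])

lemma phi_psi: "\<alpha> \<in> \<Phi> \<Longrightarrow> x \<in> U \<alpha> \<Longrightarrow> \<phi> \<alpha> (\<psi> \<alpha> x) = x"
  unfolding \<phi>_def by (rule bij_betw_inv_into_left[OF psi_bij])

lemma phi_mult:
  assumes "\<alpha> \<in> \<Phi>" "a \<in> U \<theta>" "b \<in> U \<theta>" shows "\<phi> \<alpha> (a \<otimes> b) = \<phi> \<alpha> a \<otimes> \<phi> \<alpha> b"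
proof -
  note c = phi_closed[OF assms(1,2)] phi_closed[OF assms(1,3)]
  have "\<psi> \<alpha> (\<phi> \<alpha> a \<otimes> \<phi> \<alpha> b) = a \<otimes> b"
    using psi_mult[OF assms(1) c] psi_phi[OF assms(1)] assms(2,3) by simp
  then show ?thesis using phi_psi[OF assms(1) U_m_closed[OF assms(1) c]] by simp
qed

lemma phi_shift:
  assumes "up \<alpha> \<beta>" "a \<in> U \<theta>" shows "\<phi> \<beta> a = shift \<alpha> \<beta> (\<phi> \<alpha> a)"
proof -
  have r: "\<alpha> \<in> \<Phi>" "\<beta> \<in> \<Phi>" using assms by (auto simp: up_def)
  note c = phi_closed[OF r(1) assms(2)]
  have "\<psi> \<beta> (shift \<alpha> \<beta> (\<phi> \<alpha> a)) = a" using psi_shift[OF assms(1) c] psi_phi[OF r(1) assms(2)] by simp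
  then show ?thesis using phi_psi[OF r(2) shift_closed[OF assms(1) c]] by simp
qed

definition prod_at where
  "prod_at \<alpha> \<beta> a b = \<psi> (\<alpha> + \<beta>) (mul \<alpha> \<beta> (\<phi> \<alpha> a) (\<phi> \<beta> b))"

text \<open>Replacing \<gamma> by \<delta> multiplies the left factor by
  \<open>u (\<delta> - \<gamma>)\<close>. Since \<delta> - \<gamma> is orthogonal to \<beta>,
  associativity pulls this element out of the product, where it is the shift from \<gamma> + \<beta>
  to \<delta> + \<beta> and is invisible in \<open>U \<theta>\<close>.\<close>

lemma prod_at_up:
  assumes up: "up \<gamma> \<delta>" and b: "\<beta> \<in> \<Phi>" "\<gamma> \<bullet> \<beta> = -1" "\<delta> \<bullet> \<beta> = -1" and xy: "x \<in> U \<theta>" "y \<in> U \<theta>"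
  shows "prod_at \<gamma> \<beta> x y = prod_at \<delta> \<beta> x y"
proof -
  have r: "\<gamma> \<in> \<Phi>" "\<delta> \<in> \<Phi>" "\<gamma> \<bullet> \<delta> = 1" "w \<bullet> \<gamma> < w \<bullet> \<delta>" using up by (auto simp: up_def)
  have i: "(\<delta> - \<gamma>) \<bullet> \<beta> = 0" using b by (simp add: inner_diff_left)
  note s = add_root[OF r(1) b(1,2)] add_root[OF r(2) b(1,3)]
  have up': "up (\<gamma> + \<beta>) (\<delta> + \<beta>)"
    using s r b by (auto simp: up_def inner_add_left inner_add_right norm_root inner_commute[of \<beta> \<gamma>] inner_commute[of \<beta> \<delta>] inner_commute[of \<delta> \<gamma>])
  have m: "mul \<gamma> \<beta> (\<phi> \<gamma> x) (\<phi> \<beta> y) \<in> U (\<gamma> + \<beta>)"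
    by (rule mul_closed[OF r(1) b(1,2) phi_closed[OF r(1) xy(1)] phi_closed[OF b(1) xy(2)]])
  have "mul \<delta> \<beta> (\<phi> \<delta> x) (\<phi> \<beta> y) = mul ((\<delta> - \<gamma>) + \<gamma>) \<beta> (mul (\<delta> - \<gamma>) \<gamma> (u (\<delta> - \<gamma>)) (\<phi> \<gamma> x)) (\<phi> \<beta> y)"
    using phi_shift[OF up xy(1)] by (simp add: shift_def)
  also have "\<dots> = mul (\<delta> - \<gamma>) (\<gamma> + \<beta>) (u (\<delta> - \<gamma>)) (mul \<gamma> \<beta> (\<phi> \<gamma> x) (\<phi> \<beta> y))"
    by (rule mul_assoc[OF up_diff(2)[OF up] r(1) b(1) up_diff(3)[OF up] b(2) i up_diff(5)[OF up]
          phi_closed[OF r(1) xy(1)] phi_closed[OF b(1) xy(2)]])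
  also have "\<dots> = shift (\<gamma> + \<beta>) (\<delta> + \<beta>) (mul \<gamma> \<beta> (\<phi> \<gamma> x) (\<phi> \<beta> y))"
    by (simp add: shift_def)
  finally show ?thesis using psi_shift[OF up' m] by (simp add: prod_at_def)
qed

lemma prod_at_left:
  assumes r: "\<gamma> \<in> \<Phi>" "\<delta> \<in> \<Phi>" "\<beta> \<in> \<Phi>" "\<gamma> \<bullet> \<beta> = -1" "\<delta> \<bullet> \<beta> = -1" "\<gamma> \<bullet> \<delta> = 1" and xy: "x \<in> U \<theta>" "y \<in> U \<theta>"
  shows "prod_at \<gamma> \<beta> x y = prod_at \<delta> \<beta> x y"
proof -
  have "w \<bullet> (\<gamma> - \<delta>) \<noteq> 0" by (rule w_nonzero[OF diff_root[OF r(1,2,6)]])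
  moreover have "\<delta> \<bullet> \<gamma> = 1" using r by (simp add: inner_commute)
  ultimately have "up \<gamma> \<delta> \<or> up \<delta> \<gamma>" using r by (auto simp: up_def inner_diff_right)
  then show ?thesis using prod_at_up[OF _ r(3,4,5) xy] prod_at_up[OF _ r(3,5,4) xy] by auto
qed

lemma prod_at_swap:
  assumes "\<alpha> \<in> \<Phi>" "\<beta> \<in> \<Phi>" "\<alpha> \<bullet> \<beta> = -1" "x \<in> U \<theta>" "y \<in> U \<theta>"
  shows "prod_at \<beta> \<alpha> y x = prod_at \<alpha> \<beta> x y"
  using mul_sym[OF assms(1-3) phi_closed[OF assms(1,4)] phi_closed[OF assms(2,5)]]
  by (simp add: prod_at_def add.commute)

lemma prod_at_const:
  assumes "\<alpha> \<in> \<Phi>" "\<beta> \<in> \<Phi>" "\<alpha> \<bullet> \<beta> = -1" "\<alpha>' \<in> \<Phi>" "\<beta>' \<in> \<Phi>" "\<alpha>' \<bullet> \<beta>' = -1"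
  shows "\<forall>x\<in>U \<theta>. \<forall>y\<in>U \<theta>. prod_at \<alpha>' \<beta>' x y = prod_at \<alpha> \<beta> x y"
proof (rule pairs_connected[of "\<lambda>\<alpha>' \<beta>'. \<forall>x\<in>U \<theta>. \<forall>y\<in>U \<theta>. prod_at \<alpha>' \<beta>' x y = prod_at \<alpha> \<beta> x y", OF _ assms])
  fix \<gamma> \<delta> \<beta>'' assume r: "\<gamma> \<in> \<Phi>" "\<delta> \<in> \<Phi>" "\<beta>'' \<in> \<Phi>" "\<gamma> \<bullet> \<beta>'' = -1" "\<delta> \<bullet> \<beta>'' = -1" "\<gamma> \<bullet> \<delta> = 1"
  show "\<forall>x\<in>U \<theta>. \<forall>y\<in>U \<theta>. prod_at \<delta> \<beta>'' x y = prod_at \<alpha> \<beta> x y"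
    if "\<forall>x\<in>U \<theta>. \<forall>y\<in>U \<theta>. prod_at \<gamma> \<beta>'' x y = prod_at \<alpha> \<beta> x y"
    using that prod_at_left[OF r] by simp
  show "\<forall>x\<in>U \<theta>. \<forall>y\<in>U \<theta>. prod_at \<beta>'' \<delta> x y = prod_at \<alpha> \<beta> x y"
    if "\<forall>x\<in>U \<theta>. \<forall>y\<in>U \<theta>. prod_at \<beta>'' \<gamma> x y = prod_at \<alpha> \<beta> x y"
    using that prod_at_left[OF r] prod_at_swap[OF r(1,3,4)] prod_at_swap[OF r(2,3,5)] by simp
qed auto

lemma coordinate_ring_aux:
  "\<exists>(K :: 'b ring) f. cring K
     \<and> (\<forall>\<alpha>\<in>\<Phi>. bij_betw (f \<alpha>) (carrier K) (U \<alpha>))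
     \<and> (\<forall>\<alpha>\<in>\<Phi>. \<forall>x\<in>carrier K. \<forall>y\<in>carrier K. f \<alpha> (x \<oplus>\<^bsub>K\<^esub> y) = f \<alpha> x \<otimes> f \<alpha> y)
     \<and> (\<forall>\<alpha>\<in>\<Phi>. \<forall>\<beta>\<in>\<Phi>. \<alpha> \<bullet> \<beta> = -1 \<longrightarrow> (\<forall>x\<in>carrier K. \<forall>y\<in>carrier K.
           mul \<alpha> \<beta> (f \<alpha> x) (f \<beta> y) = f (\<alpha> + \<beta>) (x \<otimes>\<^bsub>K\<^esub> y)))"
proof -
  obtain \<rho> \<sigma> where rs: "\<rho> \<in> \<Phi>" "\<sigma> \<in> \<Phi>" "\<rho> \<bullet> \<sigma> = -1" using some_D4 by blast
  define B where "B = prod_at \<rho> \<sigma>"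
  have B: "prod_at \<alpha> \<beta> x y = B x y" if "\<alpha> \<in> \<Phi>" "\<beta> \<in> \<Phi>" "\<alpha> \<bullet> \<beta> = -1" "x \<in> U \<theta>" "y \<in> U \<theta>" for \<alpha> \<beta> x y
    using prod_at_const[OF rs that(1-3)] that(4,5) by (simp add: B_def)
  have mul_phi: "mul \<alpha> \<beta> (\<phi> \<alpha> x) (\<phi> \<beta> y) = \<phi> (\<alpha> + \<beta>) (B x y)"
    if "\<alpha> \<in> \<Phi>" "\<beta> \<in> \<Phi>" "\<alpha> \<bullet> \<beta> = -1" "x \<in> U \<theta>" "y \<in> U \<theta>" for \<alpha> \<beta> x y
    using B[OF that] phi_psi[OF add_root[OF that(1-3)] mul_closed[OF that(1-3) phi_closed[OF that(1,4)] phi_closed[OF that(2,5)]]]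
    by (simp add: prod_at_def)
  have B_cl: "B x y \<in> U \<theta>" if "x \<in> U \<theta>" "y \<in> U \<theta>" for x y
    unfolding B_def prod_at_def
    by (rule psi_closed[OF add_root[OF rs] mul_closed[OF rs phi_closed[OF rs(1) that(1)] phi_closed[OF rs(2) that(2)]]])
  have B_comm: "B x y = B y x" if "x \<in> U \<theta>" "y \<in> U \<theta>" for x y
  proof -
    have i: "\<sigma> \<bullet> \<rho> = -1" using rs by (simp add: inner_commute)
    show ?thesis using prod_at_swap[OF rs that] B[OF rs(2,1) i that(2,1)] by (simp add: B_def)
  qed
  have B_assoc: "B (B x y) z = B x (B y z)" if xyz: "x \<in> U \<theta>" "y \<in> U \<theta>" "z \<in> U \<theta>" for x y z
  proof -
    \<comment> \<open>Three factors require a chain of type A3, on which both bracketings are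
      defined.\<close>
    obtain \<tau> where t: "\<tau> \<in> \<Phi>" "\<tau> \<bullet> \<rho> = 0" "\<tau> \<bullet> \<sigma> = -1" using A3_extension[OF rs] by blast
    have i: "\<sigma> \<bullet> \<tau> = -1" "\<rho> \<bullet> \<tau> = 0" "(\<rho> + \<sigma>) \<bullet> \<tau> = -1" "\<rho> \<bullet> (\<sigma> + \<tau>) = -1"
      using rs t by (auto simp: inner_add_left inner_add_right inner_commute[of _ \<tau>])
    note r = add_root[OF rs] add_root[OF rs(2) t(1) i(1)]
    note r3 = add_root[OF r(1) t(1) i(3)]
    have "\<phi> (\<rho> + \<sigma> + \<tau>) (B (B x y) z) = mul (\<rho> + \<sigma>) \<tau> (mul \<rho> \<sigma> (\<phi> \<rho> x) (\<phi> \<sigma> y)) (\<phi> \<tau> z)"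
      using mul_phi[OF rs xyz(1,2)] mul_phi[OF r(1) t(1) i(3) B_cl[OF xyz(1,2)] xyz(3)] by simp
    also have "\<dots> = mul \<rho> (\<sigma> + \<tau>) (\<phi> \<rho> x) (mul \<sigma> \<tau> (\<phi> \<sigma> y) (\<phi> \<tau> z))"
      by (rule mul_assoc[OF rs(1,2) t(1) rs(3) i(1,2) phi_closed[OF rs(1) xyz(1)] phi_closed[OF rs(2) xyz(2)] phi_closed[OF t(1) xyz(3)]])
    also have "\<dots> = \<phi> (\<rho> + \<sigma> + \<tau>) (B x (B y z))"
      using mul_phi[OF rs(2) t(1) i(1) xyz(2,3)] mul_phi[OF rs(1) r(2) i(4) xyz(1) B_cl[OF xyz(2,3)]] by (simp add: add.assoc)
    finally have "\<psi> (\<rho> + \<sigma> + \<tau>) (\<phi> (\<rho> + \<sigma> + \<tau>) (B (B x y) z)) = \<psi> (\<rho> + \<sigma> + \<tau>) (\<phi> (\<rho> + \<sigma> + \<tau>) (B x (B y z)))"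
      by simp
    then show ?thesis using psi_phi[OF r3] B_cl xyz by simp
  qed
  have B_distr: "B (x \<otimes> y) z = B x z \<otimes> B y z" if xyz: "x \<in> U \<theta>" "y \<in> U \<theta>" "z \<in> U \<theta>" for x y z
    using mul_left[OF rs phi_closed[OF rs(1) xyz(1)] phi_closed[OF rs(1) xyz(2)] phi_closed[OF rs(2) xyz(3)]]
      psi_mult[OF add_root[OF rs] mul_closed[OF rs phi_closed[OF rs(1) xyz(1)] phi_closed[OF rs(2) xyz(3)]]
         mul_closed[OF rs phi_closed[OF rs(1) xyz(2)] phi_closed[OF rs(2) xyz(3)]]]
      phi_mult[OF rs(1) xyz(1,2)] by (simp add: B_def prod_at_def)
  have "\<theta> \<in> pos \<or> - \<theta> \<in> pos" using w_nonzero[OF \<theta>] \<theta> by (auto simp: pos_iff)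
  then obtain \<epsilon> where e: "\<epsilon> \<in> pos" by blast
  have er: "\<epsilon> \<in> \<Phi>" "w \<bullet> \<epsilon> > 0" "u \<epsilon> \<in> U \<epsilon>" using e W_U u_W by (auto simp: pos_iff)
  \<comment> \<open>Multiplication by \<open>u \<epsilon>\<close> from \<beta> to \<epsilon> +
    \<beta> is a shift, and shifts become the identity in coordinates. So this element is the one of
    the ring.\<close>
  define I where "I = \<psi> \<epsilon> (u \<epsilon>)"
  have I_cl: "I \<in> U \<theta>" unfolding I_def by (rule psi_closed[OF er(1,3)])
  have B_one: "B I x = x" if x: "x \<in> U \<theta>" for x
  proof -
    obtain \<beta> where b: "\<beta> \<in> \<Phi>" "\<epsilon> \<bullet> \<beta> = -1" using neighbour_exists[OF er(1)] by blast
    have up: "up \<beta> (\<epsilon> + \<beta>)"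
      using add_root[OF er(1) b] b er by (auto simp: up_def inner_add_right norm_root inner_commute[of \<beta> \<epsilon>])
    have "B I x = \<psi> (\<epsilon> + \<beta>) (mul \<epsilon> \<beta> (u \<epsilon>) (\<phi> \<beta> x))"
      using B[OF er(1) b I_cl x] phi_psi[OF er(1,3)] by (simp add: prod_at_def I_def)
    also have "\<dots> = \<psi> (\<epsilon> + \<beta>) (shift \<beta> (\<epsilon> + \<beta>) (\<phi> \<beta> x))" by (simp add: shift_def)
    also have "\<dots> = x" using psi_shift[OF up phi_closed[OF b(1) x]] psi_phi[OF b(1) x] by simp
    finally show ?thesis .
  qed
  define K :: "'b ring" where "K = \<lparr>carrier = U \<theta>, mult = B, one = I, zero = \<one>, add = (\<lambda>x y. x \<otimes> y)\<rparr>"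
  have c: "x \<in> carrier G" if "x \<in> U \<theta>" for x using that subgroup.mem_carrier[OF U_sub[OF \<theta>]] by blast
  have "cring K"
  proof (rule cringI)
    show "abelian_group K"
    proof (rule abelian_groupI)
      fix x assume "x \<in> carrier K"
      then have x: "x \<in> U \<theta>" by (simp add: K_def)
      have "inv x \<in> U \<theta>" by (rule subgroup.m_inv_closed[OF U_sub[OF \<theta>] x])
      then show "\<exists>y\<in>carrier K. y \<oplus>\<^bsub>K\<^esub> x = \<zero>\<^bsub>K\<^esub>"
        using c[OF x] by (intro bexI[of _ "inv x"]) (auto simp: K_def)
    next
      fix x y assume "x \<in> carrier K" "y \<in> carrier K"
      then show "x \<oplus>\<^bsub>K\<^esub> y = y \<oplus>\<^bsub>K\<^esub> x" using U_comm[OF \<theta>, of x y] by (simp add: K_def)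
    qed (use U_m_closed[OF \<theta>] U_one[OF \<theta>] c in \<open>auto simp: K_def m_assoc\<close>)
    show "comm_monoid K"
    proof (rule comm_monoidI)
      fix x y assume "x \<in> carrier K" "y \<in> carrier K"
      then show "x \<otimes>\<^bsub>K\<^esub> y = y \<otimes>\<^bsub>K\<^esub> x" using B_comm[of x y] by (simp add: K_def)
    qed (use B_cl I_cl B_assoc B_one in \<open>auto simp: K_def\<close>)
  qed (use B_distr in \<open>auto simp: K_def\<close>)
  moreover have "carrier K = U \<theta>" "\<And>x y. x \<oplus>\<^bsub>K\<^esub> y = x \<otimes> y" "\<And>x y. x \<otimes>\<^bsub>K\<^esub> y = B x y" by (auto simp: K_def)
  ultimately show ?thesis using phi_bij phi_mult mul_phi
    by (intro exI[of _ K] exI[of _ \<phi>]) simp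
qed

end

context graded_product
begin

lemma coordinate_ring:
  "\<exists>(K :: 'g ring) f. cring K
     \<and> (\<forall>\<alpha>\<in>\<Phi>. bij_betw (f \<alpha>) (carrier K) (U \<alpha>))
     \<and> (\<forall>\<alpha>\<in>\<Phi>. \<forall>x\<in>carrier K. \<forall>y\<in>carrier K. f \<alpha> (x \<oplus>\<^bsub>K\<^esub> y) = f \<alpha> x \<otimes> f \<alpha> y)
     \<and> (\<forall>\<alpha>\<in>\<Phi>. \<forall>\<beta>\<in>\<Phi>. \<alpha> \<bullet> \<beta> = -1 \<longrightarrow> (\<forall>x\<in>carrier K. \<forall>y\<in>carrier K.
           mul \<alpha> \<beta> (f \<alpha> x) (f \<beta> y) = f (\<alpha> + \<beta>) (x \<otimes>\<^bsub>K\<^esub> y)))"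
proof -
  obtain \<theta> where t: "\<theta> \<in> \<Phi>" using some_D4 by blast
  obtain w where "\<And>\<gamma>. \<gamma> \<in> \<Phi> \<Longrightarrow> w \<bullet> \<gamma> \<noteq> 0" "\<And>\<gamma>. \<gamma> \<in> \<Phi> \<Longrightarrow> \<bar>w \<bullet> \<gamma> - \<theta> \<bullet> \<gamma>\<bar> < 1/2"
    using generic_functional[of \<theta>] by blast
  then interpret graded_product_functional \<Phi> G U mul W \<theta> w
    using t by unfold_locales
  obtain u where u: "\<forall>\<gamma>\<in>pos. u \<gamma> \<in> W \<gamma>" "\<forall>\<alpha>\<in>pos. \<forall>\<beta>\<in>pos. \<alpha> \<bullet> \<beta> = -1 \<longrightarrow> mul \<alpha> \<beta> (u \<alpha>) (u \<beta>) = u (\<alpha> + \<beta>)"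
    using unit_system by blast
  interpret graded_product_units \<Phi> G U mul W \<theta> w u
    by unfold_locales (use u in blast)+
  obtain \<psi> where p: "coherent \<Phi> \<psi>" using coherent_exists by blast
  interpret graded_product_coordinates \<Phi> G U mul W \<theta> w u \<psi>
    by unfold_locales (rule p)
  show ?thesis by (rule coordinate_ring_aux)
qed

end

section \<open>Signs removed from the commutators and put back\<close>

locale graded_by_signs = graded_by +
  fixes N :: "'a \<Rightarrow> 'a \<Rightarrow> int"
  assumes N_sign: "\<alpha> \<in> \<Phi> \<Longrightarrow> \<beta> \<in> \<Phi> \<Longrightarrow> \<alpha> \<bullet> \<beta> = -1 \<Longrightarrow> N \<alpha> \<beta> \<in> {-1, 1}"
    and N_anti: "\<alpha> \<in> \<Phi> \<Longrightarrow> \<beta> \<in> \<Phi> \<Longrightarrow> \<alpha> \<bullet> \<beta> = -1 \<Longrightarrow> N \<beta> \<alpha> = - N \<alpha> \<beta>"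
    and N_cocycle: "\<alpha> \<in> \<Phi> \<Longrightarrow> \<beta> \<in> \<Phi> \<Longrightarrow> \<gamma> \<in> \<Phi> \<Longrightarrow> \<alpha> \<bullet> \<beta> = -1 \<Longrightarrow> \<beta> \<bullet> \<gamma> = -1 \<Longrightarrow> \<alpha> \<bullet> \<gamma> = 0 \<Longrightarrow>
        N \<alpha> \<beta> * N (\<alpha> + \<beta>) \<gamma> = N \<beta> \<gamma> * N \<alpha> (\<beta> + \<gamma>)"
begin

definition smul where "smul \<alpha> \<beta> x y = (if N \<alpha> \<beta> = 1 then comm x y else inv (comm x y))"

text \<open>Inverses are included because a sign -1 in \<open>smul\<close> replaces a commutator by
  its inverse.\<close>

definition weyl_parts where
  "weyl_parts \<beta> = {b. \<exists>n c. weyl_pair \<beta> n c \<and> (b = c \<or> b = inv c)}"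

lemma smul_closed:
  assumes "\<alpha> \<in> \<Phi>" "\<beta> \<in> \<Phi>" "\<alpha> \<bullet> \<beta> = -1" "x \<in> U \<alpha>" "y \<in> U \<beta>"
  shows "smul \<alpha> \<beta> x y \<in> U (\<alpha> + \<beta>)"
  using comm_closed[OF assms] U_closed(2)[OF add_root[OF assms(1-3)]] by (simp add: smul_def)

lemma smul_sym:
  assumes "\<alpha> \<in> \<Phi>" "\<beta> \<in> \<Phi>" "\<alpha> \<bullet> \<beta> = -1" "x \<in> U \<alpha>" "y \<in> U \<beta>"
  shows "smul \<beta> \<alpha> y x = smul \<alpha> \<beta> x y"
proof -
  have c: "x \<in> carrier G" "y \<in> carrier G" using U_carrier assms by auto
  show ?thesis
    using N_sign[OF assms(1-3)] N_anti[OF assms(1-3)] comm_swap[OF c] c by (auto simp: smul_def)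
qed

lemma smul_left:
  assumes "\<alpha> \<in> \<Phi>" "\<beta> \<in> \<Phi>" "\<alpha> \<bullet> \<beta> = -1" "x \<in> U \<alpha>" "x' \<in> U \<alpha>" "y \<in> U \<beta>"
  shows "smul \<alpha> \<beta> (x \<otimes> x') y = smul \<alpha> \<beta> x y \<otimes> smul \<alpha> \<beta> x' y"
proof -
  have c: "x \<in> carrier G" "x' \<in> carrier G" "y \<in> carrier G" using U_carrier assms by auto
  note r = add_root[OF assms(1-3)]
  note m = comm_closed[OF assms(1-4,6)] comm_closed[OF assms(1-3,5,6)]
  show ?thesis
    using comm_bilinear[OF assms] U_abelian[OF r U_closed(2)[OF r m(1)] U_closed(2)[OF r m(2)]] c
    by (simp add: smul_def inv_mult_group)
qed

lemma smul_assoc: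
  assumes "\<alpha> \<in> \<Phi>" "\<beta> \<in> \<Phi>" "\<gamma> \<in> \<Phi>" "\<alpha> \<bullet> \<beta> = -1" "\<beta> \<bullet> \<gamma> = -1" "\<alpha> \<bullet> \<gamma> = 0"
    and xyz: "x \<in> U \<alpha>" "y \<in> U \<beta>" "z \<in> U \<gamma>"
  shows "smul (\<alpha> + \<beta>) \<gamma> (smul \<alpha> \<beta> x y) z = smul \<alpha> (\<beta> + \<gamma>) x (smul \<beta> \<gamma> y z)"
proof -
  note r = add_root[OF assms(1,2,4)] add_root[OF assms(2,3,5)]
  have i: "(\<alpha> + \<beta>) \<bullet> \<gamma> = -1" "\<alpha> \<bullet> (\<beta> + \<gamma>) = -1" using assms(4-6) by (auto simp: inner_add_left inner_add_right)
  note m = comm_closed[OF assms(1,2,4) xyz(1,2)] comm_closed[OF assms(2,3,5) xyz(2,3)]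
  have c: "x \<in> carrier G" "y \<in> carrier G" "z \<in> carrier G"
    using U_carrier[OF assms(1) xyz(1)] U_carrier[OF assms(2) xyz(2)] U_carrier[OF assms(3) xyz(3)] by auto
  have s: "N \<alpha> \<beta> = 1 \<or> N \<alpha> \<beta> = -1" "N (\<alpha> + \<beta>) \<gamma> = 1 \<or> N (\<alpha> + \<beta>) \<gamma> = -1"
    "N \<beta> \<gamma> = 1 \<or> N \<beta> \<gamma> = -1" "N \<alpha> (\<beta> + \<gamma>) = 1 \<or> N \<alpha> (\<beta> + \<gamma>) = -1"
    using N_sign[OF assms(1,2,4)] N_sign[OF r(1) assms(3) i(1)] N_sign[OF assms(2,3,5)] N_sign[OF assms(1) r(2) i(2)] by auto
  \<comment> \<open>The cocycle identity says that both bracketings carry the same product of signs.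
    Inverses can be pulled out of either argument of a commutator, so \<open>comm_assoc\<close>
    decides every case.\<close>
  show ?thesis
    using s N_cocycle[OF assms(1-6)] comm_assoc[OF assms(1-6) xyz] c
      comm_inv_left[OF r(1) assms(3) i(1) m(1) xyz(3)] comm_inv_right[OF assms(1) r(2) i(2) xyz(1) m(2)]
    by (elim disjE) (simp_all add: smul_def)
qed

lemma inv_bij: "\<delta> \<in> \<Phi> \<Longrightarrow> bij_betw (\<lambda>x. inv x) (U \<delta>) (U \<delta>)"
  by (rule bij_betw_byWitness[where f' = "\<lambda>x. inv x"]) (auto simp: U_closed)

text \<open>On \<open>U \<beta>\<close> the commutator with c is conjugation by the Weyl element n,
  hence injective with the reflected root subgroup as image.\<close>

lemma weyl_pair_bij:
  assumes "\<alpha> \<in> \<Phi>" "\<beta> \<in> \<Phi>" "\<alpha> \<bullet> \<beta> = -1" "weyl_pair \<alpha> n c"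
  shows "bij_betw (comm c) (U \<beta>) (U (\<alpha> + \<beta>))"
proof -
  have n: "weyl_element G \<Phi> U \<alpha> n" "\<And>x. x \<in> U \<beta> \<Longrightarrow> n \<otimes> x \<otimes> inv n = comm c x"
    using assms by (auto simp: weyl_pair_def)
  have r: "reflection \<alpha> \<beta> = \<alpha> + \<beta>" using assms by (simp add: reflection_eq inner_commute[of \<beta> \<alpha>])
  have "inj_on (\<lambda>x. n \<otimes> x \<otimes> inv n) (U \<beta>)"
    by (rule inj_onI) (rule conj_inj[OF weyl_element_carrier[OF assms(1) n(1)] U_carrier[OF assms(2)] U_carrier[OF assms(2)]])
  moreover have "(\<lambda>x. n \<otimes> x \<otimes> inv n) ` U \<beta> = U (\<alpha> + \<beta>)"
    using n(1) assms(2) r unfolding weyl_element_def by (auto simp: image_def Setcompr_eq_image)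
  ultimately have "bij_betw (\<lambda>x. n \<otimes> x \<otimes> inv n) (U \<beta>) (U (\<alpha> + \<beta>))" by (simp add: bij_betw_def)
  then show ?thesis using bij_betw_cong[of "U \<beta>" "\<lambda>x. n \<otimes> x \<otimes> inv n" "comm c"] n(2) by blast
qed

lemma graded_product: "graded_product \<Phi> G U smul weyl_parts"
proof (intro graded_product.intro graded_product_axioms.intro simply_laced_axioms group_axioms)
  fix \<alpha> u assume a: "\<alpha> \<in> \<Phi>" "u \<in> weyl_parts \<alpha>"
  then show "u \<in> U \<alpha>" using U_closed(2)[OF a(1)] by (auto simp: weyl_parts_def weyl_pair_def)
next
  fix \<alpha> assume "\<alpha> \<in> \<Phi>"
  then show "\<exists>u. u \<in> weyl_parts \<alpha>" using weyl_pair_exists unfolding weyl_parts_def by blast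
next
  fix \<alpha> \<beta> u v assume r: "\<alpha> \<in> \<Phi>" "\<beta> \<in> \<Phi>" "\<alpha> \<bullet> \<beta> = -1" and uv: "u \<in> weyl_parts \<alpha>" "v \<in> weyl_parts \<beta>"
  obtain n c where nc: "weyl_pair \<alpha> n c" "u = c \<or> u = inv c" using uv(1) by (auto simp: weyl_parts_def)
  obtain m d where md: "weyl_pair \<beta> m d" "v = d \<or> v = inv d" using uv(2) by (auto simp: weyl_parts_def)
  have i: "\<beta> \<bullet> \<alpha> = -1" using r by (simp add: inner_commute)
  have w: "weyl_pair (\<alpha> + \<beta>) (n \<otimes> m \<otimes> inv n) (comm c d)"
    using weyl_pair_conj[OF r(2,1) i nc(1) md(1)] by (simp add: add.commute)
  have cd: "c \<in> U \<alpha>" "d \<in> U \<beta>" using nc md by (auto simp: weyl_pair_def)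
  note c = U_carrier[OF r(1) cd(1)] U_carrier[OF r(2) cd(2)]
  have "smul \<alpha> \<beta> u v = comm c d \<or> smul \<alpha> \<beta> u v = inv (comm c d)"
    using nc(2) md(2) comm_inv_left[OF r cd] comm_inv_right[OF r cd]
      comm_inv_left[OF r cd(1) U_closed(2)[OF r(2) cd(2)]] c
    by (auto simp: smul_def)
  then show "smul \<alpha> \<beta> u v \<in> weyl_parts (\<alpha> + \<beta>)" using w by (auto simp: weyl_parts_def)
next
  fix \<alpha> \<beta> u assume r: "\<alpha> \<in> \<Phi>" "\<beta> \<in> \<Phi>" "\<alpha> \<bullet> \<beta> = -1" and u: "u \<in> weyl_parts \<alpha>"
  obtain n c where nc: "weyl_pair \<alpha> n c" "u = c \<or> u = inv c" using u by (auto simp: weyl_parts_def)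
  have cU: "c \<in> U \<alpha>" using nc by (simp add: weyl_pair_def)
  have b: "bij_betw (comm c) (U \<beta>) (U (\<alpha> + \<beta>))" by (rule weyl_pair_bij[OF r nc(1)])
  have b': "bij_betw (\<lambda>x. inv (comm c x)) (U \<beta>) (U (\<alpha> + \<beta>))"
    using bij_betw_trans[OF b inv_bij[OF add_root[OF r]]] by (simp add: comp_def)
  have cl: "comm c x \<in> carrier G" if "x \<in> U \<beta>" for x
    using U_carrier[OF r(1) cU] U_carrier[OF r(2) that] by simp
  have "(\<forall>x\<in>U \<beta>. smul \<alpha> \<beta> u x = comm c x) \<or> (\<forall>x\<in>U \<beta>. smul \<alpha> \<beta> u x = inv (comm c x))"
    using nc(2) comm_inv_left[OF r cU] cl by (auto simp: smul_def)
  then show "bij_betw (smul \<alpha> \<beta> u) (U \<beta>) (U (\<alpha> + \<beta>))"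
  proof
    assume "\<forall>x\<in>U \<beta>. smul \<alpha> \<beta> u x = comm c x"
    then show ?thesis using bij_betw_cong[of "U \<beta>" "smul \<alpha> \<beta> u" "comm c"] b by simp
  next
    assume "\<forall>x\<in>U \<beta>. smul \<alpha> \<beta> u x = inv (comm c x)"
    then show ?thesis using bij_betw_cong[of "U \<beta>" "smul \<alpha> \<beta> u" "\<lambda>x. inv (comm c x)"] b' by simp
  qed
qed (rule U_subgroup U_abelian smul_closed smul_sym smul_left smul_assoc; assumption)+

lemma steinberg_coordinates:
  "\<exists>(K :: 'b ring) f. cring K \<and> steinberg_family G \<Phi> N K f \<and> root_isos G \<Phi> U K f"
proof -
  obtain K :: "'b ring" and f where K: "cring K"
    and bij: "\<And>\<alpha>. \<alpha> \<in> \<Phi> \<Longrightarrow> bij_betw (f \<alpha>) (carrier K) (U \<alpha>)"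
    and add: "\<And>\<alpha> x y. \<alpha> \<in> \<Phi> \<Longrightarrow> x \<in> carrier K \<Longrightarrow> y \<in> carrier K \<Longrightarrow> f \<alpha> (x \<oplus>\<^bsub>K\<^esub> y) = f \<alpha> x \<otimes> f \<alpha> y"
    and mult: "\<And>\<alpha> \<beta> x y. \<alpha> \<in> \<Phi> \<Longrightarrow> \<beta> \<in> \<Phi> \<Longrightarrow> \<alpha> \<bullet> \<beta> = -1 \<Longrightarrow> x \<in> carrier K \<Longrightarrow> y \<in> carrier K \<Longrightarrow>
           smul \<alpha> \<beta> (f \<alpha> x) (f \<beta> y) = f (\<alpha> + \<beta>) (x \<otimes>\<^bsub>K\<^esub> y)"
    using graded_product.coordinate_ring[OF graded_product] by blast
  interpret K: cring K by fact
  have fU: "f \<alpha> x \<in> U \<alpha>" if "\<alpha> \<in> \<Phi>" "x \<in> carrier K" for \<alpha> x using bij_betwE[OF bij[OF that(1)]] that(2) by blast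
  have fG: "f \<alpha> x \<in> carrier G" if "\<alpha> \<in> \<Phi>" "x \<in> carrier K" for \<alpha> x by (rule U_carrier[OF that(1) fU[OF that]])
  have neg: "f \<alpha> (\<ominus>\<^bsub>K\<^esub> x) = inv (f \<alpha> x)" if "\<alpha> \<in> \<Phi>" "x \<in> carrier K" for \<alpha> x
  proof -
    have "f \<alpha> \<zero>\<^bsub>K\<^esub> \<otimes> f \<alpha> \<zero>\<^bsub>K\<^esub> = f \<alpha> \<zero>\<^bsub>K\<^esub>"
      using add[OF that(1) K.zero_closed K.zero_closed] by simp
    then have z: "f \<alpha> \<zero>\<^bsub>K\<^esub> = \<one>" using fG[OF that(1) K.zero_closed] by simp
    have "f \<alpha> (\<ominus>\<^bsub>K\<^esub> x) \<otimes> f \<alpha> x = \<one>"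
      using add[OF that(1) K.a_inv_closed[OF that(2)] that(2)] that z by (simp add: K.l_neg)
    then show ?thesis using fG that by (intro inv_equality[symmetric]) auto
  qed
  have "steinberg_family G \<Phi> N K f"
    unfolding steinberg_family_def
  proof (intro conjI ballI impI)
    fix \<alpha> x assume "\<alpha> \<in> \<Phi>" "x \<in> carrier K" then show "f \<alpha> x \<in> carrier G" by (rule fG)
  next
    fix \<alpha> x y assume "\<alpha> \<in> \<Phi>" "x \<in> carrier K" "y \<in> carrier K"
    then show "f \<alpha> x \<otimes> f \<alpha> y = f \<alpha> (x \<oplus>\<^bsub>K\<^esub> y)" by (rule add[symmetric])
  next
    fix \<alpha> \<beta> x y assume a: "\<alpha> \<in> \<Phi>" "\<beta> \<in> \<Phi>" "\<alpha> + \<beta> \<in> \<Phi>" and xy: "x \<in> carrier K" "y \<in> carrier K"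
    have i: "\<alpha> \<bullet> \<beta> = -1" using a add_root_iff by blast
    have n: "N \<alpha> \<beta> \<in> {-1, 1}" by (rule N_sign[OF a(1,2) i])
    have c: "comm (f \<alpha> x) (f \<beta> y) \<in> carrier G" using fG a xy by simp
    show "comm (f \<alpha> x) (f \<beta> y) = f (\<alpha> + \<beta>) ([N \<alpha> \<beta>] \<cdot>\<^bsub>K\<^esub> (x \<otimes>\<^bsub>K\<^esub> y))"
    proof (cases "N \<alpha> \<beta> = 1")
      case True
      then show ?thesis using mult[OF a(1,2) i xy] K.add_pow_sign[OF _ n] xy by (simp add: smul_def)
    next
      \<comment> \<open>With sign -1 the product is the inverse commutator; inverses in the root
        subgroup are negatives in the ring, which restores the sign in the Steinberg
        relation.\<close>
      case False
      then have "inv (comm (f \<alpha> x) (f \<beta> y)) = f (\<alpha> + \<beta>) (x \<otimes>\<^bsub>K\<^esub> y)"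
        using mult[OF a(1,2) i xy] by (simp add: smul_def)
      then have "comm (f \<alpha> x) (f \<beta> y) = inv (f (\<alpha> + \<beta>) (x \<otimes>\<^bsub>K\<^esub> y))" using c by (metis inv_inv)
      then show ?thesis using False neg[OF a(3)] K.add_pow_sign[OF _ n] xy by simp
    qed
  next
    fix \<alpha> \<beta> x y assume a: "\<alpha> \<in> \<Phi>" "\<beta> \<in> \<Phi>" "\<beta> \<noteq> - \<alpha> \<and> \<alpha> + \<beta> \<notin> \<Phi>" and xy: "x \<in> carrier K" "y \<in> carrier K"
    have "\<alpha> \<bullet> \<beta> \<noteq> -1" "\<alpha> \<bullet> \<beta> \<noteq> -2" using a add_root_iff[OF a(1,2)] ip_m2_iff[OF a(1,2)] by auto
    \<comment> \<open>Equal roots are among the commuting pairs of the Steinberg relations; they are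
      covered by \<open>U_abelian\<close> and not by the commutator axiom.\<close>
    then have "\<alpha> = \<beta> \<or> \<alpha> \<bullet> \<beta> = 0 \<or> \<alpha> \<bullet> \<beta> = 1" using ip_cases[OF a(1,2)] ip_2_iff[OF a(1,2)] by blast
    then have "f \<alpha> x \<otimes> f \<beta> y = f \<beta> y \<otimes> f \<alpha> x"
      using U_abelian[OF a(1) fU[OF a(1) xy(1)]] commute[OF a(1,2) _ fU[OF a(1) xy(1)] fU[OF a(2) xy(2)]] fU[OF a(2) xy(2)] by auto
    then show "comm (f \<alpha> x) (f \<beta> y) = \<one>" using fG a xy by (intro comm_unique) auto
  qed
  moreover have "root_isos G \<Phi> U K f"
    unfolding root_isos_def iso_def hom_def using bij add fU by auto
  ultimately show ?thesis using K by blast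
qed

end

lemma induces_root_isos_iff:
  "induces_root_isos G \<Phi> U N K Q \<longleftrightarrow> root_isos G \<Phi> U K (\<lambda>\<alpha> x. Q (steinberg_elt \<Phi> N K \<alpha> x))"
  by (simp add: induces_root_isos_def root_isos_def)

text \<open>A homomorphism built from a family agrees with it only for arguments in the carrier of
  the ring, so the property has to be insensitive to other values.\<close>

lemma root_isos_cong:
  assumes K: "cring K" and "\<forall>\<alpha>\<in>\<Phi>. \<forall>x\<in>carrier K. f \<alpha> x = g \<alpha> x"
  shows "root_isos G \<Phi> U K f \<longleftrightarrow> root_isos G \<Phi> U K g"
proof -
  interpret K: cring K by fact
  have "f \<alpha> \<in> iso (add_monoid K) (G\<lparr>carrier := U \<alpha>\<rparr>) \<longleftrightarrow> g \<alpha> \<in> iso (add_monoid K) (G\<lparr>carrier := U \<alpha>\<rparr>)"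
    if a: "\<alpha> \<in> \<Phi>" for \<alpha>
  proof -
    have "bij_betw (f \<alpha>) (carrier K) (U \<alpha>) = bij_betw (g \<alpha>) (carrier K) (U \<alpha>)"
      by (rule bij_betw_cong) (use assms(2) a in blast)
    then show ?thesis using assms(2) a by (auto simp: iso_def hom_def Pi_iff)
  qed
  then show ?thesis by (simp add: root_isos_def)
qed

theorem theorem4:
  fixes l :: nat
    and \<Phi> :: "(real^8) set"
    and sc :: "complex \<Rightarrow> 'l::ab_group_add \<Rightarrow> 'l"
    and br :: "'l \<Rightarrow> 'l \<Rightarrow> 'l"
    and e :: "real^8 \<Rightarrow> 'l"
    and t :: "real^8 \<Rightarrow> complex \<Rightarrow> 'l \<Rightarrow> 'l"
    and N :: "real^8 \<Rightarrow> real^8 \<Rightarrow> int"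
    and G :: "('g, 'c) monoid_scheme"
    and U :: "real^8 \<Rightarrow> 'g set"
  assumes "l \<in> {6, 7, 8}"
    and "\<Phi> = E_roots l"
    and "chevalley_basis \<Phi> sc br e"
    and "root_subgroup_parametrizations \<Phi> sc br e t"
    and "structure_constants (adjoint_chevalley_group \<Phi> sc br e) \<Phi> t N"
    and "root_graded_group G \<Phi> U"
  shows
    "(\<exists>(K :: 'g ring) Q.
        cring K \<and> Q \<in> hom (steinberg_group \<Phi> N K) G \<and> induces_root_isos G \<Phi> U N K Q)
   \<and> (\<forall>(K :: 'k ring) Q (K' :: 'm ring).
        cring K \<and> Q \<in> hom (steinberg_group \<Phi> N K) G \<and> induces_root_isos G \<Phi> U N K Q
        \<and> cring K' \<longrightarrow>
          (\<forall>Q' \<in> hom (steinberg_group \<Phi> N K') G.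
             induces_root_isos G \<Phi> U N K' Q' \<longleftrightarrow>
               (\<exists>F \<in> ring_iso K' K. \<exists>a \<in> adjoint_torus \<Phi> K. twisted_by \<Phi> N K Q K' Q' F a))
        \<and> (\<forall>F \<in> ring_iso K' K. \<forall>a \<in> adjoint_torus \<Phi> K.
             \<exists>Q' \<in> hom (steinberg_group \<Phi> N K') G. twisted_by \<Phi> N K Q K' Q' F a)
        \<and> (\<forall>Q' \<in> hom (steinberg_group \<Phi> N K') G.
             \<forall>F1 \<in> ring_iso K' K. \<forall>F2 \<in> ring_iso K' K.
             \<forall>a1 \<in> adjoint_torus \<Phi> K. \<forall>a2 \<in> adjoint_torus \<Phi> K.
               twisted_by \<Phi> N K Q K' Q' F1 a1 \<and> twisted_by \<Phi> N K Q K' Q' F2 a2 \<longrightarrow>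
                 (\<forall>x \<in> carrier K'. F1 x = F2 x) \<and> a1 = a2))"
proof -
  have laced: "simply_laced \<Phi>" using simply_laced_E[OF assms(1)] assms(2) by simp
  then interpret simply_laced \<Phi> .
  interpret L: simply_laced_chevalley \<Phi> sc br e
    by unfold_locales (rule assms(3))
  note N_facts = L.N_sign[OF assms(4,5)] L.N_anti[OF assms(4,5)] L.N_cocycle[OF assms(4,5)]
  interpret group G using assms(6) by (simp add: root_graded_group_def)
  interpret graded_by_signs \<Phi> G U N
    by unfold_locales (use assms(6) N_facts in blast)+
  show ?thesis
  proof (intro conjI allI impI)
    \<comment> \<open>The ring is carried by a root subgroup of \<open>G\<close>, so its elements
      have the type of group elements.\<close>
    obtain K :: "'g ring" and f where K: "cring K" and f: "steinberg_family G \<Phi> N K f" "root_isos G \<Phi> U K f"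
      using steinberg_coordinates by blast
    obtain Q where Q: "Q \<in> hom (steinberg_group \<Phi> N K) G" "\<forall>\<alpha>\<in>\<Phi>. \<forall>x\<in>carrier K. Q (steinberg_elt \<Phi> N K \<alpha> x) = f \<alpha> x"
      using steinberg_hom_exists[OF cring.axioms(1)[OF K] f(1)] by blast
    have "root_isos G \<Phi> U K (\<lambda>\<alpha> x. Q (steinberg_elt \<Phi> N K \<alpha> x))"
      using root_isos_cong[OF K Q(2)] f(2) by blast
    then show "\<exists>(K :: 'g ring) Q. cring K \<and> Q \<in> hom (steinberg_group \<Phi> N K) G \<and> induces_root_isos G \<Phi> U N K Q"
      using K Q(1) induces_root_isos_iff by blast
  next
    fix K :: "'k ring" and Q and K' :: "'m ring"
    assume asm: "cring K \<and> Q \<in> hom (steinberg_group \<Phi> N K) G \<and> induces_root_isos G \<Phi> U N K Q \<and> cring K'"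
    then have K: "cring K" and K': "cring K'" and Q: "Q \<in> hom (steinberg_group \<Phi> N K) G"
      by auto
    \<comment> \<open>From here on the given homomorphism is represented by its values on the
      generators, so that all claims become statements about families.\<close>
    define f where "f = (\<lambda>\<alpha> x. Q (steinberg_elt \<Phi> N K \<alpha> x))"
    have fam: "steinberg_family G \<Phi> N K f"
      unfolding f_def by (rule steinberg_hom_family[OF cring.axioms(1)[OF K] Q])
    have iso: "root_isos G \<Phi> U K f" using asm induces_root_isos_iff unfolding f_def by blast
    have tw: "twisted_by \<Phi> N K Q K' Q' F a \<longleftrightarrow>
       (\<forall>\<alpha>\<in>\<Phi>. \<forall>x\<in>carrier K'. Q' (steinberg_elt \<Phi> N K' \<alpha> x) = f \<alpha> (a \<alpha> \<otimes>\<^bsub>K\<^esub> F x))" for Q' F a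
      by (simp add: twisted_by_def f_def)
    show "\<forall>Q' \<in> hom (steinberg_group \<Phi> N K') G.
             induces_root_isos G \<Phi> U N K' Q' \<longleftrightarrow>
               (\<exists>F \<in> ring_iso K' K. \<exists>a \<in> adjoint_torus \<Phi> K. twisted_by \<Phi> N K Q K' Q' F a)"
    proof
      fix Q' assume Q': "Q' \<in> hom (steinberg_group \<Phi> N K') G"
      show "induces_root_isos G \<Phi> U N K' Q' \<longleftrightarrow>
               (\<exists>F \<in> ring_iso K' K. \<exists>a \<in> adjoint_torus \<Phi> K. twisted_by \<Phi> N K Q K' Q' F a)"
      proof
        assume i: "induces_root_isos G \<Phi> U N K' Q'"
        have "comparison \<Phi> K K' G N U f (\<lambda>\<alpha> x. Q' (steinberg_elt \<Phi> N K' \<alpha> x))"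
          using K K' fam iso N_sign steinberg_hom_family[OF cring.axioms(1)[OF K'] Q'] i induces_root_isos_iff
          by (intro comparison.intro comparison_axioms.intro laced) blast+
        then show "\<exists>F \<in> ring_iso K' K. \<exists>a \<in> adjoint_torus \<Phi> K. twisted_by \<Phi> N K Q K' Q' F a"
          unfolding tw by (rule comparison.comparison_exists)
      next
        assume "\<exists>F \<in> ring_iso K' K. \<exists>a \<in> adjoint_torus \<Phi> K. twisted_by \<Phi> N K Q K' Q' F a"
        then obtain F a where Fa: "F \<in> ring_iso K' K" "a \<in> adjoint_torus \<Phi> K"
          "\<forall>\<alpha>\<in>\<Phi>. \<forall>x\<in>carrier K'. Q' (steinberg_elt \<Phi> N K' \<alpha> x) = f \<alpha> (a \<alpha> \<otimes>\<^bsub>K\<^esub> F x)"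
          unfolding tw by blast
        show "induces_root_isos G \<Phi> U N K' Q'"
          unfolding induces_root_isos_iff root_isos_cong[OF K' Fa(3)] by (rule twisted_root_isos[OF K iso Fa(1,2)])
      qed
    qed
    show "\<forall>F \<in> ring_iso K' K. \<forall>a \<in> adjoint_torus \<Phi> K.
             \<exists>Q' \<in> hom (steinberg_group \<Phi> N K') G. twisted_by \<Phi> N K Q K' Q' F a"
      unfolding tw
      using steinberg_hom_exists[OF cring.axioms(1)[OF K'] twisted_family[OF N_sign K K' fam]] by blast
    show "\<forall>Q' \<in> hom (steinberg_group \<Phi> N K') G.
             \<forall>F1 \<in> ring_iso K' K. \<forall>F2 \<in> ring_iso K' K.
             \<forall>a1 \<in> adjoint_torus \<Phi> K. \<forall>a2 \<in> adjoint_torus \<Phi> K.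
               twisted_by \<Phi> N K Q K' Q' F1 a1 \<and> twisted_by \<Phi> N K Q K' Q' F2 a2 \<longrightarrow>
                 (\<forall>x \<in> carrier K'. F1 x = F2 x) \<and> a1 = a2"
    proof (intro ballI impI)
      fix Q' F1 F2 a1 a2
      assume F: "F1 \<in> ring_iso K' K" "F2 \<in> ring_iso K' K" and a: "a1 \<in> adjoint_torus \<Phi> K" "a2 \<in> adjoint_torus \<Phi> K"
        and t: "twisted_by \<Phi> N K Q K' Q' F1 a1 \<and> twisted_by \<Phi> N K Q K' Q' F2 a2"
      have "f \<alpha> (a1 \<alpha> \<otimes>\<^bsub>K\<^esub> F1 x) = f \<alpha> (a2 \<alpha> \<otimes>\<^bsub>K\<^esub> F2 x)" if "\<alpha> \<in> \<Phi>" "x \<in> carrier K'" for \<alpha> x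
        using t that unfolding tw by metis
      from twist_unique[OF K K' iso F a this]
      show "(\<forall>x \<in> carrier K'. F1 x = F2 x) \<and> a1 = a2" by blast
    qed
  qed
qed

end
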